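(* Let $d\ge 1$ and let $\Gamma$ be a finite graph with $d+2$ or more vertices. If $\Gamma$ does not have a minimal stress kernel in $\mathbb{E}^d$ (that is, if $k_{\min}(\Gamma,d)\ne d+1$), then any infinitesimally rigid framework $\rho\in C^d(\Gamma)$ is not globally rigid in $\mathbb{E}^d$.
   Context: A graph $\Gamma$ has a finite vertex set $\mathcal V$ of size $v$ and an edge set $\mathcal E$ of size $e$ consisting of two-element subsets of $\mathcal V$. A framework $\rho$ of $\Gamma$ in Euclidean space $\mathbb{E}^d$ is a map $\mathcal V\to\mathbb{E}^d$; $C^d(\Gamma)\cong\mathbb{R}^{vd}$ is the space of all of them. The length-squared map $\ell:C^d(\Gamma)\to\mathbb{R}^e$ has component $|\rho(u)-\rho(w)|^2$ at the edge $\{u,w\}$; $d\ell_\rho$ denotes its Jacobian at $\rho$. For $v\ge d+1$, $\rho$ is infinitesimally rigid if $\operatorname{rank} d\ell_\rho = vd-\binom{d+1}{2}$. Two frameworks are congruent if they differ by a rigid motion (rotations, reflections, translations and their compositions) of $\mathbb{E}^d$. $\rho\in C^d(\Gamma)$ is globally rigid if every $\sigma\in C^d(\Gamma)$ with $\ell(\sigma)=\ell(\rho)$ is congruent to $\rho$. $\rho$ is generic if its $vd$ coordinates satisfy no non-trivial polynomial equation with rational coefficients. An equilibrium stress matrix of $\rho$ is a real symmetric matrix $\Omega$ indexed by $\mathcal V\times\mathcal V$ with $\Omega(u,w)=0$ whenever $u\ne w$ and $\{u,w\}\notin\mathcal E$, with $\sum_{w}\Omega(u,w)=0$ for all $u$,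 and with $\sum_{w}\Omega(u,w)\rho(w)=0$ for all $u$. Let $k_{\min}(\Gamma,d)$ be the minimum of $\dim\ker\Omega$ as $\Omega$ ranges over all equilibrium stress matrices of all generic frameworks in $C^d(\Gamma)$. $\Gamma$ has a minimal stress kernel in $\mathbb{E}^d$ if $k_{\min}(\Gamma,d)=d+1$. *)

theory Defs
  imports "HOL-Analysis.Analysis" "HOL-Library.Poly_Mapping"
begin

text \<open>
  The vertex set of a graph is the whole of a finite type \<open>'v\<close> and the graph is given by its
  edge set \<open>E\<close>. Euclidean \<open>d\<close>-space is \<open>real ^ 'd\<close>, where \<open>d = CARD('d)\<close>, so that the space
  \<open>C\<^sup>d(\<Gamma>)\<close> of frameworks is the Euclidean space \<open>real ^ 'd ^ 'v\<close>.
\<close>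

type_synonym ('d, 'v) framework = "real ^ 'd ^ 'v"

definition is_graph :: "'v::finite set set \<Rightarrow> bool" where
  "is_graph E \<longleftrightarrow> (\<forall>e\<in>E. card e = 2)"

text \<open>
  The map \<open>\<ell>\<close>. The target \<open>\<real>\<^sup>e\<close> is embedded in the space with one coordinate for each set of
  vertices; the coordinates of non-edges are identically 0, which affects neither the fibres
  of \<open>\<ell>\<close> nor the rank of its derivative.
\<close>

definition len_sq :: "'v::finite set set \<Rightarrow> ('d::finite, 'v) framework \<Rightarrow> real ^ 'v set" where
  "len_sq E \<rho> = (\<chi> e. if e \<in> E
      then (THE s. \<exists>u w. e = {u, w} \<and> s = (norm (\<rho> $ u - \<rho> $ w))\<^sup>2) else 0)"

lemma len_sq_edge:
  assumes "{u, w} \<in> E"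
  shows "len_sq E \<rho> $ {u, w} = (norm (\<rho> $ u - \<rho> $ w))\<^sup>2"
proof -
  have "(THE s. \<exists>a b. {u, w} = {a, b} \<and> s = (norm (\<rho> $ a - \<rho> $ b))\<^sup>2) =
      (norm (\<rho> $ u - \<rho> $ w))\<^sup>2"
  proof (rule the_equality)
    fix s
    assume "\<exists>a b. {u, w} = {a, b} \<and> s = (norm (\<rho> $ a - \<rho> $ b))\<^sup>2"
    then show "s = (norm (\<rho> $ u - \<rho> $ w))\<^sup>2"
      by (metis doubleton_eq_iff norm_minus_commute)
  qed blast
  with assms show ?thesis by (simp add: len_sq_def)
qed

lemma len_sq_non_edge: "e \<notin> E \<Longrightarrow> len_sq E \<rho> $ e = 0"
  by (simp add: len_sq_def)

lemma len_sq_differentiable: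
  fixes \<rho> :: "('d::finite, 'v::finite) framework"
  assumes "is_graph E"
  shows "len_sq E differentiable (at \<rho>)"
proof -
  have *: "(\<lambda>\<sigma>. len_sq E \<sigma> $ e) differentiable (at \<rho>)" for e
  proof (cases "e \<in> E")
    case True
    then obtain u w where e: "e = {u, w}"
      using assms unfolding is_graph_def by (metis card_2_iff)
    have "(\<lambda>\<sigma>. (norm (\<sigma> $ u - \<sigma> $ w))\<^sup>2) differentiable (at \<rho>)"
      unfolding power2_norm_eq_inner
      by (intro differentiable_inner differentiable_diff
          bounded_linear_imp_differentiable bounded_linear_vec_nth)
    with True show ?thesis
      by (simp add: e len_sq_edge)
  next
    case False
    then show ?thesis by (simp add: len_sq_non_edge)
  qed
  show ?thesis
  proof (rule iffD2[OF differentiable_componentwise_within], rule ballI)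
    fix b :: "real ^ 'v set"
    assume "b \<in> Basis"
    then obtain e where "b = axis e 1" by (auto simp: Basis_vec_def)
    with *[of e] show "(\<lambda>\<sigma>. len_sq E \<sigma> \<bullet> b) differentiable (at \<rho>)"
      by (simp add: inner_axis)
  qed
qed

definition jacobian_rank :: "'v::finite set set \<Rightarrow> ('d::finite, 'v) framework \<Rightarrow> nat" where
  "jacobian_rank E \<rho> = dim (range (frechet_derivative (len_sq E) (at \<rho>)))"

text \<open>Only meaningful for at least \<open>d + 1\<close> vertices; the subtraction then does not truncate.\<close>

definition infinitesimally_rigid :: "'v::finite set set \<Rightarrow> ('d::finite, 'v) framework \<Rightarrow> bool" where
  "infinitesimally_rigid E \<rho> \<longleftrightarrow>
     jacobian_rank E \<rho> = CARD('v) * CARD('d) - ((CARD('d) + 1) choose 2)"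

definition rigid_motion :: "(real ^ 'd::finite \<Rightarrow> real ^ 'd) \<Rightarrow> bool" where
  "rigid_motion g \<longleftrightarrow> (\<exists>f t. orthogonal_transformation f \<and> g = (\<lambda>x. f x + t))"

definition congruent_frameworks ::
    "('d::finite, 'v::finite) framework \<Rightarrow> ('d, 'v) framework \<Rightarrow> bool" where
  "congruent_frameworks \<rho> \<sigma> \<longleftrightarrow> (\<exists>g. rigid_motion g \<and> (\<forall>u. \<sigma> $ u = g (\<rho> $ u)))"

definition globally_rigid :: "'v::finite set set \<Rightarrow> ('d::finite, 'v) framework \<Rightarrow> bool" where
  "globally_rigid E \<rho> \<longleftrightarrow>
     (\<forall>\<sigma>. len_sq E \<sigma> = len_sq E \<rho> \<longrightarrow> congruent_frameworks \<rho> \<sigma>)"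

text \<open>
  An element of \<open>('i \<Rightarrow>\<^sub>0 nat) \<Rightarrow>\<^sub>0 rat\<close> is a polynomial over the rationals in variables indexed
  by \<open>'i\<close>: it assigns coefficients to monomials, which in turn are given by their exponents.
\<close>

definition eval_poly :: "(('i::finite \<Rightarrow>\<^sub>0 nat) \<Rightarrow>\<^sub>0 rat) \<Rightarrow> ('i \<Rightarrow> real) \<Rightarrow> real" where
  "eval_poly p x = (\<Sum>m\<in>Poly_Mapping.keys p. of_rat (Poly_Mapping.lookup p m) *
     (\<Prod>i\<in>UNIV. x i ^ Poly_Mapping.lookup m i))"

definition generic :: "('d::finite, 'v::finite) framework \<Rightarrow> bool" where
  "generic \<rho> \<longleftrightarrow> (\<forall>p :: ('v \<times> 'd \<Rightarrow>\<^sub>0 nat) \<Rightarrow>\<^sub>0 rat.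
     p \<noteq> 0 \<longrightarrow> eval_poly p (\<lambda>(u, i). \<rho> $ u $ i) \<noteq> 0)"

definition equilibrium_stress_matrix ::
    "'v::finite set set \<Rightarrow> ('d::finite, 'v) framework \<Rightarrow> real ^ 'v ^ 'v \<Rightarrow> bool" where
  "equilibrium_stress_matrix E \<rho> \<Omega> \<longleftrightarrow>
     transpose \<Omega> = \<Omega> \<and>
     (\<forall>u w. u \<noteq> w \<and> {u, w} \<notin> E \<longrightarrow> \<Omega> $ u $ w = 0) \<and>
     (\<forall>u. (\<Sum>w\<in>UNIV. \<Omega> $ u $ w) = 0) \<and>
     (\<forall>u. (\<Sum>w\<in>UNIV. \<Omega> $ u $ w *\<^sub>R \<rho> $ w) = 0)"

text \<open>
  The infimum is a minimum: the zero matrix is an equilibrium stress matrix of every framework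
  and generic frameworks exist. The dimension is passed as \<open>TYPE('d)\<close>.
\<close>

definition k_min :: "'v::finite set set \<Rightarrow> 'd::finite itself \<Rightarrow> nat" where
  "k_min E d = Inf {dim {x. \<Omega> *v x = 0} | \<Omega> (\<rho> :: ('d, 'v) framework).
     generic \<rho> \<and> equilibrium_stress_matrix E \<rho> \<Omega>}"

definition minimal_stress_kernel :: "'v::finite set set \<Rightarrow> 'd::finite itself \<Rightarrow> bool" where
  "minimal_stress_kernel E d \<longleftrightarrow> k_min E d = CARD('d) + 1"

end

theory Submission
  imports Defs
begin

text \<open>
  Global rigidity of an infinitesimally rigid framework is an open condition: if two frameworks
  have the same edge lengths, their difference is an infinitesimal flex of their midpoint. Near a
  globally rigid \<open>\<rho>\<close> we may therefore pick a framework \<open>\<rho>\<^sub>0\<close> and a stress whose matrix has locally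
  maximal rank; by the hypothesis on \<open>k_min\<close> its kernel \<open>K\<close> has dimension at least \<open>d + 2\<close>.
  Deforming the stress to first order, maximality of the rank shows that \<open>\<ell>\<close> maps \<open>K\<^sup>d\<close> into the
  tangent space of \<open>\<ell>(K\<^sup>d)\<close> at \<open>\<ell>(\<rho>\<^sub>0)\<close>. A slice of \<open>K\<^sup>d\<close> for the action of the rigid motions,
  given by a triangular shape of the coordinates, thus carries a proper map \<open>\<real>\<^sup>N \<rightarrow> \<real>\<^sup>N\<close> which is
  not onto, since sums of squared lengths are nonnegative, and which is invariant under sign
  changes of \<open>d\<close> blocks of coordinates. As \<open>dim K \<ge> d + 2\<close>, each block has at least two coordinates, so
  the sign changes act freely in codimension one, and counting modulo 2 on the quotient shows that the fibre of a
  regular value cannot be a single orbit. Global rigidity of \<open>\<rho>\<^sub>0\<close> says that it is one.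
\<close>

section \<open>Kernels of linear maps under perturbation\<close>

text \<open>\<open>\<rho>\<close> is not assumed generic, and \<open>\<rho>\<^sub>0\<close> need not
  be: it is picked by minimality of the kernel over a ball. Genericity enters only when that kernel
  is compared with \<open>k_min\<close>, by perturbing framework and stress together. No regular
  value has to be searched for either: infinitesimal rigidity makes the derivative of the slice map
  at \<open>\<rho>\<^sub>0\<close> injective, so a fibre consisting of the orbit of
  \<open>\<rho>\<^sub>0\<close> alone is already regular. The obstacle is a count modulo 2 on a
  quotient by a group with fixed points. It is carried out with Sperner labels on a triangulation
  preserved by sign changes. Fixed points are harmless there because a sign change that fixes all
  vertices of a facet is trivial, and this is where blocks of size two are used. Slice coordinates
  are normalised so that \<open>\<rho>\<^sub>0\<close> is (1, ..., 1), away from all coordinate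
  hyperplanes; near its orbit the map can then be replaced by the invariant model
  \<open>|y| - 1\<close>, for which the count is explicit.\<close>

lemma dim_orthogonal_complement:
  fixes S :: "'a::euclidean_space set"
  assumes "subspace S"
  shows "dim {q. \<forall>k\<in>S. q \<bullet> k = 0} + dim S = DIM('a)"
proof -
  have "{q \<in> UNIV. \<forall>k\<in>S. orthogonal k q} = {q. \<forall>k\<in>S. q \<bullet> k = 0}"
    by (auto simp: orthogonal_def inner_commute)
  then show ?thesis
    using dim_subspace_orthogonal_to_vectors[OF assms subspace_UNIV subset_UNIV] by simp
qed

lemma subspace_orthogonal_complement: "subspace {q. \<forall>k\<in>S. q \<bullet> k = 0}"
  by (auto simp: subspace_def inner_add_left)

lemma dim_range_kernel:
  fixes A :: "'a::euclidean_space \<Rightarrow> 'b::euclidean_space"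
  assumes "linear A"
  shows "dim (range A) + dim {x. A x = 0} = DIM('a)"
proof -
  let ?K = "{x. A x = 0}" and ?Q = "{q. \<forall>k\<in>{x. A x = 0}. q \<bullet> k = 0}"
  have K: "subspace ?K" using assms by (rule linear_subspace_kernel)
  have "inj_on A ?Q"
  proof (rule inj_onI)
    fix x y assume xy: "x \<in> ?Q" "y \<in> ?Q" "A x = A y"
    then have "x - y \<in> ?K" "x - y \<in> ?Q"
      using assms by (auto simp: linear_diff inner_diff_left)
    then have "(x - y) \<bullet> (x - y) = 0" by blast
    then show "x = y" by simp
  qed
  then have "dim (A ` ?Q) = dim ?Q"
    by (intro dim_image_eq[OF assms]) (simp only: span_eq_iff[THEN iffD2, OF subspace_orthogonal_complement])
  moreover have "A ` ?Q = range A"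
  proof
    show "range A \<subseteq> A ` ?Q"
    proof
      fix y assume "y \<in> range A"
      then obtain x where x: "y = A x" by auto
      obtain k q where kq: "k \<in> span ?K" "\<And>w. w \<in> span ?K \<Longrightarrow> orthogonal q w" "x = k + q"
        using orthogonal_subspace_decomp_exists[of ?K x] by metis
      then have "q \<in> ?Q" by (auto simp: orthogonal_def span_base)
      moreover have "A k = 0" using kq(1) K by (simp add: span_eq_iff[THEN iffD2])
      ultimately show "y \<in> A ` ?Q" using x kq(3) assms by (auto simp: linear_add)
    qed
  qed auto
  ultimately show ?thesis using dim_orthogonal_complement[OF K] by simp
qed

text \<open>The bound makes \<open>B\<close> injective on the complement \<open>?Q\<close> of the
  kernel of \<open>A\<close>, so the kernel of \<open>B\<close> meets \<open>?Q\<close> only in 0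
  and cannot be larger than that of \<open>A\<close>. If the dimensions agree, \<open>?Q\<close> and
  the kernel of \<open>B\<close> span the space, and dropping the \<open>?Q\<close>-component of
  \<open>x\<close> costs at most \<open>norm (B x) / c\<close>.\<close>

lemma kernel_near:
  fixes A B :: "'a::euclidean_space \<Rightarrow> 'b::euclidean_space"
  assumes A: "linear A" and B: "linear B" and c: "0 < c"
    and lb: "\<And>q. (\<And>k. A k = 0 \<Longrightarrow> q \<bullet> k = 0) \<Longrightarrow> c * norm q \<le> norm (B q)"
  shows "dim {x. B x = 0} \<le> dim {x. A x = 0}"
    and "dim {x. A x = 0} \<le> dim {x. B x = 0} \<Longrightarrow> \<exists>x'. B x' = 0 \<and> norm (x - x') \<le> norm (B x) / c"
proof -
  let ?K = "{x. A x = 0}" and ?Q = "{q. \<forall>k\<in>{x. A x = 0}. q \<bullet> k = 0}" and ?L = "{x. B x = 0}"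
  have sub: "subspace ?K" "subspace ?L" "subspace ?Q"
    by (rule linear_subspace_kernel[OF A], rule linear_subspace_kernel[OF B], rule subspace_orthogonal_complement)
  have Q: "c * norm q \<le> norm (B q)" if "q \<in> ?Q" for q using lb that by auto
  have "?Q \<inter> ?L = {0}"
  proof -
    have "q = 0" if "q \<in> ?Q" "B q = 0" for q
      using Q[OF that(1)] that(2) c by (simp add: mult_le_0_iff)
    then show ?thesis using linear_0[OF B] by auto
  qed
  then have *: "dim {x + y |x y. x \<in> ?Q \<and> y \<in> ?L} = dim ?Q + dim ?L"
    using dim_sums_Int[OF sub(3,2)] by simp
  have le: "dim {x + y |x y. x \<in> ?Q \<and> y \<in> ?L} \<le> DIM('a)" by (rule dim_subset_UNIV)
  show "dim ?L \<le> dim ?K" using dim_orthogonal_complement[OF sub(1)] * le by linarith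
  assume "dim ?K \<le> dim ?L"
  then have "dim {x + y |x y. x \<in> ?Q \<and> y \<in> ?L} = DIM('a)"
    using * le dim_orthogonal_complement[OF sub(1)] by linarith
  then have "{x + y |x y. x \<in> ?Q \<and> y \<in> ?L} = UNIV"
    using dim_eq_full[of "{x + y |x y. x \<in> ?Q \<and> y \<in> ?L}"] subspace_sums[OF sub(3,2)]
    by (simp add: span_eq_iff[THEN iffD2])
  then obtain q x' where qx: "q \<in> ?Q" "B x' = 0" "x = q + x'" by blast
  have "B x = B q" using qx B by (simp add: linear_add)
  then have "norm q \<le> norm (B x) / c" using Q[OF qx(1)] c by (simp add: pos_le_divide_eq mult.commute)
  then show "\<exists>x'. B x' = 0 \<and> norm (x - x') \<le> norm (B x) / c" using qx by (intro exI[of _ x']) auto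
qed

text \<open>The perturbation tool for \<open>edge_form\<close>, \<open>stress_map\<close> and
  \<open>laplacian\<close> alike, in place of an implicit function argument: nullity is upper
  semicontinuous, and where it does not drop, an approximate kernel vector can be corrected to an
  exact one at a cost linear in its residual.\<close>

lemma bilinear_kernel_stable:
  fixes f :: "'p::real_normed_vector \<Rightarrow> 'a::euclidean_space \<Rightarrow> 'b::euclidean_space"
  assumes f: "bounded_bilinear f"
  obtains \<epsilon> C where "0 < \<epsilon>" "0 \<le> C"
    "\<And>p. norm (p - p0) < \<epsilon> \<Longrightarrow> dim {x. f p x = 0} \<le> dim {x. f p0 x = 0}"
    "\<And>p x. norm (p - p0) < \<epsilon> \<Longrightarrow> dim {x. f p0 x = 0} \<le> dim {x. f p x = 0} \<Longrightarrow>
       \<exists>x'. f p x' = 0 \<and> norm (x - x') \<le> C * norm (f p x)"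
proof -
  interpret bounded_bilinear f by fact
  have lin: "linear (f p)" for p using bounded_linear_right bounded_linear.linear by blast
  let ?Q = "{q. \<forall>k\<in>{x. f p0 x = 0}. q \<bullet> k = 0}"
  have "\<forall>x\<in>?Q. f p0 x = 0 \<longrightarrow> x = 0" by auto
  then obtain c where c: "0 < c" "\<And>q. q \<in> ?Q \<Longrightarrow> c * norm q \<le> norm (f p0 q)"
    using injective_imp_isometric[OF closed_subspace[OF subspace_orthogonal_complement]
        subspace_orthogonal_complement bounded_linear_right, of "{x. f p0 x = 0}" p0]
    by (auto simp: mult.commute)
  obtain M where M: "0 < M" "\<And>a b. norm (f a b) \<le> norm a * norm b * M" using pos_bounded by blast
  \<comment> \<open>Within this radius the perturbation changes \<open>f p0 q\<close> by at most
    \<open>c / 2 * norm q\<close>, half of the lower bound on \<open>?Q\<close>.\<close>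
  let ?\<epsilon> = "c / (2 * M)"
  have lb: "c / 2 * norm q \<le> norm (f p q)" if p: "norm (p - p0) < ?\<epsilon>" and q: "\<And>k. f p0 k = 0 \<Longrightarrow> q \<bullet> k = 0" for p q
  proof -
    have "norm (f p0 q) \<le> norm (f p q) + norm (f (p - p0) q)"
      using norm_triangle_ineq4[of "f p q" "f (p - p0) q"] by (simp add: diff_left)
    also have "norm (f (p - p0) q) \<le> ?\<epsilon> * norm q * M"
      using M(2)[of "p - p0" q] p M(1) by (smt (verit, best) mult_right_mono norm_ge_zero)
    also have "?\<epsilon> * norm q * M = c / 2 * norm q" using M(1) by simp
    finally show ?thesis using c(2)[of q] q by auto
  qed
  show ?thesis
  proof
    show "0 < ?\<epsilon>" "0 \<le> 2 / c" using c M by auto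
    fix p assume p: "norm (p - p0) < ?\<epsilon>"
    show "dim {x. f p x = 0} \<le> dim {x. f p0 x = 0}"
      by (rule kernel_near(1)[OF lin lin, of "c / 2"]) (use c lb[OF p] in auto)
    fix x assume "dim {x. f p0 x = 0} \<le> dim {x. f p x = 0}"
    then have "\<exists>x'. f p x' = 0 \<and> norm (x - x') \<le> norm (f p x) / (c / 2)"
      by (intro kernel_near(2)[OF lin lin, of "c / 2"]) (use c lb[OF p] in auto)
    then show "\<exists>x'. f p x' = 0 \<and> norm (x - x') \<le> 2 / c * norm (f p x)" by (simp add: mult.commute)
  qed
qed

section \<open>The length form and weighted Laplacians\<close>

text \<open>The coordinate at an edge \<open>{u, w}\<close> is \<open>(\<sigma> u - \<sigma> w) \<bullet> (\<tau> u - \<tau> w)\<close>, written symmetrically in \<open>u\<close> and \<open>w\<close>.\<close>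

definition edge_form :: "'v::finite set set \<Rightarrow> 'a::real_inner ^ 'v \<Rightarrow> 'a ^ 'v \<Rightarrow> real ^ 'v set" where
  "edge_form E \<sigma> \<tau> = (\<chi> e. if e \<in> E
     then 2 * (\<Sum>u\<in>e. \<sigma> $ u \<bullet> \<tau> $ u) - (\<Sum>u\<in>e. \<sigma> $ u) \<bullet> (\<Sum>u\<in>e. \<tau> $ u) else 0)"

lemma edge_form_edge:
  assumes "{u, w} \<in> E" "u \<noteq> w"
  shows "edge_form E \<sigma> \<tau> $ {u, w} = (\<sigma> $ u - \<sigma> $ w) \<bullet> (\<tau> $ u - \<tau> $ w)"
  using assms by (simp add: edge_form_def inner_add_left inner_add_right inner_diff_left inner_diff_right)

lemma edge_form_non_edge: "e \<notin> E \<Longrightarrow> edge_form E \<sigma> \<tau> $ e = 0"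
  by (simp add: edge_form_def)

lemma edge_form_eqI:
  assumes "is_graph E" "\<And>u w. {u, w} \<in> E \<Longrightarrow> u \<noteq> w \<Longrightarrow> edge_form E \<sigma> \<tau> $ {u, w} = y $ {u, w}" "\<And>e. e \<notin> E \<Longrightarrow> y $ e = 0"
  shows "edge_form E \<sigma> \<tau> = y"
proof (rule iffD2[OF vec_eq_iff], rule allI)
  fix e
  show "edge_form E \<sigma> \<tau> $ e = y $ e"
  proof (cases "e \<in> E")
    case True
    then obtain u w where "e = {u, w}" "u \<noteq> w" using assms(1) unfolding is_graph_def by (metis card_2_iff)
    then show ?thesis using assms(2) True by simp
  qed (use assms(3) in \<open>simp add: edge_form_non_edge\<close>)
qed

lemma len_sq_eq_edge_form: "is_graph E \<Longrightarrow> len_sq E \<sigma> = edge_form E \<sigma> \<sigma>"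
  by (rule sym, rule edge_form_eqI) (auto simp: edge_form_edge len_sq_edge len_sq_non_edge power2_norm_eq_inner)

lemma edge_form_commute: "edge_form E \<sigma> \<tau> = edge_form E \<tau> \<sigma>"
  unfolding edge_form_def by (subst inner_commute, subst (2) inner_commute) (rule refl)

lemma edge_form_const: "(\<And>u. \<sigma> $ u = c) \<Longrightarrow> is_graph E \<Longrightarrow> edge_form E \<sigma> \<tau> = 0"
  by (rule edge_form_eqI) (auto simp: edge_form_edge)

lemma bounded_bilinear_edge_form: "bounded_bilinear (edge_form E :: ('a::euclidean_space ^ 'v::finite \<Rightarrow> _))"
proof (rule iffD1[OF bilinear_conv_bounded_bilinear])
  show "bilinear (edge_form E :: ('a ^ 'v \<Rightarrow> _))"
    unfolding bilinear_def
    by (intro conjI allI linearI; rule iffD2[OF vec_eq_iff])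
      (auto simp: edge_form_def inner_add_left inner_add_right sum.distrib algebra_simps
        simp flip: scaleR_sum_right sum_distrib_left)
qed

lemmas edge_form_simps =
  bounded_bilinear.add_left[OF bounded_bilinear_edge_form] bounded_bilinear.add_right[OF bounded_bilinear_edge_form]
  bounded_bilinear.diff_left[OF bounded_bilinear_edge_form] bounded_bilinear.diff_right[OF bounded_bilinear_edge_form]
  bounded_bilinear.minus_left[OF bounded_bilinear_edge_form] bounded_bilinear.minus_right[OF bounded_bilinear_edge_form]
  bounded_bilinear.scaleR_left[OF bounded_bilinear_edge_form] bounded_bilinear.scaleR_right[OF bounded_bilinear_edge_form]
  bounded_bilinear.zero_left[OF bounded_bilinear_edge_form] bounded_bilinear.zero_right[OF bounded_bilinear_edge_form]

lemmas edge_form_sum_left = bounded_bilinear.sum_left[OF bounded_bilinear_edge_form]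
lemmas edge_form_sum_right = bounded_bilinear.sum_right[OF bounded_bilinear_edge_form]

lemma linear_edge_form: "linear (edge_form E \<sigma>)" for \<sigma> :: "'a::euclidean_space ^ 'v::finite"
  using bounded_bilinear.bounded_linear_right[OF bounded_bilinear_edge_form] bounded_linear.linear by blast

text \<open>By polarisation the derivative at \<open>\<rho>\<close> is twice
  \<open>edge_form E \<rho>\<close>, and the factor 2 does not change the range.\<close>

lemma jacobian_rank_eq:
  fixes \<rho> :: "('d::finite, 'v::finite) framework"
  assumes "is_graph E"
  shows "jacobian_rank E \<rho> = dim (range (edge_form E \<rho>))"
proof -
  have "len_sq E = (\<lambda>\<sigma> :: ('d, 'v) framework. edge_form E \<sigma> \<sigma>)" using len_sq_eq_edge_form[OF assms] by auto
  then have "(len_sq E has_derivative (\<lambda>\<tau>. edge_form E \<rho> \<tau> + edge_form E \<tau> \<rho>)) (at \<rho>)"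
    using bounded_bilinear.FDERIV[OF bounded_bilinear_edge_form has_derivative_ident has_derivative_ident, of E \<rho> UNIV] by simp
  moreover have "(\<lambda>\<tau>. edge_form E \<rho> \<tau> + edge_form E \<tau> \<rho>) = (\<lambda>\<tau>. 2 *\<^sub>R edge_form E \<rho> \<tau>)"
    by (auto simp: edge_form_commute[of E _ \<rho>] scaleR_2)
  ultimately have "frechet_derivative (len_sq E) (at \<rho>) = (\<lambda>\<tau>. 2 *\<^sub>R edge_form E \<rho> \<tau>)"
    using frechet_derivative_at by (metis (no_types, lifting))
  moreover have "range (\<lambda>\<tau>. 2 *\<^sub>R edge_form E \<rho> \<tau>) = range (edge_form E \<rho>)"
  proof
    show "range (\<lambda>\<tau>. 2 *\<^sub>R edge_form E \<rho> \<tau>) \<subseteq> range (edge_form E \<rho>)"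
      by (auto simp flip: edge_form_simps(8))
    show "range (edge_form E \<rho>) \<subseteq> range (\<lambda>\<tau>. 2 *\<^sub>R edge_form E \<rho> \<tau>)"
    proof
      fix y assume "y \<in> range (edge_form E \<rho>)"
      then obtain \<tau> where "y = edge_form E \<rho> \<tau>" by auto
      then have "y = 2 *\<^sub>R edge_form E \<rho> ((1/2) *\<^sub>R \<tau>)" by (simp add: edge_form_simps)
      then show "y \<in> range (\<lambda>\<tau>. 2 *\<^sub>R edge_form E \<rho> \<tau>)" by blast
    qed
  qed
  ultimately show ?thesis by (simp add: jacobian_rank_def)
qed

text \<open>Lengths are sums of scalar forms over the coordinates. Hence one matrix acts on every
  coordinate function separately, and changing the sign of a single coordinate preserves all
  lengths.\<close>

lemma edge_form_columns:
  fixes \<sigma> \<tau> :: "('d::finite, 'v::finite) framework"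
  shows "edge_form E \<sigma> \<tau> = (\<Sum>i\<in>UNIV. edge_form E (column i \<sigma>) (column i \<tau>))"
proof (rule iffD2[OF vec_eq_iff], rule allI)
  fix e
  have "(\<Sum>u\<in>e. \<sigma> $ u \<bullet> \<tau> $ u) = (\<Sum>i\<in>UNIV. \<Sum>u\<in>e. \<sigma> $ u $ i * \<tau> $ u $ i)"
    unfolding inner_vec_def by (subst sum.swap) simp
  then show "edge_form E \<sigma> \<tau> $ e = (\<Sum>i\<in>UNIV. edge_form E (column i \<sigma>) (column i \<tau>)) $ e"
    by (simp add: edge_form_def column_def inner_vec_def sum_subtractf sum_distrib_left)
qed

text \<open>The stress matrix with weights \<open>\<omega>\<close>: at an edge its entry is
  \<open>- \<omega> $ {u, w}\<close>. As the matrix of the form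
  \<open>\<omega> \<bullet> edge_form E f g\<close> it is visibly symmetric and linear in
  \<open>\<omega>\<close>.\<close>

definition laplacian :: "'v::finite set set \<Rightarrow> real ^ 'v set \<Rightarrow> real ^ 'v ^ 'v" where
  "laplacian E \<omega> = (\<chi> u w. \<omega> \<bullet> edge_form E (axis u 1 :: real ^ 'v) (axis w 1))"

lemma vec_axis_sum: "f = (\<Sum>u\<in>UNIV. f $ u *\<^sub>R axis u 1)" for f :: "real ^ 'v::finite"
  by (simp add: vec_eq_iff axis_def if_distrib sum.delta cong: if_cong)

lemma laplacian_inner:
  fixes f g :: "real ^ 'v::finite"
  shows "(laplacian E \<omega> *v f) \<bullet> g = \<omega> \<bullet> edge_form E f g"
proof -
  have "edge_form E f g = (\<Sum>u\<in>UNIV. \<Sum>w\<in>UNIV. (f $ u * g $ w) *\<^sub>R edge_form E (axis u 1 :: real ^ 'v) (axis w 1))"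
    by (subst vec_axis_sum[of f], subst vec_axis_sum[of g], subst edge_form_sum_left, subst edge_form_sum_right)
      (simp add: edge_form_simps mult.commute)
  then have "\<omega> \<bullet> edge_form E f g = (\<Sum>u\<in>UNIV. \<Sum>w\<in>UNIV. f $ u * g $ w * laplacian E \<omega> $ u $ w)"
    by (simp add: inner_sum_right laplacian_def)
  also have "\<dots> = (\<Sum>u\<in>UNIV. \<Sum>w\<in>UNIV. f $ u * g $ w * laplacian E \<omega> $ w $ u)"
    by (simp add: laplacian_def edge_form_commute)
  also have "\<dots> = (laplacian E \<omega> *v f) \<bullet> g"
    unfolding matrix_vector_mult_def inner_vec_def
    by (subst sum.swap) (simp add: sum_distrib_left sum_distrib_right mult_ac)
  finally show ?thesis ..
qed

lemma transpose_laplacian: "transpose (laplacian E \<omega>) = laplacian E \<omega>"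
  by (simp add: transpose_def laplacian_def edge_form_commute)

lemma laplacian_symmetric: "(laplacian E \<omega> *v f) \<bullet> g = f \<bullet> (laplacian E \<omega> *v g)"
  by (metis laplacian_inner edge_form_commute inner_commute)

lemma laplacian_const: "is_graph E \<Longrightarrow> laplacian E \<omega> *v (\<chi> u. c) = 0"
  by (rule vector_eq_rdot[THEN iffD1]) (simp add: laplacian_inner edge_form_const)

lemma laplacian_non_edge:
  fixes E :: "'v::finite set set"
  assumes "is_graph E" "u \<noteq> w" "{u, w} \<notin> E"
  shows "laplacian E \<omega> $ u $ w = 0"
proof -
  have "edge_form E (axis u 1 :: real ^ 'v) (axis w 1 :: real ^ 'v) = 0"
  proof (rule edge_form_eqI[OF assms(1)])
    fix x y assume xy: "{x, y} \<in> E" "x \<noteq> y"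
    then show "edge_form E (axis u 1 :: real ^ 'v) (axis w 1) $ {x, y} = 0 $ {x, y}"
      using assms(2,3) by (auto simp: edge_form_edge axis_def doubleton_eq_iff insert_commute)
  qed simp
  then show ?thesis by (simp add: laplacian_def)
qed

lemma bounded_bilinear_laplacian: "bounded_bilinear (\<lambda>\<omega> f. laplacian E \<omega> *v f)"
proof (rule iffD1[OF bilinear_conv_bounded_bilinear])
  show "bilinear (\<lambda>\<omega> f. laplacian E \<omega> *v f)"
    unfolding bilinear_def
    by (intro conjI allI linearI)
      (auto simp: laplacian_def matrix_vector_mult_def vec_eq_iff inner_add_left algebra_simps sum.distrib
          simp flip: sum_distrib_left)
qed

text \<open>The adjoint of \<open>edge_form E \<rho>\<close>, that is, the transposed rigidity
  matrix; its kernel consists of the equilibrium stresses. Coordinates of \<open>\<omega>\<close> at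
  non-edges are free in the kernel and do not enter \<open>laplacian E \<omega>\<close>.\<close>

definition stress_map :: "'v::finite set set \<Rightarrow> ('d::finite, 'v) framework \<Rightarrow> real ^ 'v set \<Rightarrow> ('d, 'v) framework" where
  "stress_map E \<rho> \<omega> = laplacian E \<omega> ** \<rho>"

lemma column_stress_map: "column i (stress_map E \<rho> \<omega>) = laplacian E \<omega> *v column i \<rho>"
  by (simp add: stress_map_def column_def matrix_matrix_mult_def matrix_vector_mult_def)

lemma inner_columns: "\<sigma> \<bullet> \<tau> = (\<Sum>i\<in>UNIV. column i \<sigma> \<bullet> column i \<tau>)"
  for \<sigma> \<tau> :: "('d::finite, 'v::finite) framework"
  unfolding inner_vec_def column_def by (subst sum.swap) simp

lemma stress_map_inner: "stress_map E \<rho> \<omega> \<bullet> \<tau> = \<omega> \<bullet> edge_form E \<rho> \<tau>"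
  by (simp add: inner_columns column_stress_map laplacian_inner edge_form_columns[of E \<rho>] inner_sum_right)

lemma stress_map_eq_0: "stress_map E \<rho> \<omega> = 0 \<longleftrightarrow> (\<forall>i. laplacian E \<omega> *v column i \<rho> = 0)"
  by (simp add: column_stress_map[symmetric]) (auto simp: column_def vec_eq_iff)

lemma bounded_bilinear_stress_map: "bounded_bilinear (stress_map E)"
proof (rule iffD1[OF bilinear_conv_bounded_bilinear])
  show "bilinear (stress_map E)"
    unfolding bilinear_def
    by (intro conjI allI linearI)
      (auto simp: stress_map_def laplacian_def matrix_matrix_mult_def vec_eq_iff inner_add_left algebra_simps sum.distrib
          simp flip: sum_distrib_left)
qed

lemma equilibrium_stress_matrix_laplacian:
  fixes \<rho> :: "('d::finite, 'v::finite) framework"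
  assumes "is_graph E" "stress_map E \<rho> \<omega> = 0"
  shows "equilibrium_stress_matrix E \<rho> (laplacian E \<omega>)"
proof -
  have "(\<Sum>w\<in>UNIV. laplacian E \<omega> $ u $ w) = 0" for u
    using laplacian_const[OF assms(1), of \<omega> 1] by (simp add: matrix_vector_mult_def vec_eq_iff)
  moreover have "(\<Sum>w\<in>UNIV. laplacian E \<omega> $ u $ w *\<^sub>R \<rho> $ w) = 0" for u
    using assms(2) by (simp add: stress_map_def matrix_matrix_mult_def vec_eq_iff)
  ultimately show ?thesis
    unfolding equilibrium_stress_matrix_def
    using transpose_laplacian laplacian_non_edge[OF assms(1)] by blast
qed

section \<open>Generic frameworks\<close>

lemma eval_poly_superset:
  assumes "finite S" "Poly_Mapping.keys p \<subseteq> S"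
  shows "eval_poly p x = (\<Sum>m\<in>S. of_rat (Poly_Mapping.lookup p m) * (\<Prod>i\<in>UNIV. x i ^ Poly_Mapping.lookup m i))"
  unfolding eval_poly_def using assms
  by (intro sum.mono_neutral_left) (auto simp: in_keys_iff)

lemma eval_poly_add: "eval_poly (p + q) x = eval_poly p x + eval_poly q x"
proof -
  let ?S = "Poly_Mapping.keys p \<union> Poly_Mapping.keys q"
  have S: "finite ?S" by simp
  show ?thesis
    by (subst (1 2 3) eval_poly_superset[OF S])
      (auto simp: Poly_Mapping.keys_add lookup_add of_rat_add distrib_right sum.distrib)
qed

lemma eval_poly_single:
  "eval_poly (Poly_Mapping.single m c) x = of_rat c * (\<Prod>i\<in>UNIV. x i ^ Poly_Mapping.lookup m i)"
  by (cases "c = 0") (auto simp: eval_poly_def)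

lemma poly_mapping_induct_single:
  fixes p :: "'a \<Rightarrow>\<^sub>0 'b::comm_monoid_add"
  assumes "\<And>m c. P (Poly_Mapping.single m c)" "\<And>p q. P p \<Longrightarrow> P q \<Longrightarrow> P (p + q)"
  shows "P p"
proof -
  have "P (\<Sum>m\<in>K. Poly_Mapping.single m (Poly_Mapping.lookup p m))" if "finite K" for K
    using that
  proof (induction K rule: finite_induct)
    case empty
    then show ?case using assms(1)[of _ 0] by simp
  qed (auto intro: assms)
  moreover have "p = (\<Sum>m\<in>Poly_Mapping.keys p. Poly_Mapping.single m (Poly_Mapping.lookup p m))"
    by (rule poly_mapping_eqI) (simp add: lookup_sum lookup_single when_def in_keys_iff)
  ultimately show ?thesis by (metis finite_keys)
qed

lemma eval_poly_mult: "eval_poly (p * q) x = eval_poly p x * eval_poly q x"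
proof (induction p rule: poly_mapping_induct_single)
  case (1 m c)
  show ?case
    by (induction q rule: poly_mapping_induct_single)
      (simp_all add: mult_single eval_poly_single of_rat_mult lookup_add power_add prod.distrib
        distrib_left eval_poly_add)
qed (simp add: distrib_right eval_poly_add)

section \<open>Rational polynomial functions and the affine span of generic frameworks\<close>

definition polyfun :: "(('i::finite \<Rightarrow> real) \<Rightarrow> real) \<Rightarrow> bool" where
  "polyfun f \<longleftrightarrow> (\<exists>p. \<forall>x. eval_poly p x = f x)"

lemma polyfun_const: "polyfun (\<lambda>x. of_rat c)"
  unfolding polyfun_def by (intro exI[of _ "Poly_Mapping.single 0 c"]) (simp add: eval_poly_single)

lemma polyfun_proj: "polyfun (\<lambda>x. x i)"
proof -
  have "(\<Prod>j\<in>UNIV. x j ^ Poly_Mapping.lookup (Poly_Mapping.single i 1) j) = x i" for x :: "'a \<Rightarrow> real"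
    by (subst prod.remove[of _ i]) (auto simp: lookup_single when_def)
  then show ?thesis
    unfolding polyfun_def
    by (intro exI[of _ "Poly_Mapping.single (Poly_Mapping.single i 1) 1"]) (simp add: eval_poly_single)
qed

lemma polyfun_add: "polyfun f \<Longrightarrow> polyfun g \<Longrightarrow> polyfun (\<lambda>x. f x + g x)"
  unfolding polyfun_def by (metis eval_poly_add)

lemma polyfun_mult: "polyfun f \<Longrightarrow> polyfun g \<Longrightarrow> polyfun (\<lambda>x. f x * g x)"
  unfolding polyfun_def by (metis eval_poly_mult)

lemma polyfun_of_int: "polyfun (\<lambda>x. of_int n)"
  using polyfun_const[of "of_int n"] by simp

lemma polyfun_diff: "polyfun f \<Longrightarrow> polyfun g \<Longrightarrow> polyfun (\<lambda>x. f x - g x)"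
  using polyfun_add[of f "\<lambda>x. of_int (-1) * g x"] polyfun_mult[OF polyfun_of_int[of "-1"], of g] by simp

lemma polyfun_sum: "finite A \<Longrightarrow> (\<And>a. a \<in> A \<Longrightarrow> polyfun (f a)) \<Longrightarrow> polyfun (\<lambda>x. \<Sum>a\<in>A. f a x)"
proof (induction A rule: finite_induct)
  case empty
  then show ?case using polyfun_of_int[of 0] by simp
qed (auto intro: polyfun_add)

lemma polyfun_prod: "finite A \<Longrightarrow> (\<And>a. a \<in> A \<Longrightarrow> polyfun (f a)) \<Longrightarrow> polyfun (\<lambda>x. \<Prod>a\<in>A. f a x)"
proof (induction A rule: finite_induct)
  case empty
  then show ?case using polyfun_of_int[of 1] by simp
qed (auto intro: polyfun_mult)

text \<open>One framework \<open>\<sigma>\<close> with a nonzero value rules out the zero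
  polynomial, so nondegeneracy of all generic frameworks can be read off from a single convenient
  example.\<close>

lemma generic_polyfun:
  fixes \<rho> \<sigma> :: "('d::finite, 'v::finite) framework"
  assumes "generic \<rho>" "polyfun f" "f (\<lambda>(u, i). \<sigma> $ u $ i) \<noteq> 0"
  shows "f (\<lambda>(u, i). \<rho> $ u $ i) \<noteq> 0"
proof -
  obtain p where p: "\<And>x. eval_poly p x = f x" using assms(2) unfolding polyfun_def by blast
  have "p \<noteq> 0" using p[of "\<lambda>(u, i). \<sigma> $ u $ i"] assms(3) by (auto simp: eval_poly_def)
  then show ?thesis using assms(1) p unfolding generic_def by metis
qed

text \<open>Affine spanning in dual form, since a row of a matrix together with a component of a
  translation is exactly such a pair \<open>e\<close>, \<open>c\<close>.\<close>

definition spanning :: "('d::finite, 'v::finite) framework \<Rightarrow> bool" where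
  "spanning \<rho> \<longleftrightarrow> (\<forall>e c. (\<forall>u. e \<bullet> \<rho> $ u = c) \<longrightarrow> e = 0)"

lemma generic_imp_spanning:
  fixes \<rho> :: "('d::finite, 'v::finite) framework"
  assumes "generic \<rho>" "CARD('d) < CARD('v)"
  shows "spanning \<rho>"
proof -
  obtain u0 :: 'v where True by simp
  have "card (UNIV :: 'd set) \<le> card (UNIV - {u0})" using assms(2) by (simp add: card_Diff_singleton)
  then obtain v :: "'d \<Rightarrow> 'v" where v: "inj v" "range v \<subseteq> UNIV - {u0}"
    using card_le_inj[of "UNIV :: 'd set" "UNIV - {u0}"] by auto
  define M where "M x = (\<chi> j i. x (v j, i) - x (u0, i))" for x :: "'v \<times> 'd \<Rightarrow> real"
  have "polyfun (\<lambda>x. det (M x :: real ^ 'd ^ 'd))"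
    unfolding det_def M_def
    by (auto intro!: polyfun_sum polyfun_mult polyfun_of_int polyfun_prod polyfun_diff polyfun_proj)
  \<comment> \<open>The example places \<open>u0\<close> at the origin and \<open>v i\<close> at the
    \<open>i\<close>-th unit vector.\<close>
  moreover have "det (M (\<lambda>(u, i). (\<chi> u i. if u = v i then 1 else 0) $ u $ i)) \<noteq> 0"
  proof -
    have "M (\<lambda>(u, i). (\<chi> u i. if u = v i then 1 else 0) $ u $ i) = mat 1"
      using v by (auto simp: M_def mat_def vec_eq_iff inj_eq)
    then show ?thesis by simp
  qed
  ultimately have d: "det (M (\<lambda>(u, i). \<rho> $ u $ i)) \<noteq> 0"
    using generic_polyfun[OF assms(1)] by blast
  show ?thesis
    unfolding spanning_def
  proof (intro allI impI)
    fix e c assume c: "\<forall>u. e \<bullet> \<rho> $ u = c"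
    have "M (\<lambda>(u, i). \<rho> $ u $ i) *v e = 0"
    proof (rule iffD2[OF vec_eq_iff], rule allI)
      fix j
      have "(M (\<lambda>(u, i). \<rho> $ u $ i) *v e) $ j = e \<bullet> \<rho> $ v j - e \<bullet> \<rho> $ u0"
        by (simp add: M_def matrix_vector_mult_def inner_vec_def algebra_simps sum_subtractf)
      then show "(M (\<lambda>(u, i). \<rho> $ u $ i) *v e) $ j = 0 $ j" using c by simp
    qed
    then show "e = 0"
      using d by (metis invertible_det_nz invertible_left_inverse matrix_left_invertible_ker)
  qed
qed

text \<open>Kronecker substitution: putting \<open>x i = t ^ s ^ idx i\<close> turns the monomial
  \<open>m\<close> into \<open>t ^ w m\<close>. For a base \<open>s\<close> outside a finite set the
  exponents \<open>w m\<close> are distinct on the support of \<open>p\<close>, so the coefficients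
  of \<open>p\<close> reappear as those of the one-variable polynomial \<open>Q\<close>.\<close>

lemma eval_poly_nonzero:
  assumes "p \<noteq> 0"
  shows "\<exists>x. eval_poly p x \<noteq> 0"
proof (rule ccontr)
  assume "\<nexists>x. eval_poly p x \<noteq> 0"
  then have zero: "eval_poly p x = 0" for x by blast
  let ?K = "Poly_Mapping.keys p" and ?l = "Poly_Mapping.lookup"
  obtain idx :: "'a \<Rightarrow> nat" where idx: "inj idx" using finite_imp_inj_to_nat_seg[OF finite_class.finite_UNIV] by metis
  \<comment> \<open>At \<open>s\<close> this polynomial takes the value \<open>w m - w m'\<close>,
    so its roots are the bases to avoid.\<close>
  define D where "D m m' = (\<Sum>i\<in>UNIV. monom (real (?l m i) - real (?l m' i)) (idx i))" for m m'
  have coD: "coeff (D m m') (idx i) = real (?l m i) - real (?l m' i)" for m m' i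
    unfolding D_def coeff_sum
    by (subst sum.remove[of _ i]) (auto intro!: sum.neutral simp: inj_eq[OF idx])
  have D: "D m m' \<noteq> 0" if "m \<noteq> m'" for m m'
  proof
    assume "D m m' = 0"
    then have "?l m i = ?l m' i" for i using coD[of m m' i] by simp
    then show False using that poly_mapping_eqI by blast
  qed
  have "finite (\<Union>(m, m')\<in>{(m, m'). m \<in> ?K \<and> m' \<in> ?K \<and> m \<noteq> m'}. {s. poly (D m m') s = 0})"
  proof (rule finite_UN_I)
    show "finite {(m, m'). m \<in> ?K \<and> m' \<in> ?K \<and> m \<noteq> m'}"
      by (rule finite_subset[of _ "?K \<times> ?K"]) auto
    show "finite (case x of (m, m') \<Rightarrow> {s. poly (D m m') s = 0})"
      if "x \<in> {(m, m'). m \<in> ?K \<and> m' \<in> ?K \<and> m \<noteq> m'}" for x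
      using that poly_roots_finite[OF D] by auto
  qed
  then have "finite (real -` (\<Union>(m, m')\<in>{(m, m'). m \<in> ?K \<and> m' \<in> ?K \<and> m \<noteq> m'}. {s. poly (D m m') s = 0}))"
    by (intro finite_vimageI) auto
  then obtain s :: nat where s: "s \<notin> real -` (\<Union>(m, m')\<in>{(m, m'). m \<in> ?K \<and> m' \<in> ?K \<and> m \<noteq> m'}. {s. poly (D m m') s = 0})"
    using ex_new_if_finite[OF infinite_UNIV_nat] by blast
  define w where "w m = (\<Sum>i\<in>UNIV. ?l m i * s ^ idx i)" for m
  have w: "w m \<noteq> w m'" if "m \<in> ?K" "m' \<in> ?K" "m \<noteq> m'" for m m'
  proof
    assume "w m = w m'"
    then have "real (w m) = real (w m')" by simp
    then have "poly (D m m') (real s) = 0"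
      by (simp add: D_def poly_sum poly_monom w_def left_diff_distrib sum_subtractf)
    then show False using s that by blast
  qed
  define Q where "Q = (\<Sum>m\<in>?K. monom (of_rat (?l p m) :: real) (w m))"
  have "poly Q t = eval_poly p (\<lambda>i. t ^ s ^ idx i)" for t
    unfolding Q_def eval_poly_def poly_sum poly_monom w_def
    by (simp add: power_sum power_mult mult.commute flip: power_mult)
  then have "Q = 0" using zero by (simp add: poly_eq_poly_eq_iff[symmetric] fun_eq_iff)
  moreover obtain m0 where m0: "m0 \<in> ?K" using assms by (metis keys_eq_empty ex_in_conv)
  have "coeff Q (w m0) = of_rat (?l p m0)"
    unfolding Q_def coeff_sum
    by (subst sum.remove[OF _ m0]) (use w m0 in \<open>auto intro!: sum.neutral\<close>)
  ultimately show False using m0 by (simp add: in_keys_iff)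
qed

lemma eval_poly_line:
  obtains P where "\<And>t. eval_poly p (\<lambda>i. a i + t * b i) = poly P t"
proof
  fix t
  show "eval_poly p (\<lambda>i. a i + t * b i) =
    poly (\<Sum>m\<in>Poly_Mapping.keys p. [:of_rat (Poly_Mapping.lookup p m):] * (\<Prod>i\<in>UNIV. [:a i, b i:] ^ Poly_Mapping.lookup m i)) t"
    by (simp add: eval_poly_def poly_sum poly_prod poly_power)
qed

text \<open>Along the line from \<open>a\<close> to a point \<open>x\<close> with nonzero value,
  \<open>p\<close> is a polynomial in one variable. If it vanished near \<open>a\<close>, it would
  have infinitely many roots and hence vanish at \<open>x\<close>, which is parameter 1.\<close>

lemma eval_poly_zero_interior:
  fixes p :: "('v::finite \<times> 'd::finite \<Rightarrow>\<^sub>0 nat) \<Rightarrow>\<^sub>0 rat" and a :: "('d, 'v) framework"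
  assumes "p \<noteq> 0" "0 < e"
  shows "\<exists>y. norm (y - a) < e \<and> eval_poly p (\<lambda>(u, i). y $ u $ i) \<noteq> 0"
proof (rule ccontr)
  assume "\<not> ?thesis"
  then have zero: "eval_poly p (\<lambda>(u, i). y $ u $ i) = 0" if "norm (y - a) < e" for y using that by blast
  obtain x where x: "eval_poly p x \<noteq> 0" using eval_poly_nonzero[OF assms(1)] by blast
  define b :: "('d, 'v) framework" where "b = (\<chi> u i. x (u, i)) - a"
  obtain P where P: "\<And>t. eval_poly p (\<lambda>(u, i). a $ u $ i + t * b $ u $ i) = poly P t"
    using eval_poly_line[of p "\<lambda>(u, i). a $ u $ i" "\<lambda>(u, i). b $ u $ i"] unfolding case_prod_beta by blast
  have "poly P t = 0" if t: "0 < t" "t < e / (norm b + 1)" for t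
  proof -
    have "t * norm b \<le> t * (norm b + 1)" using t by simp
    also have "\<dots> < e" using t(2) add_nonneg_pos[OF norm_ge_zero zero_less_one, of b] by (simp only: pos_less_divide_eq)
    finally have "norm ((a + t *\<^sub>R b) - a) < e" using t by simp
    from zero[OF this] show ?thesis using P[of t] by simp
  qed
  then have "{0<..<e / (norm b + 1)} \<subseteq> {t. poly P t = 0}" by auto
  moreover have "infinite {0<..<e / (norm b + 1)}"
    using assms(2) by (intro infinite_Ioo) (simp add: add_nonneg_pos)
  ultimately have "P = 0" using poly_roots_finite finite_subset by blast
  then have "eval_poly p (\<lambda>(u, i). a $ u $ i + 1 * b $ u $ i) = 0" using P[of 1] by simp
  moreover have "(\<lambda>(u, i). a $ u $ i + 1 * b $ u $ i) = x" by (auto simp: b_def)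
  ultimately show False using x by simp
qed

section \<open>Density of generic frameworks\<close>

lemma countable_poly_mapping:
  assumes "countable (UNIV :: 'a set)" "countable (UNIV :: 'b::zero set)"
  shows "countable (UNIV :: ('a \<Rightarrow>\<^sub>0 'b) set)"
proof -
  let ?g = "\<lambda>p :: 'a \<Rightarrow>\<^sub>0 'b. (\<lambda>k. (k, Poly_Mapping.lookup p k)) ` Poly_Mapping.keys p"
  have "inj ?g"
  proof (rule injI)
    fix p q assume eq: "?g p = ?g q"
    \<comment> \<open>The finite graph over the support determines the function, with default value
      0 off the support.\<close>
    have *: "Poly_Mapping.lookup p k = (if \<exists>y. (k, y) \<in> ?g p then THE y. (k, y) \<in> ?g p else 0)" for p :: "'a \<Rightarrow>\<^sub>0 'b" and k
      by (auto simp: in_keys_iff image_iff)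
    show "p = q" by (rule poly_mapping_eqI) (subst (1 2) *, simp only: eq)
  qed
  moreover have "countable (?g ` UNIV)"
  proof (rule countable_subset)
    show "?g ` UNIV \<subseteq> {A. A \<subseteq> UNIV \<times> UNIV \<and> finite A}" by auto
    show "countable {A :: ('a \<times> 'b) set. A \<subseteq> UNIV \<times> UNIV \<and> finite A}"
      using countable_Collect_finite_subset[OF countable_SIGMA[OF assms(1), of "\<lambda>_. UNIV :: 'b set"]] assms(2)
      by (simp add: conj_commute)
  qed
  ultimately show ?thesis by (rule countable_image_inj_on[rotated])
qed

text \<open>Baire category: every nonzero rational polynomial is nonzero on an open dense set, and
  there are only countably many of them.\<close>

lemma generic_dense:
  fixes \<rho> :: "('d::finite, 'v::finite) framework"
  assumes "0 < e"
  shows "\<exists>\<rho>'. generic \<rho>' \<and> norm (\<rho>' - \<rho>) < e"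
proof -
  let ?Z = "\<lambda>p :: ('v \<times> 'd \<Rightarrow>\<^sub>0 nat) \<Rightarrow>\<^sub>0 rat. {\<rho> :: ('d, 'v) framework. eval_poly p (\<lambda>(u, i). \<rho> $ u $ i) \<noteq> 0}"
  let ?G = "?Z ` {p. p \<noteq> 0}"
  have "UNIV \<subseteq> closure (\<Inter>?G)"
  proof (rule Baire)
    have "countable (UNIV :: (('v \<times> 'd \<Rightarrow>\<^sub>0 nat) \<Rightarrow>\<^sub>0 rat) set)"
      by (intro countable_poly_mapping) auto
    then show "countable ?G" by (meson countable_image countable_subset subset_UNIV)
    fix T assume "T \<in> ?G"
    then obtain p where p: "p \<noteq> 0" "T = ?Z p" by auto
    have "continuous_on UNIV (\<lambda>\<rho> :: ('d, 'v) framework. eval_poly p (\<lambda>(u, i). \<rho> $ u $ i))"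
      unfolding eval_poly_def case_prod_beta by (intro continuous_intros)
    then have "open T" unfolding p(2) by (intro open_Collect_neq continuous_on_const)
    moreover have "x \<in> closure T" for x
      using eval_poly_zero_interior[OF p(1), of _ x] p(2) unfolding closure_approachable dist_norm by blast
    ultimately show "openin (top_of_set UNIV) T \<and> UNIV \<subseteq> closure T" by auto
  qed simp
  then have "\<rho> \<in> closure (\<Inter>?G)" by auto
  then obtain \<rho>' where "\<rho>' \<in> \<Inter>?G" "dist \<rho>' \<rho> < e" using assms closure_approachable by blast
  then show ?thesis unfolding generic_def dist_norm by blast
qed

section \<open>Parity of fully labelled simplices in Todd's triangulation\<close>

lemma even_card_involution:
  assumes "finite P" "\<And>x. x \<in> P \<Longrightarrow> f x \<in> P" "\<And>x. x \<in> P \<Longrightarrow> f (f x) = x" "\<And>x. x \<in> P \<Longrightarrow> f x \<noteq> x"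
  shows "even (card P)"
proof -
  let ?C = "(\<lambda>x. {x, f x}) ` P"
  have "2 * card ?C = card (\<Union>?C)"
  proof (rule card_partition)
    show "finite ?C" "finite (\<Union>?C)" using assms(1) by auto
    show "card c = 2" if "c \<in> ?C" for c
      using that assms(4) by (force simp: card_insert_if)
    show "c \<inter> c' = {}" if c: "c \<in> ?C" "c' \<in> ?C" "c \<noteq> c'" for c c'
    proof -
      obtain x y where xy: "x \<in> P" "y \<in> P" "c = {x, f x}" "c' = {y, f y}" using c by auto
      have "f (f x) = x" "f (f y) = y" using xy assms(3) by auto
      then show ?thesis using xy(3,4) c(3)
        by (metis disjoint_iff doubleton_eq_iff insertE singletonD)
    qed
  qed
  moreover have "\<Union>?C = P" using assms(2) by auto
  ultimately show ?thesis by (metis dvd_triv_left)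
qed

text \<open>
  A flag \<open>s\<close> encodes a top-dimensional simplex with vertices \<open>s 0, \<dots>, s N\<close> of the barycentric subdivision
  of the cubical grid with vertices in \<open>(2\<int>)\<^sup>N\<close>: the point \<open>s j\<close> is the centre of a \<open>j\<close>-dimensional cell,
  whose odd coordinates are those in which the cell extends. Unlike the standard triangulation of the cubes by
  permutations, this one is invariant under sign changes of single coordinates.
\<close>

definition flag :: "nat \<Rightarrow> (nat \<Rightarrow> nat \<Rightarrow> int) \<Rightarrow> bool" where
  "flag N s \<longleftrightarrow> (\<forall>k. even (s 0 k)) \<and> (\<forall>k\<ge>N. s 0 k = 0) \<and> (\<forall>j>N. s j = (\<lambda>_. 0)) \<and>
     (\<forall>j<N. \<exists>k<N. even (s j k) \<and> (\<exists>e\<in>{1, -1}. s (Suc j) = (s j)(k := s j k + e)))"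

lemma flagD:
  assumes "flag N s"
  shows "even (s 0 k)" "k \<ge> N \<Longrightarrow> s 0 k = 0" "j > N \<Longrightarrow> s j = (\<lambda>_. 0)"
    "j < N \<Longrightarrow> \<exists>k<N. even (s j k) \<and> (\<exists>e\<in>{1, -1}. s (Suc j) = (s j)(k := s j k + e))"
  using assms by (auto simp: flag_def)

lemma flag_step:
  assumes "flag N s" "j < N"
  obtains k e where "k < N" "even (s j k)" "e \<in> {1, -1}" "s (Suc j) = (s j)(k := s j k + e)"
  using flagD(4)[OF assms] by blast

text \<open>A step makes one even coordinate odd by adding 1 or -1, so no coordinate moves twice:
  the odd coordinates count the steps, and the even ones still have their initial value.\<close>

lemma flag_basic:
  assumes "flag N s" "j \<le> N"
  shows "card {k. k < N \<and> odd (s j k)} = j \<and> (\<forall>k\<ge>N. s j k = 0) \<and>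
    (\<forall>k. \<bar>s j k - s 0 k\<bar> \<le> 1 \<and> (even (s j k) \<longrightarrow> s j k = s 0 k))"
  using assms(2)
proof (induction j)
  case 0
  then show ?case using flagD[OF assms(1)] by auto
next
  case (Suc j)
  obtain k e where k: "k < N" "even (s j k)" "e \<in> {1, -1}" "s (Suc j) = (s j)(k := s j k + e)"
    using flag_step[OF assms(1), of j] Suc.prems by (metis Suc_le_lessD)
  have IH: "card {k. k < N \<and> odd (s j k)} = j" "\<And>k. k \<ge> N \<Longrightarrow> s j k = 0"
    "\<And>k. \<bar>s j k - s 0 k\<bar> \<le> 1" "\<And>k. even (s j k) \<Longrightarrow> s j k = s 0 k"
    using Suc by auto
  have oe: "odd (s j k + e)" using k by auto
  have "{l. l < N \<and> odd (s (Suc j) l)} = insert k {l. l < N \<and> odd (s j l)}"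
    using k(1,4) oe by auto
  moreover have "k \<notin> {l. l < N \<and> odd (s j l)}" using k by auto
  ultimately have "card {k. k < N \<and> odd (s (Suc j) k)} = Suc j" using IH(1) by simp
  moreover have "\<forall>l\<ge>N. s (Suc j) l = 0" using IH(2) k by auto
  moreover have "\<forall>l. \<bar>s (Suc j) l - s 0 l\<bar> \<le> 1 \<and> (even (s (Suc j) l) \<longrightarrow> s (Suc j) l = s 0 l)"
    using IH(3,4) k oe by auto
  ultimately show ?case by blast
qed

lemma flag_dist:
  assumes "flag N s" "j \<le> N" "i \<le> N"
  shows "\<bar>s j k - s i k\<bar> \<le> 2"
  using flag_basic[OF assms(1,2)] flag_basic[OF assms(1,3)] by (smt (verit))

lemma flag_top_odd:
  assumes "flag N s" "k < N" shows "odd (s N k)"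
proof -
  have "card {k. k < N \<and> odd (s N k)} = N" using flag_basic[OF assms(1), of N] by auto
  then have "{k. k < N \<and> odd (s N k)} = {..<N}"
    by (intro card_subset_eq) auto
  then show ?thesis using assms(2) by auto
qed

text \<open>The \<open>j\<close>-th vertex of the unique other simplex that shares the facet opposite to \<open>s j\<close>.\<close>

definition reflect_vertex :: "nat \<Rightarrow> nat \<Rightarrow> (nat \<Rightarrow> nat \<Rightarrow> int) \<Rightarrow> nat \<Rightarrow> nat \<Rightarrow> int" where
  "reflect_vertex N j s = s(j := (\<lambda>k.
     if j = 0 then 2 * s 1 k - s 0 k
     else if j = N then 2 * s (N - 1) k - s N k
     else s (j - 1) k + s (Suc j) k - s j k))"

lemma reflect_vertex_other: "i \<noteq> j \<Longrightarrow> reflect_vertex N j s i = s i"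
  by (simp add: reflect_vertex_def)

lemma reflect_vertex_twice: "2 \<le> N \<Longrightarrow> reflect_vertex N j (reflect_vertex N j s) = s"
  by (rule ext) (auto simp: reflect_vertex_def fun_eq_iff)

text \<open>Opposite to the corner \<open>s 0\<close>, the neighbour starts at the other end of the
  edge with centre \<open>s 1\<close>. Opposite to the cube centre \<open>s N\<close>, it lies in
  the cube on the other side of \<open>s (N - 1)\<close>. Opposite to an intermediate vertex, it
  makes the two adjacent steps in the other order.\<close>

lemma flag_reflect_vertex:
  assumes "flag N s" "2 \<le> N" "j \<le> N"
  shows "flag N (reflect_vertex N j s)" "reflect_vertex N j s j \<noteq> s j"
proof -
  let ?t = "reflect_vertex N j s"
  note F = flagD[OF assms(1)]
  consider "j = 0" | "j = N" "j \<noteq> 0" | "0 < j" "j < N" using assms(3) by linarith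
  then have "flag N ?t \<and> ?t j \<noteq> s j"
  proof cases
    case 1
    obtain k e where k: "k < N" "even (s 0 k)" "e \<in> {1, -1}" "s (Suc 0) = (s 0)(k := s 0 k + e)"
      using flag_step[OF assms(1), of 0] assms(2) by (metis zero_less_numeral order_less_le_trans)
    have t0: "?t 0 = (s 0)(k := s 0 k + 2 * e)"
      unfolding reflect_vertex_def using k(4) 1 by (auto simp: fun_eq_iff)
    have t: "?t i = s i" if "i \<noteq> 0" for i using that 1 by (simp add: reflect_vertex_other)
    have "\<exists>k<N. even (?t i k) \<and> (\<exists>e\<in>{1, -1}. ?t (Suc i) = (?t i)(k := ?t i k + e))" if "i < N" for i
    proof (cases "i = 0")
      case True
      have "s (Suc 0) = (?t 0)(k := ?t 0 k + (- e))" using k(4) t0 by (auto simp: fun_eq_iff)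
      moreover have "even (?t 0 k)" using t0 k by simp
      moreover have "- e \<in> {1, -1}" using k by auto
      ultimately show ?thesis using True t[of "Suc 0"] k(1) by (metis One_nat_def n_not_Suc_n)
    next
      case False
      then show ?thesis using t F(4)[OF that] by simp
    qed
    moreover have "(\<forall>k. even (?t 0 k)) \<and> (\<forall>k\<ge>N. ?t 0 k = 0)" using F(1,2) k(1,2) t0 by auto
    moreover have "\<forall>j>N. ?t j = (\<lambda>_. 0)" using F(3) t by auto
    moreover have "?t j \<noteq> s j" using t0 1 k by (auto simp: fun_eq_iff dest: spec[of _ k])
    ultimately show ?thesis by (simp add: flag_def)
  next
    case 2
    obtain M where M: "N = Suc M" using assms(2) by (cases N) auto
    obtain k e where k: "k < N" "even (s M k)" "e \<in> {1, -1}" "s (Suc M) = (s M)(k := s M k + e)"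
      using flag_step[OF assms(1), of M] M by (metis lessI)
    have t0: "?t N = (s M)(k := s M k + (- e))"
      unfolding reflect_vertex_def using k(4) 2 M by (auto simp: fun_eq_iff)
    have t: "?t i = s i" if "i \<noteq> N" for i using that 2 by (simp add: reflect_vertex_other)
    have "\<exists>k<N. even (?t i k) \<and> (\<exists>e\<in>{1, -1}. ?t (Suc i) = (?t i)(k := ?t i k + e))" if "i < N" for i
    proof (cases "i = M")
      case True
      have "- e \<in> {1, -1}" using k by auto
      then show ?thesis using t0 k(1,2) True t[of M] M by (metis n_not_Suc_n)
    next
      case False
      then show ?thesis using t F(4)[OF that] that M by simp
    qed
    moreover have "(\<forall>k. even (?t 0 k)) \<and> (\<forall>k\<ge>N. ?t 0 k = 0)" using F(1,2) t[of 0] M by auto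
    moreover have "\<forall>j>N. ?t j = (\<lambda>_. 0)" using F(3) t by auto
    moreover have "?t j \<noteq> s j" using t0 2 k M by (auto simp: fun_eq_iff dest: spec[of _ k])
    ultimately show ?thesis by (simp add: flag_def)
  next
    case 3
    obtain m where m: "j = Suc m" using 3 by (cases j) auto
    obtain k e where k: "k < N" "even (s m k)" "e \<in> {1, -1}" "s j = (s m)(k := s m k + e)"
      using flag_step[OF assms(1), of m] m 3 by (metis Suc_lessD)
    obtain l e' where l: "l < N" "even (s j l)" "e' \<in> {1, -1}" "s (Suc j) = (s j)(l := s j l + e')"
      using flag_step[OF assms(1), of j] 3 by metis
    have kl: "k \<noteq> l" using k l by auto
    have t0: "?t j = (s m)(l := s m l + e')"
      unfolding reflect_vertex_def using k l 3 m kl by (auto simp: fun_eq_iff)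
    have t: "?t i = s i" if "i \<noteq> j" for i using that by (simp add: reflect_vertex_other)
    have "\<exists>k<N. even (?t i k) \<and> (\<exists>e\<in>{1, -1}. ?t (Suc i) = (?t i)(k := ?t i k + e))" if "i < N" for i
    proof -
      consider "i = m" | "i = j" | "i \<noteq> m" "i \<noteq> j" by blast
      then show ?thesis
      proof cases
        case 1
        have "even (s m l)" using l(2) k(4) kl by simp
        then show ?thesis using 1 t0 t[of m] m l(1,3) by (metis n_not_Suc_n)
      next
        case 2
        have "s (Suc j) = (?t j)(k := ?t j k + e)" using t0 k l kl by (auto simp: fun_eq_iff)
        moreover have "even (?t j k)" using t0 k kl by simp
        ultimately show ?thesis using 2 t[of "Suc j"] k(1,3) by (metis n_not_Suc_n)
      next
        case 3
        then show ?thesis using t F(4)[OF that] m by simp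
      qed
    qed
    moreover have "(\<forall>k. even (?t 0 k)) \<and> (\<forall>k\<ge>N. ?t 0 k = 0)" using F(1,2) t[of 0] 3 by auto
    moreover have "\<forall>j>N. ?t j = (\<lambda>_. 0)" using F(3) t 3 by auto
    moreover have "?t j \<noteq> s j" 
    proof
      assume "?t j = s j"
      then have "?t j k = s j k" by simp
      then show False using t0 kl k by auto
    qed
    ultimately show ?thesis by (simp add: flag_def)
  qed
  then show "flag N ?t" "?t j \<noteq> s j" by auto
qed

text \<open>Block sign changes: \<open>blk k\<close> is the block of the coordinate
  \<open>k\<close>, and \<open>g\<close> gives each block its sign. Polymorphic because they act on
  lattice vertices and on real points.\<close>

definition flip :: "(nat \<Rightarrow> nat) \<Rightarrow> (nat \<Rightarrow> 'a::ring_1) \<Rightarrow> (nat \<Rightarrow> 'a) \<Rightarrow> nat \<Rightarrow> 'a" where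
  "flip blk g x = (\<lambda>k. g (blk k) * x k)"

lemma flag_flip:
  fixes g :: "nat \<Rightarrow> int"
  assumes "flag N s" "\<And>b. g b \<in> {1, -1}"
  shows "flag N (\<lambda>j. flip blk g (s j))"
proof -
  note F = flagD[OF assms(1)]
  have par: "even (g b * x) \<longleftrightarrow> even x" for b x
    using assms(2)[of b] by auto
  have "\<exists>k<N. even (flip blk g (s j) k) \<and>
      (\<exists>e\<in>{1, -1}. flip blk g (s (Suc j)) = (flip blk g (s j))(k := flip blk g (s j) k + e))" if jN: "j < N" for j
  proof -
    obtain k e where k: "k < N" "even (s j k)" "e \<in> {1, -1}" "s (Suc j) = (s j)(k := s j k + e)"
      using flag_step[OF assms(1) jN] by metis
    have "flip blk g (s (Suc j)) = (flip blk g (s j))(k := flip blk g (s j) k + g (blk k) * e)"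
      using k(4) by (auto simp: flip_def fun_eq_iff algebra_simps)
    moreover have "g (blk k) * e \<in> {1, -1}" using assms(2)[of "blk k"] k(3) by auto
    moreover have "even (flip blk g (s j) k)" using k(2) par by (simp add: flip_def)
    ultimately show ?thesis using k(1) by blast
  qed
  moreover have "\<forall>k. even (flip blk g (s 0) k)" using F(1) par by (simp add: flip_def)
  moreover have "(\<forall>k\<ge>N. flip blk g (s 0) k = 0) \<and> (\<forall>j>N. flip blk g (s j) = (\<lambda>_. 0))"
    using F(2,3) by (auto simp: flip_def)
  ultimately show ?thesis unfolding flag_def by blast
qed

lemma reflect_flip: "reflect_vertex N j (\<lambda>j. flip blk g (s j)) = (\<lambda>i. flip blk g (reflect_vertex N j s i))"
  by (auto simp: reflect_vertex_def flip_def fun_eq_iff algebra_simps)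

text \<open>Sperner's door count. A fully labelled simplex has one facet with labels
  \<open>{..<N}\<close>, opposite to its vertex with label \<open>N\<close>. If a simplex that is
  not fully labelled has such a facet, the omitted vertex repeats a label, and leaving out either of
  the two vertices with that label gives exactly two.\<close>

lemma even_card_doors:
  fixes lab :: "nat \<Rightarrow> nat"
  assumes le: "\<And>j. j \<le> N \<Longrightarrow> lab j \<le> N"
  shows "odd (card {j. j \<le> N \<and> lab ` ({..N} - {j}) = {..<N}}) \<longleftrightarrow> lab ` {..N} = {..N}"
proof
  let ?D = "{j. j \<le> N \<and> lab ` ({..N} - {j}) = {..<N}}"
  assume full: "lab ` {..N} = {..N}"
  then have inj: "inj_on lab {..N}" by (simp add: eq_card_imp_inj_on)
  obtain j where j: "j \<le> N" "lab j = N" using full by (metis atMost_iff imageE order_refl)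
  have "?D = {j}"
  proof -
    have "lab ` ({..N} - {i}) = {..N} - {lab i}" if "i \<le> N" for i
      using inj full that by (subst inj_on_image_set_diff[of _ "{..N}"]) auto
    moreover have "{..N} - {l} = {..<N} \<longleftrightarrow> l = N" if "l \<le> N" for l
      using that by auto
    ultimately have "i \<in> ?D \<longleftrightarrow> i \<le> N \<and> lab i = N" for i using le by auto
    then show ?thesis using j inj by (auto simp: inj_on_def)
  qed
  then show "odd (card ?D)" by simp
next
  let ?D = "{j. j \<le> N \<and> lab ` ({..N} - {j}) = {..<N}}"
  assume odd: "odd (card ?D)"
  show "lab ` {..N} = {..N}"
  proof (rule ccontr)
    assume nf: "lab ` {..N} \<noteq> {..N}"
    have "?D \<noteq> {}" using odd by (metis card.empty even_zero)
    then obtain j where j: "j \<le> N" "lab ` ({..N} - {j}) = {..<N}" by auto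
    have eq: "{..N} = insert j ({..N} - {j})" using j(1) by auto
    have img: "lab ` {..N} = insert (lab j) {..<N}" by (subst eq) (simp only: image_insert j(2))
    have "lab j < N"
    proof (rule ccontr)
      assume "\<not> lab j < N"
      then have "lab j = N" using le[OF j(1)] by simp
      then show False using img nf by (simp add: lessThan_Suc[symmetric] lessThan_Suc_atMost)
    qed
    then have "lab j \<in> lab ` ({..N} - {j})" using j(2) by simp
    then obtain i where "i \<in> {..N} - {j}" "lab j = lab i" by (rule imageE)
    then have i: "i \<le> N" "i \<noteq> j" "lab i = lab j" by auto
    have inj: "inj_on lab ({..N} - {j})"
      using j by (intro eq_card_imp_inj_on) auto
    have "l = i \<or> l = j" if l: "l \<in> ?D" for l
    proof (rule ccontr)
      assume a: "\<not> (l = i \<or> l = j)"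
      have "card (lab ` ({..N} - {l})) \<le> card (lab ` ({..N} - {l} - {j}))"
      proof (rule card_mono)
        show "lab ` ({..N} - {l}) \<subseteq> lab ` ({..N} - {l} - {j})"
        proof
          fix y assume "y \<in> lab ` ({..N} - {l})"
          then obtain m where m: "m \<in> {..N} - {l}" "y = lab m" by auto
          show "y \<in> lab ` ({..N} - {l} - {j})"
            using m i a j(1) by (cases "m = j") (auto intro: image_eqI[of _ _ i])
        qed
      qed simp
      also have "\<dots> \<le> card ({..N} - {l} - {j})" by (intro card_image_le) simp
      also have "\<dots> = N - 1" using l j(1) a by (simp add: card_Diff_singleton_if)
      finally have "N \<le> N - 1" using l by simp
      then show False using \<open>lab j < N\<close> by simp
    qed
    moreover have "i \<in> ?D"
    proof -
      have "lab ` ({..N} - {i}) = lab ` ({..N} - {j})"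
      proof (intro equalityI subsetI)
        fix y assume "y \<in> lab ` ({..N} - {i})"
        then obtain m where "m \<in> {..N} - {i}" "y = lab m" by auto
        then show "y \<in> lab ` ({..N} - {j})" using i by (cases "m = j") (auto intro: image_eqI[of _ _ i])
      next
        fix y assume "y \<in> lab ` ({..N} - {j})"
        then obtain m where "m \<in> {..N} - {j}" "y = lab m" by auto
        then show "y \<in> lab ` ({..N} - {i})" using i j(1) by (cases "m = i") (auto intro: image_eqI[of _ _ j])
      qed
      then show ?thesis using i j by simp
    qed
    ultimately have "?D = {i, j}" using j by auto
    then have "card ?D = 2" using i by (simp add: card_insert_if)
    then show False using odd by simp
  qed
qed

text \<open>Crossing a door and returning to the fundamental domain by a sign change pairs off the
  doors without fixed points. There are finitely many, because a door carries the label 0, which is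
  confined to a bounded region. Fully labelled flags have an odd number of doors and all others an
  even number, so parity passes from doors to flags.\<close>

lemma even_card_full_flags:
  fixes lab :: "(nat \<Rightarrow> int) \<Rightarrow> nat"
  assumes N: "2 \<le> N"
    and blk: "\<And>k. k < N \<Longrightarrow> \<exists>k'<N. k' \<noteq> k \<and> blk k' = blk k"
    and le: "\<And>v. lab v \<le> N"
    and inv: "\<And>g v. (\<And>b. g b \<in> {1, -1}) \<Longrightarrow> lab (flip blk g v) = lab v"
    and bdd: "\<And>v k. lab v = 0 \<Longrightarrow> k < N \<Longrightarrow> \<bar>v k\<bar> \<le> M"
  shows "even (card {s. flag N s \<and> (\<forall>k<N. (\<forall>k'<k. blk k' \<noteq> blk k) \<longrightarrow> 0 < s N k) \<and>
     (\<lambda>j. lab (s j)) ` {..N} = {..N}})"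
proof -
  \<comment> \<open>A fundamental domain: the first coordinate of each block is positive at
    \<open>s N\<close>, where all coordinates below \<open>N\<close> are odd and hence
    nonzero.\<close>
  define pos where "pos s \<longleftrightarrow> (\<forall>k<N. (\<forall>k'<k. blk k' \<noteq> blk k) \<longrightarrow> 0 < s N k)" for s :: "nat \<Rightarrow> nat \<Rightarrow> int"
  define rep where "rep b = (LEAST k. blk k = b)" for b
  define sg :: "(nat \<Rightarrow> nat \<Rightarrow> int) \<Rightarrow> nat \<Rightarrow> int" where "sg s b = (if s N (rep b) < 0 then -1 else 1)" for s b
  define can where "can s = (\<lambda>j. flip blk (sg s) (s j))" for s
  define door where "door s j \<longleftrightarrow> (\<lambda>i. lab (s i)) ` ({..N} - {j}) = {..<N}" for s j
  define P where "P = {(s, j). flag N s \<and> pos s \<and> j \<le> N \<and> door s j}"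
  \<comment> \<open>Cross the facet opposite to vertex \<open>j\<close> and normalise the signs; the
    index of the omitted vertex is kept.\<close>
  define f where "f = (\<lambda>(s, j). (can (reflect_vertex N j s), j))"
  have rep: "blk (rep (blk k)) = blk k" "rep (blk k) \<le> k" for k
    unfolding rep_def by (rule LeastI[of _ k]; simp) (rule Least_le; simp)
  have rep_least: "\<forall>k'<rep (blk k). blk k' \<noteq> blk (rep (blk k))" for k
  proof (intro allI impI)
    fix k' assume "k' < rep (blk k)"
    then have "blk k' \<noteq> blk k" unfolding rep_def by (rule not_less_Least)
    then show "blk k' \<noteq> blk (rep (blk k))" by (simp only: rep(1) not_False_eq_True)
  qed
  have sg: "sg s b \<in> {1, -1}" for s b by (simp add: sg_def)
  have odd_neq: "s N k \<noteq> 0" if "flag N s" "k < N" for s k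
    using flag_top_odd[OF that] by auto
  have pos_can: "pos (can s)" if "flag N s" for s
    unfolding pos_def
  proof (intro allI impI)
    fix k assume k: "k < N" "\<forall>k'<k. blk k' \<noteq> blk k"
    then have "rep (blk k) = k" using rep[of k] by (metis nat_less_le)
    then show "0 < can s N k" using odd_neq[OF that k(1)] by (auto simp: can_def flip_def sg_def)
  qed
  have flip_flip: "flip blk g (flip blk g v) = v" if "\<And>b. g b \<in> {1, -1}" for g :: "nat \<Rightarrow> int" and v
  proof
    fix k show "flip blk g (flip blk g v) k = v k" using that[of "blk k"] by (auto simp: flip_def)
  qed
  have flag_zero: "s j k = 0" if "flag N s" "k \<ge> N" for s j k
    using that flag_basic[OF that(1), of j] flagD(3)[OF that(1), of j] by (cases "j \<le> N") auto
  have can_flip: "can (\<lambda>j. flip blk g (s j)) = s" if "flag N s" "pos s" "\<And>b. g b \<in> {1, -1}" for g s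
  proof (intro ext)
    fix j k
    show "can (\<lambda>j. flip blk g (s j)) j k = s j k"
    proof (cases "k < N")
      case True
      let ?r = "rep (blk k)"
      have "0 < s N ?r" using that(2) rep[of k] rep_least[of k] True unfolding pos_def by fastforce
      then have "sg (\<lambda>j. flip blk g (s j)) (blk k) = g (blk k)"
        using that(3)[of "blk k"] rep[of k] by (auto simp: sg_def flip_def)
      then show ?thesis using that(3)[of "blk k"] by (auto simp: can_def flip_def)
    next
      case False
      then show ?thesis using flag_zero[OF that(1), of k j] by (simp add: can_def flip_def)
    qed
  qed
  have door_can: "door (can s) j = door s j" for s j
    unfolding door_def can_def using inv[OF sg] by simp
  have door_reflect: "door (reflect_vertex N j s) j = door s j" for s j
  proof -
    have "(\<lambda>i. lab (reflect_vertex N j s i)) ` ({..N} - {j}) = (\<lambda>i. lab (s i)) ` ({..N} - {j})"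
      by (rule image_cong) (auto simp: reflect_vertex_other)
    then show ?thesis by (simp add: door_def)
  qed
  have fP: "f x \<in> P" if "x \<in> P" for x
  proof -
    obtain s j where x: "x = (s, j)" by (cases x)
    have s: "flag N s" "j \<le> N" "door s j" using that by (auto simp: P_def x)
    have fl: "flag N (reflect_vertex N j s)" by (rule flag_reflect_vertex[OF s(1) N s(2)])
    have "flag N (can (reflect_vertex N j s))"
      unfolding can_def by (rule flag_flip[OF fl sg])
    then show ?thesis using pos_can[OF fl] s door_can door_reflect by (simp add: P_def f_def x)
  qed
  have ff: "f (f x) = x" if "x \<in> P" for x
  proof -
    obtain s j where x: "x = (s, j)" by (cases x)
    have s: "flag N s" "pos s" "j \<le> N" using that by (auto simp: P_def x)
    have "reflect_vertex N j (can (reflect_vertex N j s)) =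
      (\<lambda>i. flip blk (sg (reflect_vertex N j s)) (s i))"
      unfolding can_def reflect_flip reflect_vertex_twice[OF N] ..
    then show ?thesis using can_flip[OF s(1,2) sg] by (simp add: f_def x)
  qed
  \<comment> \<open>At a fixed point the sign change \<open>?g\<close> takes the neighbour
    \<open>?t\<close> to \<open>s\<close>, so it fixes every vertex other than \<open>s j\<close>. A
    nonzero coordinate of such a vertex in each block forces \<open>?g\<close> to be 1 there, and
    then \<open>?t j = s j\<close>, which reflection excludes.\<close>
  have fne: "f x \<noteq> x" if "x \<in> P" for x
  proof
    assume eq: "f x = x"
    obtain s j where x: "x = (s, j)" by (cases x)
    have s: "flag N s" "pos s" "j \<le> N" using that by (auto simp: P_def x)
    let ?t = "reflect_vertex N j s"
    let ?g = "sg ?t"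
    have cs: "can ?t = s" using eq by (simp add: f_def x)
    then have *: "flip blk ?g (?t i) = s i" for i unfolding can_def by metis
    have g1: "?g (blk k) = 1" if k: "k < N" for k
    proof -
      have "\<exists>l i. blk l = blk k \<and> i \<noteq> j \<and> s i l \<noteq> 0"
      proof (cases "j = N")
        case False
        then show ?thesis using odd_neq[OF s(1) k] by metis
      next
        \<comment> \<open>The case that needs a second coordinate in the block:
          \<open>s (N - 1)\<close> still has one even coordinate, which may be 0.\<close>
        case True
        obtain M where M: "N = Suc M" using N by (cases N) auto
        obtain l e where l: "l < N" "even (s M l)" "e \<in> {1, -1}" "s (Suc M) = (s M)(l := s M l + e)"
          using flag_step[OF s(1), of M] M by (metis lessI)
        obtain k' where k': "k' < N" "k' \<noteq> k" "blk k' = blk k" using blk[OF k] by auto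
        define m where "m = (if l = k then k' else k)"
        have "m < N" "m \<noteq> l" "blk m = blk k" using k k' by (auto simp: m_def)
        then have "s M m = s N m" using l M by simp
        then have "s M m \<noteq> 0" using odd_neq[OF s(1) \<open>m < N\<close>] by simp
        moreover have "M \<noteq> j" using M True by simp
        ultimately show ?thesis using \<open>blk m = blk k\<close> by blast
      qed
      then obtain l i where l: "blk l = blk k" "i \<noteq> j" "s i l \<noteq> 0" by blast
      have "flip blk ?g (s i) l = s i l" using *[of i] l(2) by (simp add: reflect_vertex_other)
      then show ?thesis using l(1,3) by (simp add: flip_def)
    qed
    have "?t j = s j"
    proof
      fix k show "?t j k = s j k"
      proof (cases "k < N")
        case True
        then show ?thesis using *[of j] g1[OF True] by (metis flip_def mult_1)
      next
        case False
        then show ?thesis using flag_zero[OF s(1)] flag_zero[OF flag_reflect_vertex(1)[OF s(1) N s(3)]] by simp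
      qed
    qed
    then show False using flag_reflect_vertex(2)[OF s(1) N s(3)] by simp
  qed
  define S where "S = {s. flag N s \<and> (\<exists>i\<le>N. lab (s i) = 0)}"
  have finS: "finite S"
  proof (rule finite_subset)
    \<comment> \<open>Two vertices of a flag differ by at most 2 in each coordinate, whence
      \<open>M + 2\<close>.\<close>
    let ?A = "{v. \<forall>k. (k \<in> {..<N} \<longrightarrow> v k \<in> {-(M+2)..M+2}) \<and> (k \<notin> {..<N} \<longrightarrow> v k = (0::int))}"
    let ?B = "{s. \<forall>j. (j \<in> {..N} \<longrightarrow> s j \<in> ?A) \<and> (j \<notin> {..N} \<longrightarrow> s j = (\<lambda>_. 0))}"
    show "finite ?B" by (intro finite_set_of_finite_funs) auto
    show "S \<subseteq> ?B"
    proof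
      fix s assume "s \<in> S"
      then obtain i where s: "flag N s" "i \<le> N" "lab (s i) = 0" by (auto simp: S_def)
      have "s j k \<in> {-(M+2)..M+2}" if "j \<le> N" "k < N" for j k
        using bdd[OF s(3) that(2)] flag_dist[OF s(1,2) that(1), of k] by auto
      then show "s \<in> ?B" using flag_zero[OF s(1)] flagD(3)[OF s(1)] by auto
    qed
  qed
  have doorS: "s \<in> S" if "flag N s" "door s j" for s j
  proof -
    have "0 \<in> {..<N}" using N by auto
    then have "0 \<in> (\<lambda>i. lab (s i)) ` ({..N} - {j})" using that(2) unfolding door_def by simp
    then show ?thesis using that(1) unfolding S_def by force
  qed
  define T where "T = {s \<in> S. pos s}"
  have finT: "finite T" using finS by (simp add: T_def)
  have P_eq: "P = (SIGMA s : T. {j. j \<le> N \<and> door s j})"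
    unfolding P_def T_def using doorS by (auto simp: S_def)
  have finP: "finite P" unfolding P_eq using finT by auto
  have "even (card P)" by (rule even_card_involution[OF finP fP ff fne])
  moreover have "card P = (\<Sum>s\<in>T. card {j. j \<le> N \<and> door s j})"
    unfolding P_eq using finT by (intro card_SigmaI) auto
  ultimately have "even (card {s \<in> T. odd (card {j. j \<le> N \<and> door s j})})"
    using even_sum_iff[OF finT, of "\<lambda>s. card {j. j \<le> N \<and> door s j}"] by simp
  moreover have "{s \<in> T. odd (card {j. j \<le> N \<and> door s j})} =
    {s. flag N s \<and> pos s \<and> (\<lambda>j. lab (s j)) ` {..N} = {..N}}" (is "?L = ?R")
  proof -
    have *: "odd (card {j. j \<le> N \<and> door s j}) \<longleftrightarrow> (\<lambda>j. lab (s j)) ` {..N} = {..N}" for s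
      unfolding door_def by (rule even_card_doors) (rule le)
    have "s \<in> T" if "flag N s" "pos s" "(\<lambda>j. lab (s j)) ` {..N} = {..N}" for s
    proof -
      have "0 \<in> (\<lambda>j. lab (s j)) ` {..N}" using that(3) by simp
      then show ?thesis using that(1,2) unfolding T_def S_def by force
    qed
    then show ?thesis using * by (auto simp: T_def S_def)
  qed
  ultimately show ?thesis unfolding pos_def by simp
qed

section \<open>Fully labelled flags of the model labelling\<close>

lemma flag_odd_const:
  assumes "flag N s" "i \<le> j" "j \<le> N" "odd (s i k)"
  shows "s j k = s i k"
  using assms(2,3)
proof (induction j rule: dec_induct)
  case base
  then show ?case by simp
next
  case (step j)
  obtain l e where l: "even (s j l)" "s (Suc j) = (s j)(l := s j l + e)"
    using flag_step[OF assms(1), of j] step.prems by (metis Suc_le_lessD)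
  have "s j k = s i k" using step by simp
  then show ?case using l assms(4) by auto
qed

text \<open>Bolzano-Weierstrass for points encoded as functions on \<open>nat\<close>, of which only
  the first \<open>N\<close> coordinates count; subsequences are refined one coordinate at a
  time.\<close>

lemma convergent_subseq_coordinates:
  fixes X :: "nat \<Rightarrow> nat \<Rightarrow> real"
  assumes "\<And>n k. k < N \<Longrightarrow> \<bar>X n k\<bar> \<le> C"
  shows "\<exists>\<phi> x. strict_mono \<phi> \<and> (\<forall>k<N. (\<lambda>n. X (\<phi> n) k) \<longlonglongrightarrow> x k)"
  using assms
proof (induction N)
  case 0
  then show ?case by (intro exI[of _ id]) (auto simp: strict_mono_def)
next
  case (Suc N)
  obtain \<phi> x where \<phi>: "strict_mono \<phi>" "\<And>k. k < N \<Longrightarrow> (\<lambda>n. X (\<phi> n) k) \<longlonglongrightarrow> x k"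
    using Suc by (meson less_SucI)
  have "bounded (range (\<lambda>n. X (\<phi> n) N))"
    using Suc.prems[of N] unfolding bounded_iff by auto
  then obtain l r where r: "strict_mono r" "((\<lambda>n. X (\<phi> n) N) \<circ> r) \<longlonglongrightarrow> l"
    using bounded_imp_convergent_subsequence by blast
  have "(\<lambda>n. X ((\<phi> \<circ> r) n) k) \<longlonglongrightarrow> (x(N := l)) k" if k: "k < Suc N" for k
  proof (cases "k = N")
    case True
    then show ?thesis using r(2) by (simp add: o_def)
  next
    case False
    then have "k < N" using k by simp
    then show ?thesis using LIMSEQ_subseq_LIMSEQ[OF \<phi>(2) r(1), of k] False by (simp add: o_def)
  qed
  then show ?case using strict_mono_o[OF \<phi>(1) r(1)] by blast
qed

lemma inj_le_imp_id:
  fixes f :: "nat \<Rightarrow> nat"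
  assumes "inj_on f {..N}" "\<And>j. j \<le> N \<Longrightarrow> f j \<le> j" "j \<le> N"
  shows "f j = j"
  using assms(3)
proof (induction j rule: less_induct)
  case (less j)
  show ?case
  proof (rule ccontr)
    assume "f j \<noteq> j"
    then have "f j < j" using assms(2)[OF less.prems] by simp
    then have "f (f j) = f j" using less by simp
    then show False using assms(1) less.prems \<open>f j < j\<close> unfolding inj_on_def by fastforce
  qed
qed

text \<open>This is the labelling of a translation. The labels \<open>k\<close> and \<open>N\<close>
  put the two values of coordinate \<open>k\<close> on different sides of the threshold, so they are
  \<open>2 * K\<close> and \<open>2 * K + 1\<close>. A vertex with label \<open>l\<close> has its
  first \<open>l\<close> coordinates odd, so \<open>lab j \<le> j\<close>; as labels are distinct,
  \<open>lab j = j\<close>, and the coordinates are raised in their natural order.\<close>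

lemma unique_full_flag:
  assumes s: "flag N s" and K: "0 \<le> K"
    and lab: "\<And>j. j \<le> N \<Longrightarrow> lab j = (if \<exists>k<N. s j k \<le> 2 * K then LEAST k. k < N \<and> s j k \<le> 2 * K else N)"
    and full: "lab ` {..N} = {..N}"
  shows "s = (\<lambda>j k. if j \<le> N \<and> k < N then 2 * K + (if k < j then 1 else 0) else 0)"
proof -
  have inj: "inj_on lab {..N}" using full by (simp add: eq_card_imp_inj_on)
  have ex: "\<exists>j\<le>N. lab j = l" if "l \<le> N" for l
    using full that by (metis atMost_iff imageE)
  have vals: "s 0 k = 2 * K \<and> s N k = 2 * K + 1" if k: "k < N" for k
  proof -
    have two: "s j k = s 0 k \<or> s j k = s N k" if "j \<le> N" for j
      using flag_basic[OF s that] flag_odd_const[OF s that, of k] by fastforce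
    obtain j where j: "j \<le> N" "lab j = N" using ex by blast
    have "\<not> (\<exists>k<N. s j k \<le> 2 * K)"
    proof
      assume a: "\<exists>k<N. s j k \<le> 2 * K"
      then have "lab j < N" using lab[OF j(1)] by (smt (verit, best) LeastI_ex)
      then show False using j by simp
    qed
    then have up: "s j k > 2 * K" using k by (meson not_le)
    obtain i where i: "i \<le> N" "lab i = k" using ex[of k] k by auto
    have e: "\<exists>k<N. s i k \<le> 2 * K" using lab[OF i(1)] i(2) k by (metis less_irrefl)
    have "lab i = (LEAST k. k < N \<and> s i k \<le> 2 * K)" using lab[OF i(1)] e by simp
    then have dn: "s i k \<le> 2 * K" using LeastI_ex[OF e] i(2) by simp
    have "even (s 0 k)" "odd (s N k)" "\<bar>s N k - s 0 k\<bar> \<le> 1"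
      using flagD(1)[OF s] flag_top_odd[OF s k] flag_basic[OF s order_refl] by auto
    moreover have "s N k = s 0 k + 1 \<or> s N k = s 0 k - 1"
      using calculation by (smt (verit))
    moreover obtain m where "s 0 k = 2 * m" using \<open>even (s 0 k)\<close> by blast
    ultimately show ?thesis using two[OF j(1)] two[OF i(1)] up dn by presburger
  qed
  have le2: "s j k \<le> 2 * K \<longleftrightarrow> even (s j k)" if "j \<le> N" "k < N" for j k
  proof -
    have "odd (s j k) \<Longrightarrow> s j k = s N k" using flag_odd_const[OF s that(1) order_refl] by simp
    moreover have "even (s j k) \<Longrightarrow> s j k = s 0 k" using flag_basic[OF s that(1)] by auto
    ultimately show ?thesis using vals[OF that(2)] by fastforce
  qed
  have sub: "{..<lab j} \<subseteq> {k. k < N \<and> odd (s j k)}" if j: "j \<le> N" for j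
  proof
    fix k assume "k \<in> {..<lab j}"
    then have k: "k < lab j" by simp
    have "lab j \<le> N" using full j by (metis atMost_iff imageI)
    then have kN: "k < N" using k by simp
    have "\<not> s j k \<le> 2 * K"
    proof (cases "\<exists>k<N. s j k \<le> 2 * K")
      case True
      then have "k < (LEAST k. k < N \<and> s j k \<le> 2 * K)" using k lab[OF j] by simp
      then show ?thesis using not_less_Least kN by blast
    next
      case False
      then show ?thesis using kN by auto
    qed
    then show "k \<in> {k. k < N \<and> odd (s j k)}" using le2[OF j kN] kN by simp
  qed
  have crd: "card {k. k < N \<and> odd (s j k)} = j" if "j \<le> N" for j
    using flag_basic[OF s that] by simp
  have "lab j \<le> j" if "j \<le> N" for j
    using card_mono[OF _ sub[OF that]] crd[OF that] by simp
  then have "lab j = j" if "j \<le> N" for j using inj_le_imp_id[OF inj] that by blast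
  then have odds: "{k. k < N \<and> odd (s j k)} = {..<j}" if "j \<le> N" for j
    using card_subset_eq[OF _ sub[OF that]] crd[OF that] that by simp
  show ?thesis
  proof (intro ext)
    fix j k
    show "s j k = (if j \<le> N \<and> k < N then 2 * K + (if k < j then 1 else 0) else 0)"
    proof (cases "j \<le> N \<and> k < N")
      case True
      then have "odd (s j k) \<longleftrightarrow> k < j" using odds[of j] by blast
      moreover have "odd (s j k) \<Longrightarrow> s j k = s N k" using flag_odd_const[OF s, of j N k] True by auto
      moreover have "even (s j k) \<Longrightarrow> s j k = s 0 k" using flag_basic[OF s] True by blast
      ultimately show ?thesis using vals[of k] True by auto
    next
      case False
      then show ?thesis using flagD(3)[OF s, of j] flag_basic[OF s, of j] by (cases "j \<le> N") auto
    qed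
  qed
qed

lemma flag_standard:
  "flag N (\<lambda>j k. if j \<le> N \<and> k < N then 2 * K + (if k < j then 1 else 0) else 0)" (is "flag N ?s")
proof -
  have "\<exists>k<N. even (?s j k) \<and> (\<exists>e\<in>{1, -1}. ?s (Suc j) = (?s j)(k := ?s j k + e))" if "j < N" for j
    using that by (intro exI[of _ j]) (auto simp: fun_eq_iff)
  then show ?thesis unfolding flag_def by auto
qed

section \<open>Maps invariant under block sign changes\<close>

text \<open>Points are labelled by the first negative component. By \<open>far\<close> the label 0
  is bounded, so the number of fully labelled flags modulo signs is even at every mesh. By
  \<open>loc\<close>, at each boundary point of the small cube about (1, ..., 1) some component of
  \<open>h\<close> has the same strict sign as that of \<open>x - 1\<close>, so replacing
  \<open>h\<close> by \<open>x - 1\<close> inside the cube creates no zeros at the interface. For a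
  fine mesh every fully labelled flag then lies in the orbit of the cube, where there is exactly one
  modulo signs.\<close>

lemma flip_invariant_not_single_orbit:
  fixes h :: "(nat \<Rightarrow> real) \<Rightarrow> nat \<Rightarrow> real"
  assumes N: "2 \<le> N"
    and blk: "\<And>k. k < N \<Longrightarrow> \<exists>k'<N. k' \<noteq> k \<and> blk k' = blk k"
    and cont: "\<And>X x k. (\<And>k. k < N \<Longrightarrow> (\<lambda>n. X n k) \<longlonglongrightarrow> x k) \<Longrightarrow> k < N \<Longrightarrow> (\<lambda>n. h (X n) k) \<longlonglongrightarrow> h x k"
    and inv: "\<And>g x k. (\<And>b. g b \<in> {1, -1}) \<Longrightarrow> k < N \<Longrightarrow> h (flip blk g x) k = h x k"
    and zero: "\<And>x. (\<And>k. k < N \<Longrightarrow> h x k = 0) \<Longrightarrow> \<exists>g. (\<forall>b. g b \<in> {1, -1}) \<and> (\<forall>k<N. x k = g (blk k))"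
    and far: "\<And>x k. k < N \<Longrightarrow> R \<le> \<bar>x k\<bar> \<Longrightarrow> 0 < h x 0"
    and r: "0 < r" "r < 1"
    and loc: "\<And>x. (\<And>k. k < N \<Longrightarrow> \<bar>x k - 1\<bar> \<le> r) \<Longrightarrow> \<exists>k<N. \<bar>x k - 1\<bar> = r \<Longrightarrow>
        \<exists>k<N. \<not> ((h x k \<le> 0 \<or> x k \<le> 1) \<and> (0 \<le> h x k \<or> 1 \<le> x k))"
  shows False
proof -
  \<comment> \<open>The open cube of radius \<open>r\<close> about (1, ..., 1) together with its
    images under block sign changes; as \<open>r < 1\<close>, these stay away from the coordinate
    hyperplanes.\<close>
  define inB where "inB y \<longleftrightarrow> (\<forall>k<N. \<bar>\<bar>y k\<bar> - 1\<bar> < r) \<and> (\<forall>k<N. \<forall>l<N. blk k = blk l \<longrightarrow> 0 < y k * y l)"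
    for y :: "nat \<Rightarrow> real"
  \<comment> \<open>The map with \<open>h\<close> replaced near the orbit by the model
    \<open>y - 1\<close>, written in sign-invariant form.\<close>
  define val where "val y k = (if inB y then \<bar>y k\<bar> - 1 else h y k)" for y k
  define L where "L y = (if \<exists>k<N. val y k < 0 then LEAST k. k < N \<and> val y k < 0 else N)" for y
  \<comment> \<open>The mesh is such that 1 sits at the lattice value \<open>2 * K + 1 / 2\<close>,
    hence never at a vertex, and right above an even value.\<close>
  define \<delta> where "\<delta> K = 1 / (2 * real K + 1 / 2)" for K
  define pt where "pt K v = (\<lambda>k. \<delta> K * real_of_int (v k))" for K and v :: "nat \<Rightarrow> int"
  have \<delta>pos: "0 < \<delta> K" "\<delta> K \<le> 2" for K by (auto simp: \<delta>_def field_simps)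
  have \<delta>0: "\<delta> \<longlonglongrightarrow> 0"
  proof (rule Lim_null_comparison)
    show "\<forall>\<^sub>F K in sequentially. norm (\<delta> K) \<le> 2 * inverse (real (Suc K))"
      by (auto simp: \<delta>_def field_simps)
    show "(\<lambda>K. 2 * inverse (real (Suc K))) \<longlonglongrightarrow> 0"
      using tendsto_mult_right_zero[OF LIMSEQ_inverse_real_of_nat] .
  qed
  have abs_flip: "\<bar>flip blk g y k\<bar> = \<bar>y k\<bar>" if "\<And>b. g b \<in> {1, -1}" for g :: "nat \<Rightarrow> real" and y k
    using that[of "blk k"] by (auto simp: flip_def)
  have mult_flip: "flip blk g y k * flip blk g y l = y k * y l"
    if "\<And>b. g b \<in> {1, -1}" "blk k = blk l" for g :: "nat \<Rightarrow> real" and y k l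
    using that(1)[of "blk l"] that(2) by (auto simp: flip_def)
  have inB_flip: "inB (flip blk g y) \<longleftrightarrow> inB y" if "\<And>b. g b \<in> {1, -1}" for g y
    unfolding inB_def using abs_flip[OF that] mult_flip[OF that] by simp
  have L_flip: "L (flip blk g y) = L y" if g: "\<And>b. g b \<in> {1, -1}" for g y
  proof -
    have "val (flip blk g y) k = val y k" if "k < N" for k
      unfolding val_def using inB_flip[OF g] abs_flip[OF g] inv[OF g that] by simp
    then have "(\<lambda>k. k < N \<and> val (flip blk g y) k < 0) = (\<lambda>k. k < N \<and> val y k < 0)" by auto
    then show ?thesis unfolding L_def by (metis (no_types, lifting))
  qed
  have L_le: "L y \<le> N" for y
  proof (cases "\<exists>k<N. val y k < 0")
    case True
    then have "(LEAST k. k < N \<and> val y k < 0) < N" by (rule LeastI2_ex) auto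
    then show ?thesis using True by (simp add: L_def)
  next
    case False
    then show ?thesis unfolding L_def by (simp only: if_False order_refl)
  qed
  have L_less: "val y (L y) < 0" if "L y < N" for y
  proof -
    have e: "\<exists>k<N. val y k < 0" using that by (auto simp: L_def split: if_splits)
    then have "val y (LEAST k. k < N \<and> val y k < 0) < 0" by (rule LeastI2_ex) auto
    then show ?thesis using e by (simp add: L_def)
  qed
  have L_eq: "0 \<le> val y k" if "L y = N" "k < N" for y k
  proof (rule ccontr)
    assume "\<not> 0 \<le> val y k"
    then have e: "\<exists>k<N. val y k < 0" using that(2) by auto
    then have "(LEAST k. k < N \<and> val y k < 0) < N" by (rule LeastI2_ex) auto
    then show False using that(1) e by (simp add: L_def)
  qed
  \<comment> \<open>On \<open>inB\<close> the coordinates stay below \<open>1 + r < 2\<close>;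
    elsewhere \<open>far\<close> gives the bound \<open>R\<close>.\<close>
  define R' where "R' = max R 2"
  have L0_bdd: "\<bar>y k\<bar> \<le> R'" if "L y = 0" "k < N" for y k
  proof -
    have v: "val y 0 < 0" using L_less[of y] that N by simp
    show ?thesis
    proof (cases "inB y")
      case True
      then have "\<bar>\<bar>y k\<bar> - 1\<bar> < r" using that(2) by (simp add: inB_def)
      then show ?thesis using r(2) by (simp add: R'_def)
    next
      case False
      then have "h y 0 < 0" using v by (simp add: val_def)
      then show ?thesis using far[OF that(2), of y] by (force simp: R'_def)
    qed
  qed
  define full where "full K s \<longleftrightarrow> flag N s \<and> (\<forall>k<N. (\<forall>k'<k. blk k' \<noteq> blk k) \<longrightarrow> 0 < s N k) \<and>
     (\<lambda>j. L (pt K (s j))) ` {..N} = {..N}" for K s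
  have even: "even (card {s. full K s})" for K
    unfolding full_def
  proof (rule even_card_full_flags[OF N blk, where lab = "\<lambda>v. L (pt K v)" and M = "\<lceil>R' / \<delta> K\<rceil>"])
    show "L (pt K v) \<le> N" for v by (rule L_le)
    show "L (pt K (flip blk g v)) = L (pt K v)" if g: "\<And>b. g b \<in> {1, -1}" for g :: "nat \<Rightarrow> int" and v
    proof -
      have "pt K (flip blk g v) = flip blk (\<lambda>b. real_of_int (g b)) (pt K v)"
        by (auto simp: pt_def flip_def)
      moreover have "real_of_int (g b) \<in> {1, -1}" for b using g[of b] by auto
      ultimately show ?thesis using L_flip by metis
    qed
    show "\<bar>v k\<bar> \<le> \<lceil>R' / \<delta> K\<rceil>" if "L (pt K v) = 0" "k < N" for v k
    proof -
      have "\<delta> K * \<bar>real_of_int (v k)\<bar> \<le> R'" using L0_bdd[OF that] \<delta>pos(1)[of K] by (simp add: pt_def abs_mult)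
      then have "\<bar>real_of_int (v k)\<bar> \<le> R' / \<delta> K" using \<delta>pos(1)[of K] by (simp add: pos_le_divide_eq mult.commute)
      then show ?thesis by linarith
    qed
  qed auto
  \<comment> \<open>Otherwise offending flags at ever finer meshes shrink to a point
    \<open>x\<close>, and no position of \<open>x\<close> is possible: inside \<open>inB\<close> all
    vertices would eventually lie in \<open>inB\<close>, on its boundary \<open>loc\<close> is
    violated, and outside its closure \<open>h\<close> vanishes at \<open>x\<close>, which
    \<open>zero\<close> allows only on the orbit of (1, ..., 1).\<close>
  have claimA: "\<exists>K0. \<forall>K\<ge>K0. \<forall>s. full K s \<longrightarrow> (\<forall>j\<le>N. inB (pt K (s j)))"
  proof (rule ccontr)
    assume "\<not> ?thesis"
    then have "\<forall>n. \<exists>K s. n \<le> K \<and> full K s \<and> (\<exists>j\<le>N. \<not> inB (pt K (s j)))" by meson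
    then obtain K S where KS: "\<And>n. n \<le> K n" "\<And>n. full (K n) (S n)"
      "\<And>n. \<exists>j\<le>N. \<not> inB (pt (K n) (S n j))" by metis
    have fl: "flag N (S n)" for n using KS(2) by (simp add: full_def)
    have labs: "\<exists>j\<le>N. L (pt (K n) (S n j)) = l" if "l \<le> N" for n l
      using KS(2)[of n] that unfolding full_def by (metis (mono_tags, lifting) atMost_iff imageE)
    have \<delta>K: "(\<lambda>n. \<delta> (K n)) \<longlonglongrightarrow> 0"
    proof (rule filterlim_compose[OF \<delta>0])
      show "filterlim K sequentially sequentially"
        by (rule filterlim_at_top_mono[OF filterlim_ident]) (use KS(1) in auto)
    qed
    have near: "\<bar>pt (K n) (S n i) k - pt (K n) (S n j) k\<bar> \<le> 2 * \<delta> (K n)" if "i \<le> N" "j \<le> N" for n i j k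
    proof -
      have "real_of_int \<bar>S n i k - S n j k\<bar> \<le> 2" using flag_dist[OF fl that] by (metis of_int_le_numeral_iff)
      then have "\<delta> (K n) * \<bar>real_of_int (S n i k) - real_of_int (S n j k)\<bar> \<le> \<delta> (K n) * 2"
        using \<delta>pos[of "K n"] by (intro mult_left_mono) auto
      then show ?thesis using \<delta>pos[of "K n"] by (simp add: pt_def abs_mult right_diff_distrib[symmetric] mult.commute)
    qed
    have bdd: "\<bar>pt (K n) (S n 0) k\<bar> \<le> R' + 4" if "k < N" for n k
    proof -
      obtain j where j: "j \<le> N" "L (pt (K n) (S n j)) = 0" using labs[of 0 n] by auto
      show ?thesis using L0_bdd[OF j(2) that] near[of 0 j n k] j(1) \<delta>pos[of "K n"] by simp
    qed
    obtain \<phi> x where \<phi>: "strict_mono \<phi>" and x: "\<And>k. k < N \<Longrightarrow> (\<lambda>n. pt (K (\<phi> n)) (S (\<phi> n) 0) k) \<longlonglongrightarrow> x k"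
      using convergent_subseq_coordinates[where N = N and X = "\<lambda>n. pt (K n) (S n 0)", OF bdd] by auto
    define Y where "Y n j = pt (K (\<phi> n)) (S (\<phi> n) j)" for n j
    have \<delta>\<phi>: "(\<lambda>n. \<delta> (K (\<phi> n))) \<longlonglongrightarrow> 0"
      using LIMSEQ_subseq_LIMSEQ[OF \<delta>K \<phi>] by (simp add: o_def)
    have Ylim: "(\<lambda>n. Y n (a n) k) \<longlonglongrightarrow> x k" if "\<And>n. a n \<le> N" "k < N" for a k
    proof -
      have "(\<lambda>n. Y n (a n) k - Y n 0 k) \<longlonglongrightarrow> 0"
      proof (rule Lim_null_comparison)
        show "\<forall>\<^sub>F n in sequentially. norm (Y n (a n) k - Y n 0 k) \<le> 2 * \<delta> (K (\<phi> n))"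
          unfolding Y_def using near that by (auto intro!: always_eventually)
        show "(\<lambda>n. 2 * \<delta> (K (\<phi> n))) \<longlonglongrightarrow> 0" using tendsto_mult_right_zero[OF \<delta>\<phi>] by simp
      qed
      then show ?thesis using Lim_transform[OF x[OF that(2)]] by (simp add: Y_def)
    qed
    have lim_val: "\<exists>a. (\<forall>n. a n \<le> N \<and> L (Y n (a n)) = l)" if "l \<le> N" for l
    proof (rule choice)
      show "\<forall>n. \<exists>j. j \<le> N \<and> L (Y n j) = l" unfolding Y_def using labs[OF that] by blast
    qed
    \<comment> \<open>Component \<open>k\<close> of \<open>val\<close> is negative at the vertex
      with label \<open>k\<close> and nonnegative at the one with label \<open>N\<close>. Since each
      of these values may come from \<open>h\<close> or from the model, the limit only excludes a
      strict sign that both share and that contradicts the label.\<close>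
    have neg: "(h x k \<le> 0 \<or> \<bar>x k\<bar> \<le> 1) \<and> (0 \<le> h x k \<or> 1 \<le> \<bar>x k\<bar>)" if k: "k < N" for k
    proof (intro conjI; rule ccontr)
      assume "\<not> (h x k \<le> 0 \<or> \<bar>x k\<bar> \<le> 1)"
      then have a: "0 < h x k" "1 < \<bar>x k\<bar>" by auto
      obtain a where a': "\<And>n. a n \<le> N" "\<And>n. L (Y n (a n)) = k" using lim_val[of k] k by auto
      have "\<forall>\<^sub>F n in sequentially. 0 < h (Y n (a n)) k"
        by (rule order_tendstoD(1)[OF cont[OF Ylim[OF a'(1)] k] a(1)])
      moreover have "\<forall>\<^sub>F n in sequentially. 1 < \<bar>Y n (a n) k\<bar>"
        by (rule order_tendstoD(1)[OF tendsto_rabs[OF Ylim[OF a'(1) k]] a(2)])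
      ultimately have "\<forall>\<^sub>F n in sequentially. 0 < val (Y n (a n)) k"
        by eventually_elim (simp add: val_def)
      then obtain n where "0 < val (Y n (a n)) k" using eventually_happens'[OF sequentially_bot] by blast
      then show False using L_less[of "Y n (a n)"] a'(2)[of n] k by simp
    next
      assume "\<not> (0 \<le> h x k \<or> 1 \<le> \<bar>x k\<bar>)"
      then have a: "h x k < 0" "\<bar>x k\<bar> < 1" by auto
      obtain a where a': "\<And>n. a n \<le> N" "\<And>n. L (Y n (a n)) = N" using lim_val[of N] by auto
      have "\<forall>\<^sub>F n in sequentially. h (Y n (a n)) k < 0"
        by (rule order_tendstoD(2)[OF cont[OF Ylim[OF a'(1)] k] a(1)])
      moreover have "\<forall>\<^sub>F n in sequentially. \<bar>Y n (a n) k\<bar> < 1"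
        by (rule order_tendstoD(2)[OF tendsto_rabs[OF Ylim[OF a'(1) k]] a(2)])
      ultimately have "\<forall>\<^sub>F n in sequentially. val (Y n (a n)) k < 0"
        by eventually_elim (simp add: val_def)
      then obtain n where "val (Y n (a n)) k < 0" using eventually_happens'[OF sequentially_bot] by blast
      then show False using L_eq[OF a'(2)[of n] k] by simp
    qed
    have lim_prod: "(\<lambda>n. Y n (a n) k * Y n (a n) l) \<longlonglongrightarrow> x k * x l" if "\<And>n. a n \<le> N" "k < N" "l < N" for a k l
      using that by (intro tendsto_mult Ylim)
    have lim_abs: "(\<lambda>n. \<bar>\<bar>Y n (a n) k\<bar> - 1\<bar>) \<longlonglongrightarrow> \<bar>\<bar>x k\<bar> - 1\<bar>" if "\<And>n. a n \<le> N" "k < N" for a k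
      using that by (intro tendsto_rabs tendsto_diff Ylim tendsto_const)
    show False
    proof (cases "(\<forall>k<N. \<bar>\<bar>x k\<bar> - 1\<bar> \<le> r) \<and> (\<forall>k<N. \<forall>l<N. blk k = blk l \<longrightarrow> 0 \<le> x k * x l)")
      case cl: True
      show False
      proof (cases "inB x")
        case True
        have "\<forall>n. \<exists>j. j \<le> N \<and> \<not> inB (Y n j)" unfolding Y_def using KS(3) by blast
        from choice[OF this] obtain a where a: "\<And>n. a n \<le> N" "\<And>n. \<not> inB (Y n (a n))" by blast
        have "\<forall>\<^sub>F n in sequentially. \<forall>k\<in>{..<N}. \<bar>\<bar>Y n (a n) k\<bar> - 1\<bar> < r"
          using True unfolding inB_def
          by (intro eventually_ball_finite) (auto intro: order_tendstoD(2)[OF lim_abs[OF a(1)]])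
        moreover have "\<forall>\<^sub>F n in sequentially. \<forall>k\<in>{..<N}. \<forall>l\<in>{l. l < N \<and> blk k = blk l}. 0 < Y n (a n) k * Y n (a n) l"
          using True unfolding inB_def
          by (intro eventually_ball_finite ballI) (auto intro: order_tendstoD(1)[OF lim_prod[OF a(1)]])
        ultimately have "\<forall>\<^sub>F n in sequentially. inB (Y n (a n))"
          by eventually_elim (auto simp: inB_def)
        then show False using a(2) eventually_happens'[OF sequentially_bot] by blast
      next
        case False
        \<comment> \<open>These signs move \<open>x\<close> to the positive orthant, where
          \<open>loc\<close> applies. They are consistent on blocks because products within a block
          are nonnegative and no coordinate is 0.\<close>
        define g :: "nat \<Rightarrow> real" where "g b = (if \<exists>k<N. blk k = b \<and> x k < 0 then -1 else 1)" for b
        have g: "g b \<in> {1, -1}" for b by (simp add: g_def)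
        have nz: "1 - r \<le> \<bar>x k\<bar>" if "k < N" for k using cl that by (smt (verit))
        have y: "flip blk g x k = \<bar>x k\<bar>" if "k < N" for k
        proof (cases "x k < 0")
          case True
          then show ?thesis using that by (auto simp: flip_def g_def)
        next
          case False
          have "0 < x k" using False nz[OF that] r by simp
          have "\<not> (\<exists>l<N. blk l = blk k \<and> x l < 0)"
          proof
            assume "\<exists>l<N. blk l = blk k \<and> x l < 0"
            then obtain l where l: "l < N" "blk l = blk k" "x l < 0" by auto
            then have "x l * x k < 0" using \<open>0 < x k\<close> by (simp add: mult_neg_pos)
            then show False using cl l that by force
          qed
          then have "g (blk k) = 1" unfolding g_def by (simp only: if_False)
          then show ?thesis using False by (simp add: flip_def)
        qed
        have "\<exists>k<N. \<bar>\<bar>x k\<bar> - 1\<bar> = r"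
        proof (rule ccontr)
          assume "\<not> ?thesis"
          then have "\<forall>k<N. \<bar>\<bar>x k\<bar> - 1\<bar> < r" using cl by force
          moreover have "0 < x k * x l" if "k < N" "l < N" "blk k = blk l" for k l
          proof -
            have "x k \<noteq> 0" "x l \<noteq> 0" using nz that r by fastforce+
            then show ?thesis using cl that by (metis mult_eq_0_iff order_le_less)
          qed
          ultimately show False using False by (auto simp: inB_def)
        qed
        then have "\<exists>k<N. \<bar>flip blk g x k - 1\<bar> = r" using y by auto
        moreover have "\<bar>flip blk g x k - 1\<bar> \<le> r" if "k < N" for k using y[OF that] cl that by simp
        ultimately obtain k where k: "k < N" "\<not> ((h (flip blk g x) k \<le> 0 \<or> flip blk g x k \<le> 1) \<and>
            (0 \<le> h (flip blk g x) k \<or> 1 \<le> flip blk g x k))"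
          using loc[of "flip blk g x"] by blast
        then show False using neg[OF k(1)] inv[where g = g and k = k and x = x, OF g k(1)] y[OF k(1)] by simp
      qed
    next
      case False
      have out: "\<forall>\<^sub>F n in sequentially. \<not> inB (Y n (a n))" if a: "\<And>n. a n \<le> N" for a
      proof (cases "\<forall>k<N. \<bar>\<bar>x k\<bar> - 1\<bar> \<le> r")
        case True
        then obtain k l where kl: "k < N" "l < N" "blk k = blk l" "x k * x l < 0" using False by force
        have "\<forall>\<^sub>F n in sequentially. Y n (a n) k * Y n (a n) l < 0"
          by (rule order_tendstoD(2)[OF lim_prod[OF a kl(1,2)] kl(4)])
        then show ?thesis by (rule eventually_mono) (use kl(1-3) in \<open>force simp: inB_def\<close>)
      next
        case False
        then obtain k where k: "k < N" "r < \<bar>\<bar>x k\<bar> - 1\<bar>" by force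
        have "\<forall>\<^sub>F n in sequentially. r < \<bar>\<bar>Y n (a n) k\<bar> - 1\<bar>"
          by (rule order_tendstoD(1)[OF lim_abs[OF a k(1)] k(2)])
        then show ?thesis by (rule eventually_mono) (use k(1) in \<open>force simp: inB_def\<close>)
      qed
      have "h x k = 0" if k: "k < N" for k
      proof (rule antisym)
        obtain a where a: "\<And>n. a n \<le> N" "\<And>n. L (Y n (a n)) = k" using lim_val[of k] k by auto
        have "\<forall>\<^sub>F n in sequentially. h (Y n (a n)) k \<le> 0"
        proof (rule eventually_mono[OF out[of a]])
          show "h (Y n (a n)) k \<le> 0" if "\<not> inB (Y n (a n))" for n
            using that L_less[of "Y n (a n)"] a(2)[of n] k by (simp add: val_def)
        qed (rule a(1))
        then show "h x k \<le> 0" using tendsto_upperbound[OF cont[OF Ylim[of a] k]] a(1) by simp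
        obtain b where b: "\<And>n. b n \<le> N" "\<And>n. L (Y n (b n)) = N" using lim_val[of N] by auto
        have "\<forall>\<^sub>F n in sequentially. 0 \<le> h (Y n (b n)) k"
        proof (rule eventually_mono[OF out[of b]])
          show "0 \<le> h (Y n (b n)) k" if "\<not> inB (Y n (b n))" for n
            using that L_eq[OF b(2)[of n] k] by (simp add: val_def)
        qed (rule b(1))
        then show "0 \<le> h x k" using tendsto_lowerbound[OF cont[OF Ylim[of b] k]] b(1) by simp
      qed
      then obtain g where g: "\<forall>b. g b \<in> {1, -1}" "\<forall>k<N. x k = g (blk k)" using zero by blast
      have "\<bar>g b\<bar> = 1" for b using g(1)[rule_format, of b] by auto
      then show False using False g(2) r by auto
    qed
  qed
  then obtain K0 where K0: "\<And>K s j. K0 \<le> K \<Longrightarrow> full K s \<Longrightarrow> j \<le> N \<Longrightarrow> inB (pt K (s j))" by blast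
  have "\<forall>\<^sub>F K in sequentially. \<delta> K < min (2 * r) (1 - r)" using order_tendstoD(2)[OF \<delta>0, of "min (2 * r) (1 - r)"] r by simp
  then have "\<forall>\<^sub>F K in sequentially. K0 \<le> K \<and> \<delta> K < min (2 * r) (1 - r)"
    using eventually_ge_at_top[of K0] by eventually_elim simp
  \<comment> \<open>The bound \<open>2 * r\<close> puts the standard flag, with coordinates
    \<open>1 - \<delta> K / 2\<close> and \<open>1 + \<delta> K / 2\<close>, into the cube. The
    bound \<open>1 - r\<close> keeps coordinates of one flag, which differ by at most
    \<open>2 * \<delta> K\<close>, from jumping the gap \<open>2 * (1 - r)\<close> between the two
    signs.\<close>
  then obtain K where K: "K0 \<le> K" "\<delta> K < 2 * r" "\<delta> K < 1 - r"
    using eventually_happens'[OF sequentially_bot] by fastforce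
  define s0 where "s0 = (\<lambda>j k. if j \<le> N \<and> k < N then 2 * int K + (if k < j then 1 else 0) else 0)"
  have \<delta>K: "\<delta> K * (2 * real K) = 1 - \<delta> K / 2"
    by (simp add: \<delta>_def field_simps)
  have less1: "\<delta> K * real_of_int m - 1 < 0 \<longleftrightarrow> m \<le> 2 * int K" for m
  proof -
    have "\<delta> K * real_of_int m - 1 < 0 \<longleftrightarrow> \<delta> K * real_of_int m < \<delta> K * (2 * real K + 1 / 2)"
      using \<delta>K by (simp add: algebra_simps)
    also have "\<dots> \<longleftrightarrow> real_of_int m < 2 * real K + 1 / 2" using \<delta>pos(1)[of K] by simp
    also have "\<dots> \<longleftrightarrow> m \<le> 2 * int K" by linarith
    finally show ?thesis .
  qed
  have lab: "L (pt K v) = (if \<exists>k<N. v k \<le> 2 * int K then LEAST k. k < N \<and> v k \<le> 2 * int K else N)"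
    if v: "inB (pt K v)" "\<And>k. k < N \<Longrightarrow> 0 \<le> v k" for v
  proof -
    have "val (pt K v) k < 0 \<longleftrightarrow> v k \<le> 2 * int K" if k: "k < N" for k
      using v(1) less1[of "v k"] v(2)[OF k] \<delta>pos(1)[of K] by (simp add: val_def pt_def)
    then have eq: "k < N \<and> val (pt K v) k < 0 \<longleftrightarrow> k < N \<and> v k \<le> 2 * int K" for k by auto
    show ?thesis unfolding L_def by (simp only: eq)
  qed
  have "full K s0"
  proof -
    have inB0: "inB (pt K (s0 j))" if "j \<le> N" for j
    proof -
      have "\<bar>pt K (s0 j) k - 1\<bar> < r" if "k < N" for k
        using \<delta>K K(2) \<open>j \<le> N\<close> that \<delta>pos(1)[of K] r(1) by (auto simp: pt_def s0_def algebra_simps)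
      moreover have "0 < pt K (s0 j) k" if "k < N" for k using calculation[OF that] r(2) by linarith
      ultimately show ?thesis unfolding inB_def by (smt (verit, best) zero_less_mult_iff)
    qed
    have "L (pt K (s0 j)) = j" if j: "j \<le> N" for j
    proof -
      have "L (pt K (s0 j)) = (if \<exists>k<N. s0 j k \<le> 2 * int K then LEAST k. k < N \<and> s0 j k \<le> 2 * int K else N)"
        by (rule lab[OF inB0[OF j]]) (auto simp: s0_def)
      moreover have eq: "k < N \<and> s0 j k \<le> 2 * int K \<longleftrightarrow> k < N \<and> j \<le> k" for k
        using j by (auto simp: s0_def)
      ultimately have L: "L (pt K (s0 j)) = (if \<exists>k<N. j \<le> k then LEAST k. k < N \<and> j \<le> k else N)"
        by (simp only: eq)
      show ?thesis
      proof (cases "j < N")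
        case True
        then have "(LEAST k. k < N \<and> j \<le> k) = j" by (intro Least_equality) auto
        moreover have "\<exists>k<N. j \<le> k" using True by auto
        ultimately show ?thesis using L by (simp only: if_True)
      next
        case False
        then have "\<not> (\<exists>k<N. j \<le> k)" using j by auto
        then have "L (pt K (s0 j)) = N" using L by (simp only: if_False)
        then show ?thesis using False j by simp
      qed
    qed
    then have "(\<lambda>j. L (pt K (s0 j))) ` {..N} = {..N}" by (force simp: image_iff)
    moreover have "flag N s0" unfolding s0_def by (rule flag_standard)
    ultimately show ?thesis unfolding full_def by (auto simp: s0_def)
  qed
  moreover have "s = s0" if s: "full K s" for s
  proof -
    have fl: "flag N s" using s by (simp add: full_def)
    have inB: "inB (pt K (s j))" if "j \<le> N" for j using K0[OF K(1) s that] .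
    \<comment> \<open>The first coordinate of each block is positive by the choice of fundamental
      domain, and \<open>inB\<close> gives the rest of the block the same sign.\<close>
    have top: "0 < s N k" if k: "k < N" for k
    proof -
      define l where "l = (LEAST l. blk l = blk k)"
      have l: "blk l = blk k" unfolding l_def by (rule LeastI[of _ k]) simp
      have "l \<le> k" unfolding l_def by (rule Least_le) simp
      have "\<forall>k'<l. blk k' \<noteq> blk l" using l not_less_Least unfolding l_def by metis
      then have "0 < s N l" using s k \<open>l \<le> k\<close> by (auto simp: full_def)
      moreover have "0 < pt K (s N) k * pt K (s N) l"
        using inB[of N] k l \<open>l \<le> k\<close> by (simp add: inB_def)
      moreover have "0 < pt K (s N) l" using calculation(1) \<delta>pos(1)[of K] by (simp add: pt_def)
      ultimately have "0 < pt K (s N) k" by (metis zero_less_mult_pos2)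
      then show ?thesis using \<delta>pos(1)[of K] by (simp add: pt_def zero_less_mult_iff)
    qed
    have pos: "0 \<le> s j k" if "j \<le> N" "k < N" for j k
    proof (rule ccontr)
      assume "\<not> 0 \<le> s j k"
      then have "\<delta> K * real_of_int (s j k) < 0" using \<delta>pos(1)[of K] by (simp add: mult_pos_neg)
      moreover have "\<bar>\<bar>\<delta> K * real_of_int (s j k)\<bar> - 1\<bar> < r" "\<bar>\<bar>\<delta> K * real_of_int (s N k)\<bar> - 1\<bar> < r"
        using inB[OF that(1)] inB[of N] that(2) by (auto simp: inB_def pt_def)
      moreover have "0 < \<delta> K * real_of_int (s N k)" using top[OF that(2)] \<delta>pos(1)[of K] by simp
      ultimately have "2 * (1 - r) < \<delta> K * real_of_int (s N k) - \<delta> K * real_of_int (s j k)" by (smt (verit))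
      also have "\<dots> = \<delta> K * real_of_int (s N k - s j k)" by (simp add: algebra_simps)
      also have "\<dots> \<le> \<delta> K * 2"
        using flag_dist[OF fl, of N j k] that(1) \<delta>pos(1)[of K] by (intro mult_left_mono) auto
      finally show False using K(3) by simp
    qed
    show ?thesis unfolding s0_def
    proof (rule unique_full_flag[OF fl])
      show "(\<lambda>j. L (pt K (s j))) ` {..N} = {..N}" using s by (simp add: full_def)
    qed (use lab inB pos in auto)
  qed
  ultimately have "{s. full K s} = {s0}" by blast
  then show False using even[of K] by simp
qed

section \<open>Infinitesimal flexes\<close>

lemma skew_inner:
  fixes A :: "real ^ 'd::finite ^ 'd"
  assumes "transpose A = - A"
  shows "x \<bullet> (A *v y) = - ((A *v x) \<bullet> y)"
proof -
  have "x \<bullet> (A *v y) = (transpose A *v x) \<bullet> y" by (simp add: dot_lmul_matrix[symmetric])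
  also have "transpose A *v x = - (A *v x)"
    unfolding assms by (simp add: matrix_vector_mult_def vec_eq_iff sum_negf)
  finally show ?thesis by simp
qed

lemma skew_inner_self:
  fixes A :: "real ^ 'd::finite ^ 'd"
  assumes "transpose A = - A"
  shows "x \<bullet> (A *v x) = 0"
  using skew_inner[OF assms, of x x] by (simp add: inner_commute)

text \<open>The elementary skew matrices, one for each 2-subset of the indices, are nonzero and
  pairwise orthogonal.\<close>

lemma dim_skew: "CARD('d) choose 2 \<le> dim {A :: real ^ 'd::finite ^ 'd. transpose A = - A}"
proof -
  let ?P = "{S :: 'd set. S \<subseteq> UNIV \<and> card S = 2}"
  have "\<forall>S\<in>?P. \<exists>p. S = {fst p, snd p} \<and> fst p \<noteq> snd p" by (auto simp: card_2_iff)
  then obtain p where p: "\<And>S. S \<in> ?P \<Longrightarrow> S = {fst (p S), snd (p S)} \<and> fst (p S) \<noteq> snd (p S)" by metis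
  define X :: "'d set \<Rightarrow> real ^ 'd ^ 'd" where
    "X S = axis (fst (p S)) (axis (snd (p S)) 1) - axis (snd (p S)) (axis (fst (p S)) 1)" for S
  have X: "X S \<bullet> X T = (if S = T then 2 else 0)" if "S \<in> ?P" "T \<in> ?P" for S T
  proof (cases "S = T")
    case True
    have "fst (p S) \<noteq> snd (p S)" using p[OF that(1)] by blast
    then show ?thesis using True by (simp add: X_def inner_diff_left inner_diff_right inner_axis_axis)
  next
    case False
    have "\<not> (fst (p S) = fst (p T) \<and> snd (p S) = snd (p T))" "\<not> (fst (p S) = snd (p T) \<and> snd (p S) = fst (p T))"
      using p[OF that(1)] p[OF that(2)] False by (metis, metis insert_commute)
    then show ?thesis using False by (auto simp: X_def inner_diff_left inner_diff_right inner_axis_axis)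
  qed
  have inj: "inj_on X ?P"
  proof (rule inj_onI, rule ccontr)
    fix S T assume ST: "S \<in> ?P" "T \<in> ?P" "X S = X T" "S \<noteq> T"
    show False using X[OF ST(1) ST(1)] X[OF ST(1) ST(2)] ST(3,4) by simp
  qed
  have "independent (X ` ?P)"
  proof (rule pairwise_orthogonal_independent)
    show "pairwise orthogonal (X ` ?P)"
      unfolding pairwise_image orthogonal_def using X by (simp add: pairwise_def)
    show "0 \<notin> X ` ?P"
    proof
      assume "0 \<in> X ` ?P"
      then obtain S where "S \<in> ?P" "X S = 0" by auto
      then show False using X[of S S] by simp
    qed
  qed
  moreover have "X ` ?P \<subseteq> {A. transpose A = - A}"
    by (auto simp: X_def transpose_def axis_def vec_eq_iff)
  ultimately have "card (X ` ?P) \<le> dim {A :: real ^ 'd ^ 'd. transpose A = - A}"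
    by (intro independent_card_le_dim)
  moreover have "card (X ` ?P) = CARD('d) choose 2"
    using card_image[OF inj] n_subsets[of "UNIV :: 'd set" 2] by simp
  ultimately show ?thesis by simp
qed

section \<open>Trivial flexes and infinitesimal rigidity\<close>

definition trivial_flexes :: "('d::finite, 'v::finite) framework \<Rightarrow> ('d, 'v) framework set" where
  "trivial_flexes \<rho> = {\<tau>. \<exists>A b. transpose A = - A \<and> (\<forall>u. \<tau> $ u = A *v \<rho> $ u + b)}"

lemma subspace_skew: "subspace {A :: real ^ 'd::finite ^ 'd. transpose A = - A}"
proof (rule subspaceI)
  have add: "transpose (x + y) = transpose x + transpose y" for x y :: "real ^ 'd ^ 'd"
    by (simp add: transpose_def vec_eq_iff)
  have scale: "transpose (c *\<^sub>R x) = c *\<^sub>R transpose x" for c and x :: "real ^ 'd ^ 'd"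
    by (simp add: transpose_def vec_eq_iff)
  show "0 \<in> {A :: real ^ 'd ^ 'd. transpose A = - A}" by (simp add: transpose_def vec_eq_iff)
  show "x + y \<in> {A :: real ^ 'd ^ 'd. transpose A = - A}"
    if "x \<in> {A. transpose A = - A}" "y \<in> {A. transpose A = - A}" for x y
    using that by (simp add: add)
  show "c *\<^sub>R x \<in> {A :: real ^ 'd ^ 'd. transpose A = - A}" if "x \<in> {A. transpose A = - A}" for c x
    using that by (simp add: scale)
qed

lemma trivial_flexes_image:
  "trivial_flexes \<rho> = (\<lambda>(A, b). \<chi> u. A *v \<rho> $ u + b) ` ({A. transpose A = - A} \<times> UNIV)"
proof
  show "trivial_flexes \<rho> \<subseteq> (\<lambda>(A, b). \<chi> u. A *v \<rho> $ u + b) ` ({A. transpose A = - A} \<times> UNIV)"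
  proof
    fix \<tau> assume "\<tau> \<in> trivial_flexes \<rho>"
    then obtain A b where A: "transpose A = - A" "\<And>u. \<tau> $ u = A *v \<rho> $ u + b" unfolding trivial_flexes_def by blast
    then have "\<tau> = (\<lambda>(A, b). \<chi> u. A *v \<rho> $ u + b) (A, b)" by (simp add: vec_eq_iff[of \<tau>])
    then show "\<tau> \<in> (\<lambda>(A, b). \<chi> u. A *v \<rho> $ u + b) ` ({A. transpose A = - A} \<times> UNIV)"
      using A(1) by blast
  qed
  show "(\<lambda>(A, b). \<chi> u. A *v \<rho> $ u + b) ` ({A. transpose A = - A} \<times> UNIV) \<subseteq> trivial_flexes \<rho>"
    by (force simp: trivial_flexes_def)
qed

lemma linear_trivial_flexes_map:
  "linear (\<lambda>(A :: real ^ 'd::finite ^ 'd, b). (\<chi> u. A *v \<rho> $ u + b) :: ('d, 'v::finite) framework)"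
proof (rule linearI)
  let ?f = "\<lambda>(A :: real ^ 'd ^ 'd, b). (\<chi> u. A *v \<rho> $ u + b) :: ('d, 'v) framework"
  fix x y :: "(real ^ 'd ^ 'd) \<times> (real ^ 'd)" and c :: real
  show "?f (x + y) = ?f x + ?f y"
    by (cases x, cases y, rule iffD2[OF vec_eq_iff]) (simp add: matrix_vector_mult_add_rdistrib)
  show "?f (c *\<^sub>R x) = c *\<^sub>R ?f x"
    by (cases x, rule iffD2[OF vec_eq_iff]) (simp add: scaleR_matrix_vector_assoc scaleR_add_right)
qed

lemma subspace_trivial_flexes: "subspace (trivial_flexes \<rho>)"
  unfolding trivial_flexes_image
  by (intro linear_subspace_image[OF linear_trivial_flexes_map] subspace_Times subspace_skew subspace_UNIV)

text \<open>The pair \<open>(A, b)\<close> is determined by its flex: if the flex is 0, row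
  \<open>i\<close> of \<open>A\<close> and \<open>- b $ i\<close> describe a hyperplane through all
  points, so the row is 0. Skew matrices and translations then add up to the binomial
  coefficient.\<close>

lemma dim_trivial_flexes:
  fixes \<rho> :: "('d::finite, 'v::finite) framework"
  assumes "spanning \<rho>"
  shows "(CARD('d) + 1) choose 2 \<le> dim (trivial_flexes \<rho>)"
proof -
  let ?f = "\<lambda>(A :: real ^ 'd ^ 'd, b). (\<chi> u. A *v \<rho> $ u + b) :: ('d, 'v) framework"
  let ?S = "{A :: real ^ 'd ^ 'd. transpose A = - A} \<times> (UNIV :: (real ^ 'd) set)"
  have "x = 0" if "?f x = 0" for x
  proof -
    obtain A b where x: "x = (A, b)" by (cases x)
    have *: "A *v \<rho> $ u + b = 0" for u using that unfolding x by (simp add: vec_eq_iff)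
    have "A $ i = 0" for i
    proof -
      have "A $ i \<bullet> \<rho> $ u = - b $ i" for u
        using arg_cong[OF *[of u], of "\<lambda>y. y $ i"] by (simp add: matrix_vector_mul_component)
      then show ?thesis using assms unfolding spanning_def by blast
    qed
    then have "A = 0" by (simp add: vec_eq_iff)
    then show ?thesis using *[of undefined] x by (simp add: zero_prod_def)
  qed
  then have "inj ?f" using linear_injective_0[OF linear_trivial_flexes_map] by blast
  then have "dim (?f ` ?S) = dim ?S"
    using dim_image_eq[OF linear_trivial_flexes_map] inj_on_subset by blast
  also have "\<dots> = dim {A :: real ^ 'd ^ 'd. transpose A = - A} + CARD('d)"
    by (simp add: dim_Times subspace_skew)
  finally show ?thesis
    using dim_skew[where 'd = 'd] by (simp add: trivial_flexes_image numeral_2_eq_2)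
qed

lemma trivial_flexes_subset_kernel:
  assumes "is_graph E"
  shows "trivial_flexes \<rho> \<subseteq> {\<tau>. edge_form E \<rho> \<tau> = 0}"
proof
  fix \<tau> assume "\<tau> \<in> trivial_flexes \<rho>"
  then obtain A b where A: "transpose A = - A" "\<And>u. \<tau> $ u = A *v \<rho> $ u + b" unfolding trivial_flexes_def by blast
  have "edge_form E \<rho> \<tau> = 0"
  proof (rule edge_form_eqI[OF assms])
    fix u w assume "{u, w} \<in> E" "u \<noteq> w"
    then have "edge_form E \<rho> \<tau> $ {u, w} = (\<rho> $ u - \<rho> $ w) \<bullet> (A *v (\<rho> $ u - \<rho> $ w))"
      by (simp add: edge_form_edge A(2) matrix_vector_mult_diff_distrib)
    then show "edge_form E \<rho> \<tau> $ {u, w} = 0 $ {u, w}" by (simp add: skew_inner_self[OF A(1)])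
  qed simp
  then show "\<tau> \<in> {\<tau>. edge_form E \<rho> \<tau> = 0}" by simp
qed

lemma rank_plus_flexes:
  fixes \<rho> :: "('d::finite, 'v::finite) framework"
  shows "dim (range (edge_form E \<rho>)) + dim {\<tau>. edge_form E \<rho> \<tau> = 0} = CARD('v) * CARD('d)"
  using dim_range_kernel[OF linear_edge_form, of E \<rho>] by simp

lemma spanning_rigid_kernel:
  fixes \<rho> :: "('d::finite, 'v::finite) framework"
  assumes "is_graph E" "spanning \<rho>"
    and "CARD('v) * CARD('d) - ((CARD('d) + 1) choose 2) \<le> dim (range (edge_form E \<rho>))"
  shows "{\<tau>. edge_form E \<rho> \<tau> = 0} = trivial_flexes \<rho>" "dim {\<tau>. edge_form E \<rho> \<tau> = 0} = (CARD('d) + 1) choose 2"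
proof -
  let ?K = "{\<tau>. edge_form E \<rho> \<tau> = 0}" and ?D = "(CARD('d) + 1) choose 2"
  have 1: "?D \<le> dim (trivial_flexes \<rho>)" by (rule dim_trivial_flexes) fact
  have 2: "dim (trivial_flexes \<rho>) \<le> dim ?K" by (rule dim_subset[OF trivial_flexes_subset_kernel]) fact
  have 3: "dim ?K \<le> ?D" using rank_plus_flexes[of E \<rho>] assms(3) 1 2 by linarith
  show "?K = trivial_flexes \<rho>"
    using subspace_dim_equal[OF subspace_trivial_flexes linear_subspace_kernel[OF linear_edge_form] trivial_flexes_subset_kernel[OF assms(1)], of \<rho>] 1 3
    by (metis le_trans)
  show "dim ?K = ?D" using 1 2 3 by simp
qed

text \<open>A framework in a hyperplane with normal \<open>e\<close> is flexed by every displacement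
  along \<open>e\<close>. With more than \<open>d\<close> vertices, such a flex \<open>z\<close> can
  be chosen orthogonal to the trivial flexes of a nearby generic \<open>m'\<close>. Those are all
  the flexes of \<open>m'\<close>, and kernel stability puts \<open>z\<close> closer to them than
  \<open>norm z\<close>, against orthogonality. No flex count in degenerate position is
  involved.\<close>

lemma rigid_imp_spanning:
  fixes m :: "('d::finite, 'v::finite) framework"
  assumes "is_graph E" "CARD('d) < CARD('v)"
    and rank: "CARD('v) * CARD('d) - ((CARD('d) + 1) choose 2) \<le> dim (range (edge_form E m))"
  shows "spanning m"
proof (rule ccontr)
  let ?D = "(CARD('d) + 1) choose 2"
  assume "\<not> spanning m"
  then obtain e c where e: "e \<noteq> 0" "\<And>u. e \<bullet> m $ u = c" unfolding spanning_def by blast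
  obtain \<epsilon> C where \<epsilon>: "0 < \<epsilon>" "0 \<le> C"
    "\<And>p :: ('d, 'v) framework. norm (p - m) < \<epsilon> \<Longrightarrow> dim {x. edge_form E p x = 0} \<le> dim {x. edge_form E m x = 0}"
    "\<And>p x. norm (p - m) < \<epsilon> \<Longrightarrow> dim {x. edge_form E m x = 0} \<le> dim {x. edge_form E p x = 0} \<Longrightarrow>
       \<exists>x'. edge_form E p x' = 0 \<and> norm (x - x') \<le> C * norm (edge_form E p x)"
    using bilinear_kernel_stable[OF bounded_bilinear_edge_form[of E], of m] by metis
  obtain M where M: "0 < M" "\<And>a b :: ('d, 'v) framework. norm (edge_form E a b) \<le> norm a * norm b * M"
    using bounded_bilinear.pos_bounded[OF bounded_bilinear_edge_form[of E]] by blast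
  \<comment> \<open>The second bound makes the distance from \<open>z\<close> to the flexes of
    \<open>m'\<close> smaller than \<open>norm z\<close>.\<close>
  have "0 < min \<epsilon> (1 / (C * M + 1))" using \<epsilon> M by (simp add: add_nonneg_pos)
  then obtain m' where m': "generic m'" "norm (m' - m) < min \<epsilon> (1 / (C * M + 1))"
    using generic_dense[of "min \<epsilon> (1 / (C * M + 1))" m] by blast
  have sp: "spanning m'" using generic_imp_spanning[OF m'(1) assms(2)] .
  have D: "?D \<le> dim {x. edge_form E m' x = 0}"
    using dim_trivial_flexes[OF sp] dim_subset[OF trivial_flexes_subset_kernel[OF assms(1)], of m'] by simp
  have le: "dim {x. edge_form E m' x = 0} \<le> dim {x. edge_form E m x = 0}" using \<epsilon>(3)[of m'] m'(2) by simp
  then have rank': "CARD('v) * CARD('d) - ?D \<le> dim (range (edge_form E m'))"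
    using rank_plus_flexes[of E m'] rank_plus_flexes[of E m] rank by linarith
  note ker = spanning_rigid_kernel[OF assms(1) sp rank']
  have ge: "dim {x. edge_form E m x = 0} \<le> dim {x. edge_form E m' x = 0}"
    using rank_plus_flexes[of E m] rank D by linarith
  \<comment> \<open>Affine functions of the points of \<open>m'\<close> with linear part orthogonal
    to \<open>e\<close>: the linear part loses one dimension and the constant restores it, so they
    do not fill the space of functions on the vertices.\<close>
  let ?G = "\<lambda>(f, t). (\<chi> u. f \<bullet> m' $ u + t) :: real ^ 'v"
  let ?S = "{f. e \<bullet> f = 0} \<times> (UNIV :: real set)"
  have linG: "linear ?G" by (rule linearI) (auto simp: vec_eq_iff inner_add_left algebra_simps)
  have "dim (?G ` ?S) \<le> dim ?S" by (rule dim_image_le[OF linG])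
  also have "\<dots> = CARD('d)"
  proof -
    have "dim {f. e \<bullet> f = 0} = CARD('d) - 1" using dim_hyperplane[OF e(1)] by simp
    moreover have "subspace {f. e \<bullet> f = 0}" by (rule subspace_hyperplane)
    moreover have "0 < CARD('d)" by simp
    ultimately show ?thesis by (simp add: dim_Times)
  qed
  finally have "dim (?G ` ?S) < DIM(real ^ 'v)" using assms(2) by simp
  then obtain l where l: "l \<noteq> 0" "\<And>y. y \<in> span (?G ` ?S) \<Longrightarrow> orthogonal l y"
    using orthogonal_to_subspace_exists by blast
  have lG: "(\<Sum>u\<in>UNIV. l $ u * (f \<bullet> m' $ u + t)) = 0" if "e \<bullet> f = 0" for f t
  proof -
    have "?G (f, t) \<in> ?G ` ?S" using that by (intro imageI) simp
    then have "orthogonal l (?G (f, t))" by (intro l(2) span_base)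
    then show ?thesis by (simp add: orthogonal_def inner_vec_def)
  qed
  define z :: "('d, 'v) framework" where "z = (\<chi> u. l $ u *\<^sub>R e)"
  have z0: "z \<noteq> 0"
  proof
    assume "z = 0"
    then have "l $ u *\<^sub>R e = 0" for u by (metis z_def vec_lambda_beta zero_index)
    then have "l $ u = 0" for u using e(1) by simp
    then show False using l(1) by (simp add: vec_eq_iff)
  qed
  have "edge_form E m z = 0"
  proof (rule edge_form_eqI[OF assms(1)])
    fix u w assume "{u, w} \<in> E" "u \<noteq> w"
    then have "edge_form E m z $ {u, w} = (l $ u - l $ w) * ((m $ u - m $ w) \<bullet> e)"
      by (simp add: edge_form_edge z_def scaleR_diff_left[symmetric])
    also have "(m $ u - m $ w) \<bullet> e = 0" by (subst inner_commute) (simp add: inner_diff_right e(2))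
    finally show "edge_form E m z $ {u, w} = 0 $ {u, w}" by simp
  qed simp
  then have bz: "edge_form E m' z = edge_form E (m' - m) z" by (simp add: edge_form_simps)
  obtain z' where z': "edge_form E m' z' = 0" "norm (z - z') \<le> C * norm (edge_form E m' z)"
    using \<epsilon>(4)[OF _ ge, of z] m'(2) by auto
  have "z' \<in> trivial_flexes m'" using z'(1) ker(1) by blast
  then obtain A b where A: "transpose A = - A" "\<And>u. z' $ u = A *v m' $ u + b" unfolding trivial_flexes_def by blast
  \<comment> \<open>For skew \<open>A\<close>, the vector \<open>A *v e\<close> is orthogonal to
    \<open>e\<close>, so this is one of the sums annihilated by \<open>l\<close>.\<close>
  have "z \<bullet> z' = (\<Sum>u\<in>UNIV. l $ u * (- (A *v e) \<bullet> m' $ u + e \<bullet> b))"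
    unfolding inner_vec_def[of z] by (simp add: z_def A(2) inner_add_right skew_inner[OF A(1)] matrix_vector_mult_scaleR inner_diff_right right_diff_distrib)
  also have "\<dots> = 0" by (rule lG) (simp add: skew_inner_self[OF A(1)])
  finally have "z \<bullet> z = z \<bullet> (z - z')" by (simp add: inner_diff_right)
  also have "\<dots> \<le> norm z * norm (z - z')" by (rule norm_cauchy_schwarz)
  finally have "norm z \<le> norm (z - z')" using z0 by (simp add: power2_norm_eq_inner[symmetric] power2_eq_square)
  also have "\<dots> \<le> C * (norm (m' - m) * norm z * M)"
    using z'(2) M(2)[of "m' - m" z] \<epsilon>(2) unfolding bz by (meson mult_left_mono order_trans)
  also have "\<dots> = (C * M) * norm (m' - m) * norm z" by simp
  also have "\<dots> < 1 * norm z"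
  proof (rule mult_strict_right_mono)
    have pos: "0 < C * M + 1" using \<epsilon>(2) M(1) by (simp add: add_nonneg_pos)
    have "(C * M) * norm (m' - m) \<le> (C * M + 1) * norm (m' - m)" by (simp add: mult_right_mono)
    also have "\<dots> < 1" using m'(2) pos by (simp add: pos_less_divide_eq mult.commute)
    finally show "(C * M) * norm (m' - m) < 1" .
  qed (use z0 in simp)
  finally show False by simp
qed

lemma rigid_kernel:
  fixes m :: "('d::finite, 'v::finite) framework"
  assumes "is_graph E" "CARD('d) < CARD('v)"
    and rank: "CARD('v) * CARD('d) - ((CARD('d) + 1) choose 2) \<le> dim (range (edge_form E m))"
  shows "{\<tau>. edge_form E m \<tau> = 0} = trivial_flexes m" "dim {\<tau>. edge_form E m \<tau> = 0} = (CARD('d) + 1) choose 2"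
  using spanning_rigid_kernel[OF assms(1) rigid_imp_spanning[OF assms] rank] by auto

lemma rigid_near:
  fixes \<rho> :: "('d::finite, 'v::finite) framework"
  assumes "is_graph E" "CARD('d) < CARD('v)" "infinitesimally_rigid E \<rho>"
  obtains \<epsilon> where "0 < \<epsilon>"
    "\<And>m :: ('d, 'v) framework. norm (m - \<rho>) < \<epsilon> \<Longrightarrow> CARD('v) * CARD('d) - ((CARD('d) + 1) choose 2) \<le> dim (range (edge_form E m))"
proof -
  obtain \<epsilon> where \<epsilon>: "0 < \<epsilon>"
    "\<And>p :: ('d, 'v) framework. norm (p - \<rho>) < \<epsilon> \<Longrightarrow> dim {x. edge_form E p x = 0} \<le> dim {x. edge_form E \<rho> x = 0}"
    using bilinear_kernel_stable[OF bounded_bilinear_edge_form[of E], of \<rho>] by metis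
  have r: "dim (range (edge_form E \<rho>)) = CARD('v) * CARD('d) - ((CARD('d) + 1) choose 2)"
    using assms(3) jacobian_rank_eq[OF assms(1), of \<rho>] by (simp add: infinitesimally_rigid_def)
  show ?thesis
  proof
    fix m :: "('d, 'v) framework" assume "norm (m - \<rho>) < \<epsilon>"
    then show "CARD('v) * CARD('d) - ((CARD('d) + 1) choose 2) \<le> dim (range (edge_form E m))"
      using \<epsilon>(2)[of m] rank_plus_flexes[of E m] rank_plus_flexes[of E \<rho>] r by linarith
  qed (rule \<epsilon>)
qed

section \<open>Openness of global rigidity\<close>

lemma congruent_sym:
  assumes "congruent_frameworks \<rho> \<sigma>" shows "congruent_frameworks \<sigma> \<rho>"
proof -
  obtain f t where f: "orthogonal_transformation f" "\<And>u. \<sigma> $ u = f (\<rho> $ u) + t"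
    using assms unfolding congruent_frameworks_def rigid_motion_def by blast
  have i: "orthogonal_transformation (inv f)" using f(1) by (rule orthogonal_transformation_inv)
  have "\<rho> $ u = inv f (\<sigma> $ u) + inv f (- t)" for u
  proof -
    have "inv f (\<sigma> $ u) + inv f (- t) = inv f (\<sigma> $ u + - t)"
      by (rule linear_add[OF orthogonal_transformation_linear[OF i], symmetric])
    also have "\<dots> = \<rho> $ u" using f orthogonal_transformation_inj[OF f(1)] by (simp add: inv_f_f)
    finally show ?thesis ..
  qed
  then show ?thesis using i unfolding congruent_frameworks_def rigid_motion_def by blast
qed

lemma congruent_trans:
  assumes "congruent_frameworks \<rho> \<sigma>" "congruent_frameworks \<sigma> \<tau>" shows "congruent_frameworks \<rho> \<tau>"
proof -
  obtain f t where f: "orthogonal_transformation f" "\<And>u. \<sigma> $ u = f (\<rho> $ u) + t"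
    using assms(1) unfolding congruent_frameworks_def rigid_motion_def by blast
  obtain g s where g: "orthogonal_transformation g" "\<And>u. \<tau> $ u = g (\<sigma> $ u) + s"
    using assms(2) unfolding congruent_frameworks_def rigid_motion_def by blast
  have "\<tau> $ u = (g \<circ> f) (\<rho> $ u) + (g t + s)" for u
    using g f by (simp add: orthogonal_transformation_def linear_add)
  moreover have "orthogonal_transformation (g \<circ> f)" by (rule orthogonal_transformation_compose[OF g(1) f(1)])
  ultimately show ?thesis unfolding congruent_frameworks_def rigid_motion_def by blast
qed

lemma congruent_dist:
  assumes "congruent_frameworks \<rho> \<sigma>"
  shows "norm (\<sigma> $ u - \<sigma> $ w) = norm (\<rho> $ u - \<rho> $ w)"
proof -
  obtain f t where f: "orthogonal_transformation f" "\<And>u. \<sigma> $ u = f (\<rho> $ u) + t"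
    using assms unfolding congruent_frameworks_def rigid_motion_def by blast
  have "\<sigma> $ u - \<sigma> $ w = f (\<rho> $ u - \<rho> $ w)"
    using f by (simp add: orthogonal_transformation_def linear_diff)
  then show ?thesis using f(1) by (simp add: orthogonal_transformation_norm)
qed

lemma congruent_edge_form:
  assumes "is_graph E" "congruent_frameworks \<rho> \<sigma>"
  shows "edge_form E \<sigma> \<sigma> = edge_form E \<rho> \<rho>"
proof (rule edge_form_eqI[OF assms(1)])
  fix u w assume "{u, w} \<in> E" "u \<noteq> w"
  then show "edge_form E \<sigma> \<sigma> $ {u, w} = edge_form E \<rho> \<rho> $ {u, w}"
    using congruent_dist[OF assms(2), of u w] by (simp add: edge_form_edge power2_norm_eq_inner[symmetric])
qed (simp add: edge_form_non_edge)

text \<open>The congruence is the Cayley transform of \<open>A / 2\<close>.\<close>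

lemma midpoint_flex_congruent:
  fixes \<sigma> \<tau> :: "real ^ 'a::finite ^ 'v::finite"
  assumes "\<sigma> - \<tau> \<in> trivial_flexes ((1 / 2) *\<^sub>R (\<sigma> + \<tau>))"
  shows "congruent_frameworks \<tau> \<sigma>"
proof -
  let ?m = "(1 / 2) *\<^sub>R (\<sigma> + \<tau>)"
  obtain A b where A: "transpose A = - A" "\<And>u. (\<sigma> - \<tau>) $ u = A *v ?m $ u + b"
    using assms unfolding trivial_flexes_def by blast
  define S R where "S x = x + (1 / 2) *\<^sub>R (A *v x)" and "R x = x - (1 / 2) *\<^sub>R (A *v x)" for x
  have lin: "linear S" "linear R"
    unfolding S_def R_def by (rule linearI; simp add: algebra_simps)+
  have nS: "norm (S x) = norm (R x)" for x
  proof -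
    have "S x \<bullet> S x = R x \<bullet> R x"
      by (simp add: S_def R_def inner_add_left inner_add_right inner_diff_left inner_diff_right
          skew_inner_self[OF A(1)] inner_commute[of "A *v x" x])
    then show ?thesis by (simp add: norm_eq)
  qed
  have "R x = 0 \<Longrightarrow> x = 0" for x
  proof -
    assume "R x = 0"
    then have "x \<bullet> x = x \<bullet> ((1 / 2) *\<^sub>R (A *v x))" by (simp add: R_def)
    then show "x = 0" by (simp add: skew_inner_self[OF A(1)])
  qed
  then have "inj R" using linear_injective_0[OF lin(2)] by blast
  then obtain R' where R': "linear R'" "\<And>x. R' (R x) = x" "\<And>x. R (R' x) = x"
    using linear_injective_isomorphism[OF lin(2)] by metis
  have orth: "orthogonal_transformation (S \<circ> R')"
    unfolding orthogonal_transformation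
    using linear_compose[OF R'(1) lin(1)] nS R'(3) by simp
  have "\<sigma> $ u = (S \<circ> R') (\<tau> $ u) + ((S \<circ> R') ((1 / 2) *\<^sub>R b) + (1 / 2) *\<^sub>R b)" for u
  proof -
    \<comment> \<open>In terms of the midpoint, \<open>\<sigma> $ u\<close> is \<open>S m\<close>
      plus half of \<open>b\<close>, and \<open>\<tau> $ u\<close> is \<open>R m\<close> minus half
      of \<open>b\<close>; hence \<open>S\<close> composed with the inverse of \<open>R\<close>
      carries one to the other up to a translation.\<close>
    define m where "m = ?m $ u"
    have "\<sigma> $ u = m + (1 / 2) *\<^sub>R (\<sigma> - \<tau>) $ u" "\<tau> $ u = m - (1 / 2) *\<^sub>R (\<sigma> - \<tau>) $ u"
    proof -
      have "x = (1 / 2) *\<^sub>R (x + y) + (1 / 2) *\<^sub>R (x - y)" "y = (1 / 2) *\<^sub>R (x + y) - (1 / 2) *\<^sub>R (x - y)"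
        for x y :: "real ^ 'a"
      proof -
        have "(x + y) + (x - y) = x + x" "(x + y) - (x - y) = y + y" by simp_all
        then show "x = (1 / 2) *\<^sub>R (x + y) + (1 / 2) *\<^sub>R (x - y)" "y = (1 / 2) *\<^sub>R (x + y) - (1 / 2) *\<^sub>R (x - y)"
          by (simp_all only: scaleR_add_right[symmetric] scaleR_diff_right[symmetric] scaleR_half_double)
      qed
      from this(1)[of "\<sigma> $ u" "\<tau> $ u"] this(2)[where x = "\<sigma> $ u" and y = "\<tau> $ u"]
      show "\<sigma> $ u = m + (1 / 2) *\<^sub>R (\<sigma> - \<tau>) $ u" "\<tau> $ u = m - (1 / 2) *\<^sub>R (\<sigma> - \<tau>) $ u"
        unfolding m_def by simp_all
    qed
    note half = this
    have d: "(\<sigma> - \<tau>) $ u = A *v m + b" unfolding m_def by (rule A(2))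
    have s: "\<sigma> $ u = S m + (1 / 2) *\<^sub>R b" unfolding half(1) d S_def by (simp add: scaleR_add_right)
    have t: "\<tau> $ u + (1 / 2) *\<^sub>R b = R m" unfolding half(2) d R_def by (simp add: scaleR_add_right)
    have "(S \<circ> R') (\<tau> $ u + (1 / 2) *\<^sub>R b) = S m" unfolding t by (simp add: R'(2))
    moreover have "(S \<circ> R') (\<tau> $ u + (1 / 2) *\<^sub>R b) = (S \<circ> R') (\<tau> $ u) + (S \<circ> R') ((1 / 2) *\<^sub>R b)"
      using linear_compose[OF R'(1) lin(1)] by (rule linear_add)
    ultimately show ?thesis using s by (simp add: add.assoc[symmetric])
  qed
  then show ?thesis using orth unfolding congruent_frameworks_def rigid_motion_def by blast
qed

section \<open>Connectedness, and properness of the length map modulo translations\<close>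

definition connected_graph :: "'v set set \<Rightarrow> bool" where
  "connected_graph E \<longleftrightarrow> (\<forall>u w. (u, w) \<in> {(u, w). {u, w} \<in> E}\<^sup>*)"

text \<open>Otherwise one component could be translated on its own without changing any edge
  length.\<close>

lemma globally_rigid_connected:
  fixes \<rho> :: "('d::finite, 'v::finite) framework"
  assumes "is_graph E" "globally_rigid E \<rho>"
  shows "connected_graph E"
  unfolding connected_graph_def
proof (intro allI, rule ccontr)
  let ?r = "{(u, w). {u, w} \<in> E}"
  fix u w assume uw: "(u, w) \<notin> ?r\<^sup>*"
  define a where "a = \<rho> $ u - \<rho> $ w"
  \<comment> \<open>Chosen to change the distance between \<open>u\<close> and \<open>w\<close>: it
    doubles, or becomes 1 if the points coincide.\<close>
  define t where "t = (if a = 0 then axis undefined 1 else a)"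
  have t: "norm (a + t) \<noteq> norm a"
    by (auto simp: t_def scaleR_2[symmetric] axis_eq_0_iff)
  define \<sigma> where "\<sigma> = (\<chi> x. if (u, x) \<in> ?r\<^sup>* then \<rho> $ x + t else \<rho> $ x)"
  have "edge_form E \<sigma> \<sigma> = edge_form E \<rho> \<rho>"
  proof (rule edge_form_eqI[OF assms(1)])
    fix x y assume xy: "{x, y} \<in> E" "x \<noteq> y"
    then have "(x, y) \<in> ?r" "(y, x) \<in> ?r" by (auto simp: insert_commute)
    then have "(u, x) \<in> ?r\<^sup>* \<longleftrightarrow> (u, y) \<in> ?r\<^sup>*" by (meson rtrancl.rtrancl_into_rtrancl)
    then show "edge_form E \<sigma> \<sigma> $ {x, y} = edge_form E \<rho> \<rho> $ {x, y}" using xy by (simp add: edge_form_edge \<sigma>_def)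
  qed (simp add: edge_form_non_edge)
  then have "congruent_frameworks \<rho> \<sigma>"
    using assms unfolding globally_rigid_def by (simp add: len_sq_eq_edge_form)
  then have "norm (\<sigma> $ u - \<sigma> $ w) = norm a" unfolding a_def by (rule congruent_dist)
  moreover have "\<sigma> $ u - \<sigma> $ w = a + t" using uw by (simp add: \<sigma>_def a_def)
  ultimately show False using t by simp
qed

text \<open>Each edge length is at most the square root of the norm of the vector of squared
  lengths, and the triangle inequality adds these up along a path.\<close>

lemma connected_diameter_bound:
  fixes E :: "'v::finite set set"
  assumes "is_graph E" "connected_graph E"
  obtains C where "0 \<le> C"
    "\<And>(\<sigma> :: ('d::finite, 'v) framework) u w. norm (\<sigma> $ u - \<sigma> $ w) \<le> C * sqrt (norm (edge_form E \<sigma> \<sigma>))"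
proof -
  let ?r = "{(u, w). {u, w} \<in> E}"
  have "\<exists>n :: nat. \<forall>\<sigma> :: ('d, 'v) framework. norm (\<sigma> $ u - \<sigma> $ w) \<le> n * sqrt (norm (edge_form E \<sigma> \<sigma>))"
    if "(u, w) \<in> ?r\<^sup>*" for u w
    using that
  proof (induction rule: rtrancl_induct)
    case base
    then show ?case by (intro exI[of _ 0]) simp
  next
    case (step x y)
    then obtain n :: nat where n: "\<And>\<sigma> :: ('d, 'v) framework. norm (\<sigma> $ u - \<sigma> $ x) \<le> n * sqrt (norm (edge_form E \<sigma> \<sigma>))" by blast
    have xy: "{x, y} \<in> E" "x \<noteq> y" using step(2) assms(1) by (auto simp: is_graph_def)
    have "norm (\<sigma> $ u - \<sigma> $ y) \<le> Suc n * sqrt (norm (edge_form E \<sigma> \<sigma>))" for \<sigma> :: "('d, 'v) framework"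
    proof -
      have "(norm (\<sigma> $ x - \<sigma> $ y))\<^sup>2 \<le> norm (edge_form E \<sigma> \<sigma>)"
        using component_le_norm_cart[of "edge_form E \<sigma> \<sigma>" "{x, y}"] xy by (simp add: edge_form_edge power2_norm_eq_inner)
      then have "norm (\<sigma> $ x - \<sigma> $ y) \<le> sqrt (norm (edge_form E \<sigma> \<sigma>))" by (rule real_le_rsqrt)
      moreover have "norm (\<sigma> $ u - \<sigma> $ y) \<le> norm (\<sigma> $ u - \<sigma> $ x) + norm (\<sigma> $ x - \<sigma> $ y)"
        using norm_triangle_ineq[of "\<sigma> $ u - \<sigma> $ x" "\<sigma> $ x - \<sigma> $ y"] by simp
      ultimately show ?thesis using n[of \<sigma>] by (simp add: algebra_simps)
    qed
    then show ?case by blast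
  qed
  then have "\<forall>u w. \<exists>n :: nat. \<forall>\<sigma> :: ('d, 'v) framework. norm (\<sigma> $ u - \<sigma> $ w) \<le> n * sqrt (norm (edge_form E \<sigma> \<sigma>))"
    using assms(2) unfolding connected_graph_def by blast
  then obtain n :: "'v \<Rightarrow> 'v \<Rightarrow> nat" where
    n: "\<And>u w (\<sigma> :: ('d, 'v) framework). norm (\<sigma> $ u - \<sigma> $ w) \<le> n u w * sqrt (norm (edge_form E \<sigma> \<sigma>))" by metis
  show ?thesis
  proof
    show "0 \<le> (\<Sum>u\<in>UNIV. \<Sum>w\<in>UNIV. real (n u w))" by (intro sum_nonneg) auto
    fix \<sigma> :: "('d, 'v) framework" and u w
    have "real (n u w) \<le> (\<Sum>w\<in>UNIV. real (n u w))" by (rule member_le_sum) auto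
    also have "\<dots> \<le> (\<Sum>u\<in>UNIV. \<Sum>w\<in>UNIV. real (n u w))"
      by (rule member_le_sum[of u UNIV "\<lambda>u. \<Sum>w\<in>UNIV. real (n u w)"]) (auto intro: sum_nonneg)
    finally show "norm (\<sigma> $ u - \<sigma> $ w) \<le> (\<Sum>u\<in>UNIV. \<Sum>w\<in>UNIV. real (n u w)) * sqrt (norm (edge_form E \<sigma> \<sigma>))"
      by (intro order_trans[OF n]) (simp add: mult_right_mono)
  qed
qed

text \<open>Counterexamples tending to \<open>\<rho>\<close> come with noncongruent partners of
  equal lengths. Up to translation the partners converge along a subsequence, to a framework
  congruent to \<open>\<rho>\<close>. Undoing that congruence brings each partner close to its
  counterexample, so their midpoint is rigid and their difference, a flex of it, is trivial; this
  makes them congruent.\<close>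

lemma globally_rigid_near:
  fixes \<rho> :: "('d::finite, 'v::finite) framework"
  assumes E: "is_graph E" and v: "CARD('d) < CARD('v)"
    and ir: "infinitesimally_rigid E \<rho>" and gr: "globally_rigid E \<rho>"
  obtains \<epsilon> where "0 < \<epsilon>" "\<And>\<rho>' :: ('d, 'v) framework. norm (\<rho>' - \<rho>) < \<epsilon> \<Longrightarrow> globally_rigid E \<rho>'"
proof (rule ccontr)
  note wit = that
  assume na: "\<not> thesis"
  have "\<exists>\<rho>' :: ('d, 'v) framework. norm (\<rho>' - \<rho>) < \<epsilon> \<and> \<not> globally_rigid E \<rho>'" if "0 < \<epsilon>" for \<epsilon>
    using na wit[OF that] by blast
  then have "\<forall>n. \<exists>\<rho>' :: ('d, 'v) framework. norm (\<rho>' - \<rho>) < inverse (real (Suc n)) \<and> \<not> globally_rigid E \<rho>'"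
    by simp
  then obtain P :: "nat \<Rightarrow> ('d, 'v) framework" where
    P: "\<And>n. norm (P n - \<rho>) < inverse (real (Suc n))" "\<And>n. \<not> globally_rigid E (P n)" by metis
  have Plim: "P \<longlonglongrightarrow> \<rho>"
    by (rule LIM_zero_cancel, rule Lim_null_comparison[OF _ LIMSEQ_inverse_real_of_nat])
      (use P(1) in \<open>auto intro!: always_eventually less_imp_le\<close>)
  have "\<forall>n. \<exists>\<sigma>. edge_form E \<sigma> \<sigma> = edge_form E (P n) (P n) \<and> \<not> congruent_frameworks (P n) \<sigma>"
    using P(2) unfolding globally_rigid_def len_sq_eq_edge_form[OF E] by blast
  then obtain S0 where S0: "\<And>n. edge_form E (S0 n) (S0 n) = edge_form E (P n) (P n)" "\<And>n. \<not> congruent_frameworks (P n) (S0 n)" by metis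
  define u0 :: 'v where "u0 = undefined"
  \<comment> \<open>Pinning \<open>u0\<close> to its position in \<open>P n\<close> removes
    translations, so the diameter bound makes the sequence bounded.\<close>
  define S where "S n = (\<chi> u. S0 n $ u + (P n $ u0 - S0 n $ u0))" for n
  have S0S: "congruent_frameworks (S0 n) (S n)" for n
  proof -
    have "rigid_motion (\<lambda>x. id x + (P n $ u0 - S0 n $ u0))"
      unfolding rigid_motion_def using orthogonal_transformation_id unfolding id_def by blast
    then show ?thesis unfolding congruent_frameworks_def
      by (intro exI[of _ "\<lambda>x. id x + (P n $ u0 - S0 n $ u0)"] conjI) (simp_all add: S_def)
  qed
  have S: "edge_form E (S n) (S n) = edge_form E (P n) (P n)" "\<not> congruent_frameworks (P n) (S n)" "S n $ u0 = P n $ u0" for n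
    using congruent_edge_form[OF E S0S, of n] S0[of n] congruent_trans[OF _ congruent_sym[OF S0S]] by (auto simp: S_def)
  obtain C where C: "0 \<le> C"
    "\<And>(\<sigma> :: ('d, 'v) framework) u w. norm (\<sigma> $ u - \<sigma> $ w) \<le> C * sqrt (norm (edge_form E \<sigma> \<sigma>))"
    using connected_diameter_bound[OF E globally_rigid_connected[OF E gr], where 'd = 'd] by blast
  obtain B where B: "\<And>n. norm (P n) \<le> B"
    using convergent_imp_Bseq[OF convergentI[OF Plim]] unfolding Bseq_def by blast
  have bilP: "(\<lambda>n. edge_form E (P n) (P n)) \<longlonglongrightarrow> edge_form E \<rho> \<rho>"
    by (rule bounded_bilinear.tendsto[OF bounded_bilinear_edge_form Plim Plim])
  obtain B' where B': "\<And>n. norm (edge_form E (P n) (P n)) \<le> B'"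
    using convergent_imp_Bseq[OF convergentI[OF bilP]] unfolding Bseq_def by blast
  have "norm (S n $ u) \<le> C * sqrt B' + B" for n u
  proof -
    have "norm (S n $ u - S n $ u0) \<le> C * sqrt B'"
      using C(2)[where \<sigma> = "S n" and u = u and w = u0] B'[of n] C(1) unfolding S(1)
      by (meson mult_left_mono order_trans real_sqrt_le_mono)
    moreover have "norm (S n $ u0) \<le> B"
      unfolding S(3) using Finite_Cartesian_Product.norm_nth_le[of "P n" u0] B[of n] by linarith
    ultimately show ?thesis using norm_triangle_ineq[of "S n $ u - S n $ u0" "S n $ u0"] by simp
  qed
  moreover have "norm (S n) \<le> (\<Sum>u\<in>UNIV. norm (S n $ u))" for n
    by (subst norm_vec_def) (rule L2_set_le_sum, simp)
  ultimately have "norm (S n) \<le> (\<Sum>u :: 'v\<in>UNIV. C * sqrt B' + B)" for n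
    by (meson order_trans sum_mono)
  then have "bounded (range S)" unfolding bounded_iff by blast
  then obtain l r where r: "strict_mono r" "(S \<circ> r) \<longlonglongrightarrow> l"
    using bounded_imp_convergent_subsequence by blast
  have Pr: "(P \<circ> r) \<longlonglongrightarrow> \<rho>" by (rule LIMSEQ_subseq_LIMSEQ[OF Plim r(1)])
  have "(\<lambda>n. edge_form E ((S \<circ> r) n) ((S \<circ> r) n)) \<longlonglongrightarrow> edge_form E l l"
    by (rule bounded_bilinear.tendsto[OF bounded_bilinear_edge_form r(2) r(2)])
  moreover have "(\<lambda>n. edge_form E ((P \<circ> r) n) ((P \<circ> r) n)) \<longlonglongrightarrow> edge_form E \<rho> \<rho>"
    by (rule bounded_bilinear.tendsto[OF bounded_bilinear_edge_form Pr Pr])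
  ultimately have "edge_form E l l = edge_form E \<rho> \<rho>" using LIMSEQ_unique by (simp add: S(1))
  then have "congruent_frameworks \<rho> l" using gr unfolding globally_rigid_def len_sq_eq_edge_form[OF E] by blast
  then have "congruent_frameworks l \<rho>" by (rule congruent_sym)
  then obtain f t where f: "orthogonal_transformation f" "\<And>u. \<rho> $ u = f (l $ u) + t"
    unfolding congruent_frameworks_def rigid_motion_def by blast
  \<comment> \<open>The congruence that takes the limit \<open>l\<close> to \<open>\<rho>\<close> is
    applied along the sequence, which now tends to \<open>\<rho>\<close> itself.\<close>
  define T where "T n = (\<chi> u. f (S (r n) $ u) + t)" for n
  have ST: "congruent_frameworks (S (r n)) (T n)" for n
    unfolding congruent_frameworks_def rigid_motion_def T_def using f(1) by auto
  have Tlim: "T \<longlonglongrightarrow> \<rho>"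
  proof (rule vec_tendstoI)
    fix u
    have "(\<lambda>n. f ((S \<circ> r) n $ u) + t) \<longlonglongrightarrow> f (l $ u) + t"
      by (rule tendsto_add[OF bounded_linear.tendsto[OF _ tendsto_vec_nth[OF r(2)]] tendsto_const])
        (use orthogonal_transformation_linear[OF f(1)] in \<open>simp add: linear_conv_bounded_linear\<close>)
    then show "(\<lambda>n. T n $ u) \<longlonglongrightarrow> \<rho> $ u" by (simp add: T_def f(2))
  qed
  obtain \<epsilon> where \<epsilon>: "0 < \<epsilon>"
    "\<And>m :: ('d, 'v) framework. norm (m - \<rho>) < \<epsilon> \<Longrightarrow> CARD('v) * CARD('d) - ((CARD('d) + 1) choose 2) \<le> dim (range (edge_form E m))"
    using rigid_near[OF E v ir] by metis
  have "(\<lambda>n. (1 / 2) *\<^sub>R (T n + (P \<circ> r) n)) \<longlonglongrightarrow> (1 / 2) *\<^sub>R (\<rho> + \<rho>)"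
    by (intro tendsto_intros Tlim Pr)
  then have "(\<lambda>n. (1 / 2) *\<^sub>R (T n + P (r n))) \<longlonglongrightarrow> \<rho>" by (simp add: scaleR_half_double)
  then have "\<forall>\<^sub>F n in sequentially. norm ((1 / 2) *\<^sub>R (T n + P (r n)) - \<rho>) < \<epsilon>"
    using \<epsilon>(1) by (simp add: tendsto_iff dist_norm)
  then obtain n where n: "norm ((1 / 2) *\<^sub>R (T n + P (r n)) - \<rho>) < \<epsilon>"
    using eventually_happens'[OF sequentially_bot] by blast
  have "edge_form E (T n) (T n) = edge_form E (P (r n)) (P (r n))" using congruent_edge_form[OF E ST, of n] S(1) by simp
  then have "edge_form E ((1 / 2) *\<^sub>R (T n + P (r n))) (T n - P (r n)) = 0"
    by (simp add: edge_form_simps edge_form_commute[of E "P (r n)" "T n"])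
  then have "T n - P (r n) \<in> trivial_flexes ((1 / 2) *\<^sub>R (T n + P (r n)))"
    using rigid_kernel(1)[OF E v \<epsilon>(2)[OF n]] by blast
  then have "congruent_frameworks (P (r n)) (T n)" by (rule midpoint_flex_congruent)
  then have "congruent_frameworks (P (r n)) (S (r n))" using congruent_trans congruent_sym[OF ST] by blast
  then show False using S(2) by blast
qed

section \<open>Flatness along the kernel of a stress of maximal rank\<close>

text \<open>By symmetry the component \<open>q\<close> of \<open>x\<close> orthogonal to the range
  lies in the kernel, hence is orthogonal to \<open>x\<close> and therefore 0.\<close>

lemma symmetric_range:
  fixes L :: "'a::euclidean_space \<Rightarrow> 'a"
  assumes lin: "linear L" and sym: "\<And>x y. L x \<bullet> y = x \<bullet> L y"
    and orth: "\<And>k. L k = 0 \<Longrightarrow> x \<bullet> k = 0"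
  shows "x \<in> range L"
proof -
  have sub: "subspace (range L)" using lin by (simp add: linear_subspace_image)
  obtain a q where aq: "a \<in> span (range L)" "\<And>w. w \<in> span (range L) \<Longrightarrow> orthogonal q w" "x = a + q"
    using orthogonal_subspace_decomp_exists[of "range L" x] by metis
  have a: "a \<in> range L" using aq(1) sub by (simp add: span_eq_iff[THEN iffD2])
  have "L q \<bullet> y = 0" for y
    using aq(2)[of "L y"] sym[of q y] by (simp add: orthogonal_def span_base)
  then have "L q = 0" using inner_eq_zero_iff by blast
  then have "x \<bullet> q = 0" by (rule orth)
  moreover have "q \<bullet> a = 0" using aq(1,2) by (simp add: orthogonal_def)
  ultimately have "q \<bullet> q = 0" using aq(3) by (simp add: inner_add_left inner_add_right inner_commute)
  then show ?thesis using a aq(3) by simp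
qed

lemma not_in_subspace_separate:
  fixes y :: "'a::euclidean_space"
  assumes "subspace S" "y \<notin> S"
  shows "\<exists>q. (\<forall>s\<in>S. q \<bullet> s = 0) \<and> q \<bullet> y \<noteq> 0"
proof -
  obtain a q where aq: "a \<in> span S" "\<And>w. w \<in> span S \<Longrightarrow> orthogonal q w" "y = a + q"
    using orthogonal_subspace_decomp_exists[of S y] by metis
  have "a \<in> S" using aq(1) assms(1) by (simp add: span_eq_iff[THEN iffD2])
  then have "q \<noteq> 0" using aq(3) assms(2) by auto
  moreover have "q \<bullet> a = 0" using aq(1,2) by (simp add: orthogonal_def)
  ultimately have "q \<bullet> y \<noteq> 0" using aq(3) by (simp add: inner_add_right)
  moreover have "q \<bullet> s = 0" if "s \<in> S" for s using aq(2)[of s] that by (simp add: span_base orthogonal_def)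
  ultimately show ?thesis by blast
qed

lemma linear_le_quadratic_imp_le_0:
  fixes a Q \<delta> :: real
  assumes "0 < \<delta>" "\<And>t. 0 < t \<Longrightarrow> t < \<delta> \<Longrightarrow> t * a \<le> t * t * Q"
  shows "a \<le> 0"
proof (rule tendsto_lowerbound)
  show "((\<lambda>t. t * Q) \<longlongrightarrow> 0) (at_right 0)" by (rule tendsto_eq_intros refl | simp)+
  have "a \<le> t * Q" if "0 < t" "t < \<delta>" for t
    using assms(2)[OF that] that(1) by (simp add: mult.assoc)
  then show "\<forall>\<^sub>F t in at_right 0. a \<le> t * Q"
    using assms(1) unfolding eventually_at_right_field by blast
qed simp

lemma stress_map_kernel: "{\<omega>. stress_map E \<rho> \<omega> = 0} = {\<omega>. \<forall>y\<in>range (edge_form E \<rho>). \<omega> \<bullet> y = 0}"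
proof -
  have "stress_map E \<rho> \<omega> = 0 \<longleftrightarrow> (\<forall>\<tau>. stress_map E \<rho> \<omega> \<bullet> \<tau> = 0)" for \<omega>
    by (metis inner_eq_zero_iff inner_zero_left)
  then show ?thesis by (auto simp: stress_map_inner)
qed

text \<open>Stresses form the orthogonal complement of the range of
  \<open>edge_form E \<rho>\<close>. Constant rank thus gives stress spaces of constant dimension,
  which is what correcting an approximate stress requires.\<close>

lemma dim_stresses:
  fixes \<rho> :: "('d::finite, 'v::finite) framework"
  shows "dim {\<omega>. stress_map E \<rho> \<omega> = 0} + dim (range (edge_form E \<rho>)) = DIM(real ^ 'v set)"
  unfolding stress_map_kernel
  by (rule dim_orthogonal_complement) (rule linear_subspace_image[OF linear_edge_form subspace_UNIV])

text \<open>Deforming a stress to first order together with the framework: constancy of the rank of the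
  stress matrix kills the second fundamental form on its kernel.\<close>

lemma max_rank_second_order:
  fixes \<rho> \<rho>' :: "('d::finite, 'v::finite) framework"
  assumes \<epsilon>: "0 < \<epsilon>"
    and rank: "\<And>m :: ('d, 'v) framework. norm (m - \<rho>) < \<epsilon> \<Longrightarrow> dim (range (edge_form E m)) = dim (range (edge_form E \<rho>))"
    and st: "stress_map E \<rho> \<omega> = 0"
    and max: "\<And>m \<omega>'. norm (m - \<rho>) < \<epsilon> \<Longrightarrow> stress_map E m \<omega>' = 0 \<Longrightarrow>
      dim {f. laplacian E \<omega> *v f = 0} \<le> dim {f. laplacian E \<omega>' *v f = 0}"
    and first: "stress_map E \<rho> \<psi> + stress_map E \<rho>' \<omega> = 0"
    and ker: "laplacian E \<omega> *v k = 0" "laplacian E \<omega> *v k' = 0"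
  shows "(laplacian E \<psi> *v k) \<bullet> k' \<le> 0"
proof -
  note SM = bounded_bilinear_stress_map[of E, where ?'a = 'd] and LP = bounded_bilinear_laplacian[of E]
  obtain e1 C1 where e1: "0 < e1" "0 \<le> C1"
    "\<And>p \<theta>. norm (p - \<rho>) < e1 \<Longrightarrow> dim {x. stress_map E \<rho> x = 0} \<le> dim {x. stress_map E p x = 0} \<Longrightarrow>
       \<exists>x'. stress_map E p x' = 0 \<and> norm (\<theta> - x') \<le> C1 * norm (stress_map E p \<theta>)"
    using bilinear_kernel_stable[OF SM, of \<rho>] by metis
  obtain e2 C2 where e2: "0 < e2" "0 \<le> C2"
    "\<And>p x. norm (p - \<omega>) < e2 \<Longrightarrow> dim {x. laplacian E \<omega> *v x = 0} \<le> dim {x. laplacian E p *v x = 0} \<Longrightarrow>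
       \<exists>x'. laplacian E p *v x' = 0 \<and> norm (x - x') \<le> C2 * norm (laplacian E p *v x)"
    using bilinear_kernel_stable[OF LP, of \<omega>] by metis
  obtain M where M: "0 < M" "\<And>a b. norm (laplacian E a *v b) \<le> norm a * norm b * M"
    using bounded_bilinear.pos_bounded[OF LP] by blast
  define n1 where "n1 = norm (stress_map E \<rho>' \<psi>)"
  define B where "B = norm \<psi> + C1 * n1"
  have B0: "0 \<le> B" "0 \<le> n1" using e1(2) by (auto simp: B_def n1_def)
  \<comment> \<open>The bounds keep \<open>?m\<close> in both balls around \<open>\<rho>\<close> and
    the corrected stress within \<open>e2\<close> of \<open>\<omega>\<close>;
    \<open>t \<le> 1\<close> absorbs a factor \<open>t\<close>.\<close>
  define \<delta> where "\<delta> = min 1 (min (min \<epsilon> e1 / (norm \<rho>' + 1)) (e2 / (B + 1)))"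
  have \<delta>: "0 < \<delta>" using \<epsilon> e1(1) e2(1) B0 by (simp add: \<delta>_def add_nonneg_pos)
  define Q where "Q = (norm k' * M * B) * (C2 * (norm k * M * B)) + norm k * norm k' * M * (C1 * n1)"
  show ?thesis
  proof (rule linear_le_quadratic_imp_le_0[OF \<delta>])
    fix t :: real assume t: "0 < t" "t < \<delta>"
    let ?m = "\<rho> + t *\<^sub>R \<rho>'" and ?\<theta> = "\<omega> + t *\<^sub>R \<psi>"
    have "t * norm \<rho>' \<le> t * (norm \<rho>' + 1)" using t(1) by simp
    also have "\<dots> < min \<epsilon> e1"
      using t(2) add_nonneg_pos[OF norm_ge_zero zero_less_one, of \<rho>'] by (simp add: \<delta>_def pos_less_divide_eq)
    finally have m: "norm (?m - \<rho>) < \<epsilon>" "norm (?m - \<rho>) < e1" using t(1) by auto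
    have "dim {x. stress_map E \<rho> x = 0} \<le> dim {x. stress_map E ?m x = 0}"
      using dim_stresses[of E \<rho>] dim_stresses[of E ?m] rank[OF m(1)] by linarith
    \<comment> \<open>By \<open>st\<close> and \<open>first\<close>, \<open>?\<theta>\<close> fails
      to be a stress of \<open>?m\<close> only by a term in \<open>t * t\<close>, so the correction
      is of that order too.\<close>
    then obtain \<omega>' where \<omega>': "stress_map E ?m \<omega>' = 0" "norm (?\<theta> - \<omega>') \<le> C1 * norm (stress_map E ?m ?\<theta>)"
      using e1(3)[OF m(2)] by blast
    have "stress_map E ?m ?\<theta> = stress_map E \<rho> \<omega> + t *\<^sub>R (stress_map E \<rho> \<psi> + stress_map E \<rho>' \<omega>) + (t * t) *\<^sub>R stress_map E \<rho>' \<psi>"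
      using bounded_bilinear.add_left[OF SM] bounded_bilinear.add_right[OF SM]
        bounded_bilinear.scaleR_left[OF SM] bounded_bilinear.scaleR_right[OF SM]
      by (simp add: algebra_simps)
    then have "norm (stress_map E ?m ?\<theta>) = t * t * n1" using t(1) by (simp add: st first n1_def)
    then have \<omega>'2: "norm (?\<theta> - \<omega>') \<le> t * t * (C1 * n1)" using \<omega>'(2) by (simp add: mult_ac)
    have "t * t * (C1 * n1) \<le> t * (C1 * n1)"
      using t \<delta>_def e1(2) B0 by (intro mult_right_mono) (auto simp: mult_left_le)
    then have d1: "norm (\<omega>' - \<omega>) \<le> t * B"
    proof -
      have "norm (\<omega>' - \<omega>) \<le> t * norm \<psi> + norm (?\<theta> - \<omega>')"
        using norm_triangle_ineq4[of "t *\<^sub>R \<psi>" "?\<theta> - \<omega>'"] t(1) by simp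
      then show ?thesis using \<omega>'2 \<open>t * t * (C1 * n1) \<le> t * (C1 * n1)\<close> unfolding B_def distrib_left by linarith
    qed
    also have "\<dots> \<le> t * (B + 1)" using t(1) by simp
    also have "\<dots> < e2" using t(2) B0 by (simp add: \<delta>_def pos_less_divide_eq)
    finally have near: "norm (\<omega>' - \<omega>) < e2" .
    have bd: "norm (laplacian E \<omega>' *v x) \<le> t * (norm x * M * B)" if "laplacian E \<omega> *v x = 0" for x
    proof -
      have "laplacian E \<omega>' *v x = laplacian E (\<omega>' - \<omega>) *v x"
        using bounded_bilinear.diff_left[OF LP] that by simp
      then have "norm (laplacian E \<omega>' *v x) \<le> norm (\<omega>' - \<omega>) * norm x * M" using M(2) by simp
      also have "\<dots> \<le> (t * B) * norm x * M" using d1 M(1) by (simp add: mult_right_mono)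
      finally show ?thesis by (simp add: mult_ac)
    qed
    \<comment> \<open>By \<open>max\<close> the kernel at \<open>\<omega>'\<close> is no smaller
      than at \<open>\<omega>\<close>, so \<open>k\<close> moves into it over a distance of order
      \<open>t\<close>. By symmetry the value at \<open>k\<close>, \<open>k'\<close> is then bounded
      by a product of two quantities of order \<open>t\<close>.\<close>
    obtain x where x: "laplacian E \<omega>' *v x = 0" "norm (k - x) \<le> C2 * norm (laplacian E \<omega>' *v k)"
      using e2(3)[OF near max[OF m(1) \<omega>'(1)], of k] by blast
    have kx: "norm (k - x) \<le> C2 * (t * (norm k * M * B))"
      using x(2) mult_left_mono[OF bd[OF ker(1)] e2(2)] by linarith
    have "(laplacian E \<omega>' *v k) \<bullet> k' = (laplacian E \<omega>' *v (k - x)) \<bullet> k'"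
      using x(1) by (simp add: matrix_vector_mult_diff_distrib)
    also have "\<dots> = (k - x) \<bullet> (laplacian E \<omega>' *v k')" by (rule laplacian_symmetric)
    also have "\<dots> \<le> norm (k - x) * norm (laplacian E \<omega>' *v k')" by (rule norm_cauchy_schwarz)
    also have "\<dots> \<le> (C2 * (t * (norm k * M * B))) * (t * (norm k' * M * B))"
      using kx bd[OF ker(2)] e2(2) t(1) M(1) B0 by (intro mult_mono) auto
    finally have 1: "(laplacian E \<omega>' *v k) \<bullet> k' \<le> t * t * ((norm k' * M * B) * (C2 * (norm k * M * B)))"
      by (simp add: mult_ac)
    have "(laplacian E (?\<theta> - \<omega>') *v k) \<bullet> k' \<le> norm (laplacian E (?\<theta> - \<omega>') *v k) * norm k'" by (rule norm_cauchy_schwarz)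
    also have "\<dots> \<le> (norm (?\<theta> - \<omega>') * norm k * M) * norm k'" by (intro mult_right_mono M) auto
    also have "\<dots> \<le> ((t * t * (C1 * n1)) * norm k * M) * norm k'"
      using \<omega>'2 M(1) by (intro mult_right_mono) auto
    finally have 2: "(laplacian E (?\<theta> - \<omega>') *v k) \<bullet> k' \<le> t * t * (norm k * norm k' * M * (C1 * n1))"
      by (simp add: mult_ac)
    have "t *\<^sub>R (laplacian E \<psi> *v k) = laplacian E \<omega>' *v k + laplacian E (?\<theta> - \<omega>') *v k"
      using bounded_bilinear.add_left[OF LP] bounded_bilinear.diff_left[OF LP] bounded_bilinear.scaleR_left[OF LP]
      by (simp add: ker)
    then have "t * ((laplacian E \<psi> *v k) \<bullet> k') = (laplacian E \<omega>' *v k) \<bullet> k' + (laplacian E (?\<theta> - \<omega>') *v k) \<bullet> k'"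
      by (metis inner_add_left inner_scaleR_left)
    then show "t * ((laplacian E \<psi> *v k) \<bullet> k') \<le> t * t * Q"
      using 1 2 by (simp add: Q_def distrib_left)
  qed
qed

text \<open>Otherwise some \<open>\<psi>\<close> is orthogonal to all
  \<open>edge_form E \<rho> \<tau>\<close> with columns of \<open>\<tau>\<close> in the kernel, but
  not to \<open>edge_form E k k'\<close>. The orthogonality puts
  \<open>laplacian E \<psi> *v column i \<rho>\<close> into the range of
  \<open>laplacian E \<omega>\<close>, so a velocity \<open>\<rho>'\<close> exists for which
  \<open>\<psi>\<close> is a first-order change of the stress. The second-order estimate then
  annihilates \<open>\<psi> \<bullet> edge_form E k k'\<close>.\<close>

lemma stress_kernel_flat:
  fixes \<rho> :: "('d::finite, 'v::finite) framework"
  assumes \<epsilon>: "0 < \<epsilon>"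
    and rank: "\<And>m :: ('d, 'v) framework. norm (m - \<rho>) < \<epsilon> \<Longrightarrow> dim (range (edge_form E m)) = dim (range (edge_form E \<rho>))"
    and st: "stress_map E \<rho> \<omega> = 0"
    and max: "\<And>m \<omega>'. norm (m - \<rho>) < \<epsilon> \<Longrightarrow> stress_map E m \<omega>' = 0 \<Longrightarrow>
      dim {f. laplacian E \<omega> *v f = 0} \<le> dim {f. laplacian E \<omega>' *v f = 0}"
    and ker: "laplacian E \<omega> *v k = 0" "laplacian E \<omega> *v k' = 0"
  shows "\<exists>\<tau> :: ('d, 'v) framework. (\<forall>i. laplacian E \<omega> *v column i \<tau> = 0) \<and> edge_form E k k' = edge_form E \<rho> \<tau>"
proof (rule ccontr)
  let ?K = "{\<tau> :: ('d, 'v) framework. stress_map E \<tau> \<omega> = 0}"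
  note SM = bounded_bilinear_stress_map[of E, where ?'a = 'd]
  assume "\<not> ?thesis"
  then have nin: "edge_form E k k' \<notin> edge_form E \<rho> ` ?K" by (auto simp: stress_map_eq_0)
  have "subspace ?K"
    using linear_subspace_kernel[OF bounded_linear.linear[OF bounded_bilinear.bounded_linear_left[OF SM]]] .
  then have sub: "subspace (edge_form E \<rho> ` ?K)" by (rule linear_subspace_image[OF linear_edge_form])
  obtain \<psi> where \<psi>0: "\<forall>s\<in>edge_form E \<rho> ` ?K. \<psi> \<bullet> s = 0" "\<psi> \<bullet> edge_form E k k' \<noteq> 0"
    using not_in_subspace_separate[OF sub nin] by (elim exE conjE)
  have \<psi>: "\<psi> \<bullet> edge_form E \<rho> \<tau> = 0" if "\<tau> \<in> ?K" for \<tau> using \<psi>0(1) that by blast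
  have "laplacian E \<psi> *v column i \<rho> \<in> range (\<lambda>f. laplacian E \<omega> *v f)" for i
  proof (rule symmetric_range[OF _ laplacian_symmetric])
    fix g assume g: "laplacian E \<omega> *v g = 0"
    define \<tau> :: "('d, 'v) framework" where "\<tau> = (\<chi> u j. if j = i then g $ u else 0)"
    have col: "column j \<tau> = (if j = i then g else 0)" for j
      by (simp add: column_def \<tau>_def vec_eq_iff)
    then have "\<tau> \<in> ?K" using g by (simp add: stress_map_eq_0)
    then have "\<psi> \<bullet> edge_form E \<rho> \<tau> = 0" by (rule \<psi>)
    moreover have "edge_form E \<rho> \<tau> = edge_form E (column i \<rho>) g"
      by (simp add: edge_form_columns[of E \<rho>] col if_distrib edge_form_simps cong: if_cong)
    ultimately show "(laplacian E \<psi> *v column i \<rho>) \<bullet> g = 0" by (simp add: laplacian_inner)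
  qed simp
  then have "\<forall>i. \<exists>f. laplacian E \<psi> *v column i \<rho> = laplacian E \<omega> *v f" by blast
  then obtain r where r: "\<And>i. laplacian E \<psi> *v column i \<rho> = laplacian E \<omega> *v r i" by metis
  define \<rho>' :: "('d, 'v) framework" where "\<rho>' = (\<chi> u i. - (r i $ u))"
  have col: "column i \<rho>' = - r i" for i by (simp add: column_def \<rho>'_def vec_eq_iff)
  have c: "column i (stress_map E \<rho> \<psi> + stress_map E \<rho>' \<omega>) = 0" for i
  proof -
    have "column i (stress_map E \<rho> \<psi> + stress_map E \<rho>' \<omega>) = column i (stress_map E \<rho> \<psi>) + column i (stress_map E \<rho>' \<omega>)"
      by (simp add: column_def vec_eq_iff)
    also have "\<dots> = 0" using r[of i] linear_neg[OF matrix_vector_mul_linear, of "laplacian E \<omega>" "r i"]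
      by (simp add: column_stress_map col)
    finally show ?thesis .
  qed
  have first: "stress_map E \<rho> \<psi> + stress_map E \<rho>' \<omega> = 0"
    using c by (simp add: column_def vec_eq_iff)
  \<comment> \<open>The estimate is one-sided, so it is applied to \<open>k'\<close> and to
    \<open>- k'\<close>.\<close>
  have "(laplacian E \<psi> *v k) \<bullet> k' \<le> 0"
    by (rule max_rank_second_order[OF \<epsilon> rank st max first ker])
  moreover have "(laplacian E \<psi> *v k) \<bullet> (- k') \<le> 0"
    using ker linear_neg[OF matrix_vector_mul_linear, of "laplacian E \<omega>" k']
    by (intro max_rank_second_order[OF \<epsilon> rank st max first]) auto
  ultimately show False using \<psi>0(2) by (simp add: laplacian_inner)
qed

section \<open>A slice for the rigid motions\<close>

lemma dual_basis:
  fixes B :: "'a::euclidean_space set"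
  assumes "independent B"
  obtains t where "\<And>b c. b \<in> B \<Longrightarrow> c \<in> B \<Longrightarrow> t b \<bullet> c = (if b = c then 1 else 0)"
proof -
  have "\<exists>t. \<forall>c\<in>B. t \<bullet> c = (if b = c then 1 else 0)" for b
  proof -
    obtain f :: "'a \<Rightarrow> real" where f: "linear f" "\<forall>c\<in>B. f c = (if b = c then 1 else 0)"
      using linear_independent_extend[OF assms, of "\<lambda>c. if b = c then 1 else 0"] by blast
    have "adjoint f 1 \<bullet> c = f c" for c
      using adjoint_works[OF f(1), of c 1] by (simp add: inner_commute)
    then show ?thesis using f(2) by (intro exI[of _ "adjoint f 1"]) simp
  qed
  then obtain t where "\<And>b. \<forall>c\<in>B. t b \<bullet> c = (if b = c then 1 else 0)" by metis
  then show ?thesis using that by blast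
qed

lemma dual_family:
  fixes w :: "nat \<Rightarrow> 'a::euclidean_space"
  assumes indep: "\<And>c. (\<Sum>k<N. c k *\<^sub>R w k) = 0 \<Longrightarrow> \<forall>k<N. c k = 0"
  shows "\<exists>s. \<forall>k<N. \<forall>l<N. s k \<bullet> w l = (if k = l then 1 else 0)"
proof -
  have inj: "inj_on w {..<N}"
  proof (rule inj_onI, rule ccontr)
    fix k l assume kl: "k \<in> {..<N}" "l \<in> {..<N}" "w k = w l" "k \<noteq> l"
    let ?c = "\<lambda>m. (if m = k then 1 else 0) - (if m = l then 1 else 0 :: real)"
    have "(\<Sum>m<N. ?c m *\<^sub>R w m) = w k - w l"
      using kl by (simp add: scaleR_diff_left sum_subtractf if_distrib[of "\<lambda>x. x *\<^sub>R _"] cong: if_cong)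
    also have "\<dots> = 0" using kl(3) by simp
    finally have "\<forall>m<N. ?c m = 0" by (rule indep)
    then have "?c k = 0" using kl(1) by blast
    then show False using kl(4) by simp
  qed
  have "independent (w ` {..<N})"
    unfolding dependent_finite[OF finite_imageI[OF finite_lessThan]]
  proof (intro notI, elim exE conjE)
    fix u assume u: "\<exists>v\<in>w ` {..<N}. u v \<noteq> 0" "(\<Sum>v\<in>w ` {..<N}. u v *\<^sub>R v) = 0"
    then have "(\<Sum>k<N. u (w k) *\<^sub>R w k) = 0" by (simp add: sum.reindex[OF inj])
    then have "\<forall>k<N. u (w k) = 0" by (rule indep)
    then show False using u(1) by auto
  qed
  then obtain t where t: "\<And>b c. b \<in> w ` {..<N} \<Longrightarrow> c \<in> w ` {..<N} \<Longrightarrow> t b \<bullet> c = (if b = c then 1 else 0)"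
    using dual_basis by metis
  show ?thesis
  proof (intro exI allI impI)
    fix k l assume "k < N" "l < N"
    then show "t (w k) \<bullet> w l = (if k = l then 1 else 0)"
      using t[of "w k" "w l"] inj by (auto simp: inj_on_def)
  qed
qed

text \<open>The components \<open>H\<close> of \<open>F x - y0\<close> with respect to
  \<open>w\<close> have the identity as linear part at (1, ..., 1). Component 0 is replaced by the
  sum \<open>p\<close> of all entries: squared lengths are nonnegative, so this functional is
  positive far out. The hypothesis \<open>a0\<close> makes the replacement reversible and gives it a
  positive linear coefficient at \<open>x 0 - 1\<close>. The conditions on signs then follow from
  estimates of the quadratic remainder.\<close>

lemma slice_contradiction:
  fixes \<rho> :: "('d::finite, 'v::finite) framework" and V :: "nat \<Rightarrow> ('d, 'v) framework"
    and E :: "'v set set" and blk :: "nat \<Rightarrow> nat" and N :: nat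
  defines "\<Phi> \<equiv> \<lambda>x :: nat \<Rightarrow> real. \<Sum>k<N. x k *\<^sub>R V k"
  assumes E: "is_graph E" and N: "2 \<le> N"
    and blk: "\<And>k. k < N \<Longrightarrow> \<exists>k'<N. k' \<noteq> k \<and> blk k' = blk k"
    and one: "\<Phi> (\<lambda>_. 1) = \<rho>"
    and indep: "\<And>c. edge_form E \<rho> (\<Phi> c) = 0 \<Longrightarrow> \<forall>k<N. c k = 0"
    and rng: "\<And>x. \<exists>c. edge_form E (\<Phi> x) (\<Phi> x) = edge_form E \<rho> (\<Phi> c)"
    and inv: "\<And>g x. (\<And>b. g b \<in> {1, -1}) \<Longrightarrow> edge_form E (\<Phi> (flip blk g x)) (\<Phi> (flip blk g x)) = edge_form E (\<Phi> x) (\<Phi> x)"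
    and uniq: "\<And>x. edge_form E (\<Phi> x) (\<Phi> x) = edge_form E \<rho> \<rho> \<Longrightarrow> \<exists>g. (\<forall>b. g b \<in> {1, -1}) \<and> (\<forall>k<N. x k = g (blk k))"
    and bnd: "0 \<le> C" "\<And>x k. k < N \<Longrightarrow> \<bar>x k\<bar> \<le> C * sqrt (norm (edge_form E (\<Phi> x) (\<Phi> x)))"
    and a0: "0 < (\<Sum>e\<in>UNIV. edge_form E \<rho> (V 0) $ e)"
  shows False
proof -
  \<comment> \<open>The factor 2 is that of the derivative of a quadratic form and normalises the
    linear part of \<open>H\<close>.\<close>
  define w where "w k = 2 *\<^sub>R edge_form E \<rho> (V k)" for k
  define F where "F x = edge_form E (\<Phi> x) (\<Phi> x)" for x
  define y0 where "y0 = edge_form E \<rho> \<rho>"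
  define p where "p y = (\<Sum>e\<in>UNIV. y $ e)" for y :: "real ^ 'v set"
  have p_add: "p (x + y) = p x + p y" and p_diff: "p (x - y) = p x - p y" and p_scale: "p (c *\<^sub>R x) = c * p x"
    for x y c
    unfolding p_def by (simp_all add: sum.distrib sum_subtractf sum_distrib_left)
  have p_sum: "p (\<Sum>k\<in>A. f k) = (\<Sum>k\<in>A. p (f k))" for f :: "nat \<Rightarrow> real ^ 'v set" and A
    unfolding p_def sum_component by (rule sum.swap)
  have p_le: "\<bar>p y\<bar> \<le> real CARD('v set) * norm y" for y
  proof -
    have "\<bar>p y\<bar> \<le> (\<Sum>e\<in>UNIV. \<bar>y $ e\<bar>)" unfolding p_def by (rule sum_abs)
    also have "\<dots> \<le> (\<Sum>e\<in>(UNIV :: 'v set set). norm y)" by (intro sum_mono component_le_norm_cart)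
    finally show ?thesis by simp
  qed
  have edge_form\<Phi>: "2 *\<^sub>R edge_form E \<rho> (\<Phi> c) = (\<Sum>k<N. c k *\<^sub>R w k)" for c
    unfolding \<Phi>_def w_def by (simp add: edge_form_sum_right edge_form_simps scaleR_sum_right mult.commute)
  have "\<forall>k<N. c k = 0" if "(\<Sum>k<N. c k *\<^sub>R w k) = 0" for c
    using that indep[of c] unfolding edge_form\<Phi>[symmetric] by simp
  from dual_family[where N = N and w = w, OF this]
  obtain s where s: "\<And>k l. k < N \<Longrightarrow> l < N \<Longrightarrow> s k \<bullet> w l = (if k = l then 1 else 0)" by blast
  have s_comb: "s k \<bullet> (\<Sum>l<N. c l *\<^sub>R w l) = c k" if "k < N" for k c
  proof -
    have "s k \<bullet> (\<Sum>l<N. c l *\<^sub>R w l) = (\<Sum>l<N. if k = l then c l else 0)"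
      unfolding inner_sum_right using s[OF that] by (intro sum.cong) auto
    then show ?thesis using that by simp
  qed
  define H where "H x k = s k \<bullet> (F x - y0)" for x k
  have FH: "F x - y0 = (\<Sum>k<N. H x k *\<^sub>R w k)" for x
  proof -
    obtain c where c: "F x = edge_form E \<rho> (\<Phi> c)" using rng unfolding F_def by blast
    have lin: "edge_form E \<rho> (\<Phi> c) = (\<Sum>k<N. c k *\<^sub>R edge_form E \<rho> (V k))" for c
      unfolding \<Phi>_def by (simp add: edge_form_sum_right edge_form_simps)
    have "F x - y0 = edge_form E \<rho> (\<Phi> c) - edge_form E \<rho> (\<Phi> (\<lambda>_. 1))" unfolding c y0_def one ..
    also have "\<dots> = (\<Sum>k<N. (c k - 1) *\<^sub>R edge_form E \<rho> (V k))"
      unfolding lin by (simp add: scaleR_diff_left sum_subtractf)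
    also have "\<dots> = (\<Sum>k<N. ((c k - 1) / 2) *\<^sub>R w k)"
      by (intro sum.cong refl) (simp only: w_def scaleR_scaleR, simp)
    finally have *: "F x - y0 = (\<Sum>k<N. ((c k - 1) / 2) *\<^sub>R w k)" .
    have "H x k = (c k - 1) / 2" if "k < N" for k unfolding H_def * using s_comb[OF that] .
    then show ?thesis unfolding * by (intro sum.cong) auto
  qed
  define a where "a k = p (w k)" for k
  have a0': "0 < a 0" using a0 by (simp add: a_def w_def p_scale) (simp add: p_def)
  define h where "h x k = (if k = 0 then p (F x - y0) else H x k)" for x and k :: nat
  have h0: "h x 0 = (\<Sum>k<N. H x k * a k)" for x
    by (simp add: h_def a_def FH[of x] p_sum p_scale)
  have N_split: "(\<Sum>k<N. f k) = f 0 + (\<Sum>k\<in>{1..<N}. f k)" for f :: "nat \<Rightarrow> real"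
    using N by (simp add: lessThan_atLeast0 sum.atLeast_Suc_lessThan)
  obtain M where M: "0 < M" "\<And>a b :: ('d, 'v) framework. norm (edge_form E a b) \<le> norm a * norm b * M"
    using bounded_bilinear.pos_bounded[OF bounded_bilinear_edge_form[of E]] by blast
  define nV where "nV = (\<Sum>k<N. norm (V k))"
  define Q where "Q = nV * nV * M"
  have Q: "norm (F z) \<le> Q * r\<^sup>2" if "\<And>k. k < N \<Longrightarrow> \<bar>z k\<bar> \<le> r" "0 \<le> r" for z r
  proof -
    have "norm (\<Phi> z) \<le> (\<Sum>k<N. r * norm (V k))"
      unfolding \<Phi>_def using that by (intro sum_norm_le) (auto intro: mult_right_mono)
    then have n: "norm (\<Phi> z) \<le> r * nV" by (simp add: nV_def sum_distrib_left)
    have "norm (F z) \<le> norm (\<Phi> z) * norm (\<Phi> z) * M" unfolding F_def by (rule M)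
    also have "\<dots> \<le> (r * nV) * (r * nV) * M"
      using n that(2) M(1) by (intro mult_right_mono mult_mono) (auto simp: nV_def sum_nonneg)
    finally show ?thesis by (simp add: Q_def power2_eq_square mult_ac)
  qed
  have Q0: "0 \<le> Q" using M(1) by (simp add: Q_def nV_def sum_nonneg)
  have expand: "F x - y0 = (\<Sum>k<N. (x k - 1) *\<^sub>R w k) + F (\<lambda>k. x k - 1)" for x
  proof -
    have "\<Phi> x = \<rho> + \<Phi> (\<lambda>k. x k - 1)"
      unfolding one[symmetric] \<Phi>_def by (simp add: sum.distrib[symmetric] scaleR_diff_left)
    then have "F x = y0 + 2 *\<^sub>R edge_form E \<rho> (\<Phi> (\<lambda>k. x k - 1)) + F (\<lambda>k. x k - 1)"
      unfolding F_def y0_def scaleR_2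
      by (simp only: edge_form_simps edge_form_commute[of E "\<Phi> (\<lambda>k. x k - 1)" \<rho>] add.assoc)
    then show ?thesis using edge_form\<Phi>[of "\<lambda>k. x k - 1"] by simp
  qed
  have Hx: "H x k = (x k - 1) + s k \<bullet> F (\<lambda>k. x k - 1)" if "k < N" for x k
    unfolding H_def expand using s_comb[OF that, of "\<lambda>k. x k - 1"] by (simp add: inner_add_right)
  have h0x: "h x 0 = (\<Sum>k<N. a k * (x k - 1)) + p (F (\<lambda>k. x k - 1))" for x
    unfolding h_def expand by (simp add: p_add p_sum p_scale a_def mult.commute)
  define D where "D = (\<Sum>k<N. norm (s k)) * Q"
  have D0: "0 \<le> D" using Q0 by (simp add: D_def sum_nonneg)
  define G where "G = (\<Sum>k\<in>{1..<N}. \<bar>a k\<bar>) * D + real CARD('v set) * Q"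
  have G0: "0 \<le> G" using D0 Q0 by (simp add: G_def sum_nonneg)
  \<comment> \<open>\<open>D\<close> bounds the quadratic error of the components other than 0, and
    \<open>G / a 0\<close> that of component 0; \<open>r\<close> is so small that
    \<open>T * r\<^sup>2 < r\<close>.\<close>
  define T where "T = max D (G / a 0)"
  define r where "r = 1 / (T + 2)"
  have T0: "0 \<le> T" using D0 by (simp add: T_def)
  have r: "0 < r" "r < 1" using T0 by (auto simp: r_def)
  have "T * r < 1" using T0 by (simp add: r_def)
  then have "(T * r) * r < 1 * r" using r(1) by (rule mult_strict_right_mono)
  then have Tr: "T * r\<^sup>2 < r" by (simp add: power2_eq_square mult.assoc)
  show False
  proof (rule flip_invariant_not_single_orbit[OF N blk, where h = h and r = r and R = "C * sqrt (p y0) + 1"])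
    fix X :: "nat \<Rightarrow> nat \<Rightarrow> real" and x k assume X: "\<And>k. k < N \<Longrightarrow> (\<lambda>n. X n k) \<longlonglongrightarrow> x k"
    have "(\<lambda>n. \<Phi> (X n)) \<longlonglongrightarrow> \<Phi> x"
      unfolding \<Phi>_def by (intro tendsto_sum tendsto_scaleR tendsto_const X) simp
    then have Flim: "(\<lambda>n. F (X n)) \<longlonglongrightarrow> F x"
      unfolding F_def by (intro bounded_bilinear.tendsto[OF bounded_bilinear_edge_form])
    show "(\<lambda>n. h (X n) k) \<longlonglongrightarrow> h x k"
      unfolding h_def p_def H_def
      by (cases "k = 0") (auto intro!: tendsto_sum tendsto_vec_nth tendsto_diff tendsto_inner Flim)
  next
    fix g :: "nat \<Rightarrow> real" and x k assume "\<And>b. g b \<in> {1, -1}" "k < N"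
    then show "h (flip blk g x) k = h x k" unfolding h_def H_def F_def using inv by simp
  next
    fix x :: "nat \<Rightarrow> real" assume z: "\<And>k. k < N \<Longrightarrow> h x k = 0"
    have H1: "H x k = 0" if "k < N" "k \<noteq> 0" for k using z[OF that(1)] that(2) by (simp add: h_def)
    have "h x 0 = H x 0 * a 0" unfolding h0 N_split using H1 by simp
    then have "H x 0 = 0" using z[of 0] N a0' by simp
    then have "H x k = 0" if "k < N" for k using H1 that by (cases "k = 0") auto
    then have "F x = y0" using FH[of x] by simp
    then show "\<exists>g. (\<forall>b. g b \<in> {1, -1}) \<and> (\<forall>k<N. x k = g (blk k))" unfolding F_def y0_def by (rule uniq)
  next
    fix x :: "nat \<Rightarrow> real" and k assume k: "k < N" "C * sqrt (p y0) + 1 \<le> \<bar>x k\<bar>"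
    show "0 < h x 0"
    \<comment> \<open>Since the entries of \<open>F x\<close> are nonnegative,
      \<open>p (F x) \<le> p y0\<close> bounds \<open>norm (F x)\<close>, and \<open>bnd\<close>
      then keeps all coordinates below the radius.\<close>
    proof (rule ccontr)
      assume "\<not> 0 < h x 0"
      then have le: "p (F x) \<le> p y0" by (simp add: h_def p_diff)
      have nn: "0 \<le> F x $ e" for e
      proof -
        have "edge_form E (\<Phi> x) (\<Phi> x) $ e = len_sq E (\<Phi> x) $ e" by (simp only: len_sq_eq_edge_form[OF E])
        moreover have "0 \<le> len_sq E (\<Phi> x) $ e"
        proof (cases "e \<in> E")
          case True
          then obtain u w where "e = {u, w}" using E unfolding is_graph_def by (metis card_2_iff)
          then show ?thesis using True by (simp add: len_sq_edge)
        qed (simp add: len_sq_non_edge)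
        ultimately show ?thesis by (simp add: F_def)
      qed
      have "norm (F x) \<le> (\<Sum>e\<in>UNIV. \<bar>F x $ e\<bar>)" by (rule norm_le_l1_cart)
      also have "\<dots> = p (F x)" using nn by (simp add: p_def)
      finally have "norm (F x) \<le> p y0" using le by simp
      then have "C * sqrt (norm (F x)) \<le> C * sqrt (p y0)" using bnd(1) by (intro mult_left_mono) auto
      then show False using bnd(2)[OF k(1), of x] k(2) unfolding F_def by simp
    qed
  next
    fix x :: "nat \<Rightarrow> real" assume x: "\<And>k. k < N \<Longrightarrow> \<bar>x k - 1\<bar> \<le> r" "\<exists>k<N. \<bar>x k - 1\<bar> = r"
    let ?z = "\<lambda>k. x k - 1"
    have nF: "norm (F ?z) \<le> Q * r\<^sup>2" using Q[of ?z r] x(1) r by simp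
    show "\<exists>k<N. \<not> ((h x k \<le> 0 \<or> x k \<le> 1) \<and> (0 \<le> h x k \<or> 1 \<le> x k))"
    proof (rule ccontr)
      assume "\<not> ?thesis"
      then have sg: "(h x k \<le> 0 \<or> x k \<le> 1) \<and> (0 \<le> h x k \<or> 1 \<le> x k)" if "k < N" for k using that by blast
      \<comment> \<open>Without a common strict sign, the linear part cannot exceed the error.
        Component 0 has to wait, because its error contains the deviations of all the
        others.\<close>
      have small: "\<bar>x k - 1\<bar> \<le> D * r\<^sup>2" if k: "k < N" "k \<noteq> 0" for k
      proof -
        have "\<bar>s k \<bullet> F ?z\<bar> \<le> norm (s k) * norm (F ?z)" by (rule Cauchy_Schwarz_ineq2)
        also have "\<dots> \<le> (\<Sum>k<N. norm (s k)) * (Q * r\<^sup>2)"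
          using nF k(1) by (intro mult_mono member_le_sum) (auto intro: sum_nonneg)
        finally have "\<bar>s k \<bullet> F ?z\<bar> \<le> D * r\<^sup>2" by (simp add: D_def mult_ac)
        moreover have "h x k = (x k - 1) + s k \<bullet> F ?z" using Hx[OF k(1), of x] k(2) by (simp add: h_def)
        ultimately show ?thesis using sg[OF k(1)] by linarith
      qed
      have small0: "\<bar>x 0 - 1\<bar> \<le> (G / a 0) * r\<^sup>2"
      proof -
        have "\<bar>\<Sum>k\<in>{1..<N}. a k * (x k - 1)\<bar> \<le> (\<Sum>k\<in>{1..<N}. \<bar>a k\<bar> * (D * r\<^sup>2))"
          using small by (intro order_trans[OF sum_abs] sum_mono) (auto simp: abs_mult intro: mult_left_mono)
        moreover have "\<bar>p (F ?z)\<bar> \<le> real CARD('v set) * (Q * r\<^sup>2)"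
          using p_le[of "F ?z"] nF by (meson mult_left_mono of_nat_0_le_iff order_trans)
        ultimately have e: "\<bar>(\<Sum>k\<in>{1..<N}. a k * (x k - 1)) + p (F ?z)\<bar> \<le> G * r\<^sup>2"
          by (simp add: G_def distrib_right sum_distrib_right mult.assoc)
        have "h x 0 = a 0 * (x 0 - 1) + ((\<Sum>k\<in>{1..<N}. a k * (x k - 1)) + p (F ?z))"
          unfolding h0x N_split by simp
        moreover have "0 < N" using N by simp
        moreover have "x 0 \<le> 1 \<longleftrightarrow> a 0 * (x 0 - 1) \<le> 0" "1 \<le> x 0 \<longleftrightarrow> 0 \<le> a 0 * (x 0 - 1)"
          using a0' by (auto simp: mult_le_0_iff zero_le_mult_iff)
        ultimately have "\<bar>a 0 * (x 0 - 1)\<bar> \<le> G * r\<^sup>2" using sg[of 0] e by linarith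
        then show ?thesis using a0' by (simp add: abs_mult pos_le_divide_eq mult.commute)
      qed
      have "\<bar>x k - 1\<bar> \<le> T * r\<^sup>2" if "k < N" for k
      proof (cases "k = 0")
        case True
        have "(G / a 0) * r\<^sup>2 \<le> T * r\<^sup>2" by (intro mult_right_mono) (auto simp: T_def)
        then show ?thesis using small0 True by simp
      next
        case False
        have "D * r\<^sup>2 \<le> T * r\<^sup>2" by (intro mult_right_mono) (auto simp: T_def)
        then show ?thesis using small[OF that False] by simp
      qed
      then show False using x(2) Tr by fastforce
    qed
  qed (use r in auto)
qed

text \<open>In column \<open>i\<close> the entries on one side of the diagonal vanish by
  triangularity and those on the other by induction. The unit length of the column leaves 1 or -1 on
  the diagonal, and the unit length of the row clears the rest. On the slice this reduces
  congruences to sign changes.\<close>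

lemma orthogonal_triangular:
  fixes A :: "real ^ 'd::finite ^ 'd" and idx :: "'d \<Rightarrow> nat"
  assumes A: "orthogonal_matrix A" and idx: "inj idx"
    and tri: "\<And>i j. idx j < idx i \<Longrightarrow> A $ i $ j = 0"
  shows "A $ i $ i \<in> {1, -1} \<and> (\<forall>j. j \<noteq> i \<longrightarrow> A $ i $ j = 0)"
proof (induction "idx i" arbitrary: i rule: less_induct)
  case less
  have "(transpose A ** A) $ i $ i = 1" "(A ** transpose A) $ i $ i = 1"
    using A unfolding orthogonal_matrix_def by (simp_all add: mat_def)
  then have col: "(\<Sum>k\<in>UNIV. (A $ k $ i)\<^sup>2) = 1" and row: "(\<Sum>k\<in>UNIV. (A $ i $ k)\<^sup>2) = 1"
    by (simp_all add: matrix_matrix_mult_def transpose_def power2_eq_square)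
  have "A $ k $ i = 0" if "k \<noteq> i" for k
  proof -
    have "idx k \<noteq> idx i" using idx that by (simp add: inj_eq)
    then consider "idx k < idx i" | "idx i < idx k" by linarith
    then show ?thesis using less that tri by cases auto
  qed
  then have "(\<Sum>k\<in>UNIV. (A $ k $ i)\<^sup>2) = (A $ i $ i)\<^sup>2"
    by (subst sum.remove[of _ i]) auto
  then have d: "(A $ i $ i)\<^sup>2 = 1" using col by simp
  have "(\<Sum>k\<in>UNIV - {i}. (A $ i $ k)\<^sup>2) = 0"
    using row d by (subst (asm) sum.remove[of _ i]) auto
  then have "\<forall>k\<in>UNIV - {i}. (A $ i $ k)\<^sup>2 = 0" by (subst (asm) sum_nonneg_eq_0_iff) auto
  then show ?case using d by (auto simp: power2_eq_1_iff)
qed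

section \<open>Coordinate columns of frameworks\<close>

lemma column_sum: "column i (\<Sum>k\<in>A. f k) = (\<Sum>k\<in>A. column i (f k))"
  by (simp add: column_def vec_eq_iff)

lemma column_scaleR: "column i (c *\<^sub>R (x :: real ^ 'd ^ 'v)) = c *\<^sub>R column i x"
  by (simp add: column_def vec_eq_iff)

lemma column_eqI: "(\<And>i. column i x = column i y) \<Longrightarrow> x = y"
  by (simp add: column_def vec_eq_iff)

lemma column_affine:
  fixes \<rho> :: "('d::finite, 'v::finite) framework" and A :: "real ^ 'd ^ 'd"
  assumes "\<And>u. \<tau> $ u = A *v \<rho> $ u + b"
  shows "column i \<tau> = (\<Sum>j\<in>UNIV. A $ i $ j *\<^sub>R column j \<rho>) + b $ i *\<^sub>R (\<chi> u. 1)"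
  by (simp add: column_def vec_eq_iff assms matrix_vector_mult_def)

text \<open>A relation among the columns and the constant function is an affine hyperplane through
  all points.\<close>

lemma spanning_columns_independent:
  fixes \<rho> :: "('d::finite, 'v::finite) framework"
  assumes "spanning \<rho>"
  shows "inj (\<lambda>i. column i \<rho>)" "(\<chi> u. 1) \<notin> range (\<lambda>i. column i \<rho>)"
    "independent (insert (\<chi> u. 1) (range (\<lambda>i. column i \<rho>)))"
proof -
  have *: "(\<forall>i. f i = 0) \<and> c = 0" if "(\<Sum>i\<in>UNIV. f i *\<^sub>R column i \<rho>) + c *\<^sub>R (\<chi> u. 1) = 0" for f c
  proof -
    have "(\<chi> i. f i) \<bullet> \<rho> $ u = - c" for u
      using arg_cong[OF that, of "\<lambda>x. x $ u"] by (simp add: column_def inner_vec_def)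
    then have "(\<chi> i. f i) = 0" using assms unfolding spanning_def by blast
    then have f: "f i = 0" for i by (simp add: vec_eq_iff)
    then have "c *\<^sub>R (\<chi> u. 1) = (0 :: real ^ 'v)" using that by simp
    then show ?thesis using f by (simp add: vec_eq_iff)
  qed
  show inj: "inj (\<lambda>i. column i \<rho>)"
  proof (rule injI, rule ccontr)
    fix i j assume ij: "column i \<rho> = column j \<rho>" "i \<noteq> j"
    let ?f = "\<lambda>k. (if k = i then 1 else 0) - (if k = j then 1 else 0 :: real)"
    have "(\<Sum>k\<in>UNIV. ?f k *\<^sub>R column k \<rho>) + 0 *\<^sub>R (\<chi> u. 1) = column i \<rho> - column j \<rho>"
      by (simp add: scaleR_diff_left sum_subtractf if_distrib[of "\<lambda>x. x *\<^sub>R _"] cong: if_cong)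
    also have "\<dots> = 0" using ij by simp
    finally have "\<forall>k. ?f k = 0" using *[of ?f 0] by blast
    then have "?f i = 0" by blast
    then show False using ij by simp
  qed
  show n: "(\<chi> u. 1) \<notin> range (\<lambda>i. column i \<rho>)"
  proof
    assume "(\<chi> u. 1) \<in> range (\<lambda>i. column i \<rho>)"
    then obtain j where j: "(\<chi> u. 1) = column j \<rho>" by blast
    let ?f = "\<lambda>k. if k = j then 1 else 0 :: real"
    have "(\<Sum>k\<in>UNIV. ?f k *\<^sub>R column k \<rho>) + (-1) *\<^sub>R (\<chi> u. 1) = column j \<rho> - (\<chi> u. 1)"
      by (simp add: if_distrib[of "\<lambda>x. x *\<^sub>R _"] cong: if_cong)
    also have "\<dots> = 0" using j by simp
    finally show False using *[of ?f "-1"] by simp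
  qed
  show "independent (insert (\<chi> u. 1) (range (\<lambda>i. column i \<rho>)))"
    unfolding dependent_finite[OF finite.insertI[OF finite_imageI[OF finite_class.finite_UNIV]]]
  proof (intro notI, elim exE conjE)
    fix g assume g: "\<exists>v\<in>insert (\<chi> u. 1) (range (\<lambda>i. column i \<rho>)). g v \<noteq> 0"
      "(\<Sum>v\<in>insert (\<chi> u. 1) (range (\<lambda>i. column i \<rho>)). g v *\<^sub>R v) = 0"
    have "(\<Sum>i\<in>UNIV. g (column i \<rho>) *\<^sub>R column i \<rho>) + g (\<chi> u. 1) *\<^sub>R (\<chi> u. 1) = 0"
      using g(2) n by (simp add: sum.reindex[OF inj] add.commute)
    from *[OF this] show False using g(1) by auto
  qed
qed

text \<open>In the slice, column \<open>i\<close> involves neither the constant function nor any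
  \<open>c j\<close> with \<open>idx j < idx i\<close>; this removes translations and rotations. A
  skew matrix of this shape is 0 and an orthogonal one is a diagonal of signs, so
  \<open>edge_form E \<rho>\<close> is injective on the slice and the fibre is one orbit of sign
  changes. Modulo trivial flexes the slice still reaches every framework with columns in
  \<open>K\<close>, so by \<open>flat\<close> the lengths stay in the image of the slice.\<close>

lemma no_large_flat_kernel:
  fixes \<rho> :: "('d::finite, 'v::finite) framework" and K :: "(real ^ 'v) set"
  assumes E: "is_graph E" and gr: "globally_rigid E \<rho>" and sp: "spanning \<rho>"
    and ker: "{\<tau>. edge_form E \<rho> \<tau> = 0} = trivial_flexes \<rho>"
    and K: "subspace K" "(\<chi> u. 1) \<in> K" "\<And>i. column i \<rho> \<in> K" "CARD('d) + 2 \<le> dim K"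
    and flat: "\<And>k k'. k \<in> K \<Longrightarrow> k' \<in> K \<Longrightarrow> \<exists>\<tau> :: ('d, 'v) framework. (\<forall>i. column i \<tau> \<in> K) \<and> edge_form E k k' = edge_form E \<rho> \<tau>"
  shows False
proof -
  define o1 :: "real ^ 'v" where "o1 = (\<chi> u. 1)"
  define c where "c i = column i \<rho>" for i
  note ind = spanning_columns_independent[OF sp, folded o1_def c_def]
  have "insert o1 (range c) \<subseteq> K" using K(2,3) by (auto simp: o1_def c_def)
  then obtain B where B: "insert o1 (range c) \<subseteq> B" "B \<subseteq> K" "independent B" "K \<subseteq> span B"
    using maximal_independent_subset_extend[OF _ ind(3), of K] by blast
  have finB: "finite B" using B(3) by (rule independent_imp_finite)
  define W where "W = B - insert o1 (range c)"
  have "W \<noteq> {}"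
  proof
    assume "W = {}"
    then have "B = insert o1 (range c)" using B(1) by (auto simp: W_def)
    then have "card B = CARD('d) + 1" using ind(1,2) by (simp add: card_image)
    moreover have "card B = dim K" using B by (intro basis_card_eq_dim) auto
    ultimately show False using K(4) by simp
  qed
  then obtain w where w: "w \<in> W" by blast
  obtain t where t: "\<And>b b'. b \<in> B \<Longrightarrow> b' \<in> B \<Longrightarrow> t b \<bullet> b' = (if b = b' then 1 else 0)"
    using dual_basis[OF B(3)] by metis
  have cB: "c i \<in> B" "o1 \<in> B" for i using B(1) by auto
  have c_eq: "c i = c j \<longleftrightarrow> i = j" "c i \<noteq> o1" for i j using ind(1,2) by (auto simp: inj_eq)
  have t_comb: "t b \<bullet> (\<Sum>b'\<in>S. \<alpha> b' *\<^sub>R b') = (if b \<in> S then \<alpha> b else 0)" if "b \<in> B" "S \<subseteq> B" for b \<alpha> S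
  proof -
    have "t b \<bullet> (\<Sum>b'\<in>S. \<alpha> b' *\<^sub>R b') = (\<Sum>b'\<in>S. if b' = b then \<alpha> b' else 0)"
      unfolding inner_sum_right using t[OF that(1)] that(2) by (intro sum.cong) auto
    also have "\<dots> = (if b \<in> S then \<alpha> b else 0)" using finite_subset[OF that(2) finB] by simp
    finally show ?thesis .
  qed
  have expandB: "x = (\<Sum>b\<in>B. (t b \<bullet> x) *\<^sub>R b)" if "x \<in> K" for x
  proof -
    have "x \<in> range (\<lambda>\<alpha>. \<Sum>b\<in>B. \<alpha> b *\<^sub>R b)" using B(4) that unfolding span_finite[OF finB] by blast
    then obtain \<alpha> where \<alpha>: "x = (\<Sum>b\<in>B. \<alpha> b *\<^sub>R b)" by blast
    have "t b \<bullet> x = \<alpha> b" if "b \<in> B" for b unfolding \<alpha> using t_comb[OF that order_refl] that by simp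
    then show ?thesis using \<alpha> by simp
  qed
  have t_aff: "t (c j) \<bullet> ((\<Sum>j\<in>UNIV. f j *\<^sub>R c j) + r *\<^sub>R o1) = f j"
    "t o1 \<bullet> ((\<Sum>j\<in>UNIV. f j *\<^sub>R c j) + r *\<^sub>R o1) = r" for f r j
  proof -
    have tc: "t (c j) \<bullet> c k = (if k = j then 1 else 0)" "t (c j) \<bullet> o1 = 0" "t o1 \<bullet> c k = 0" "t o1 \<bullet> o1 = 1" for k
      using t[OF cB(1)[of j] cB(1)[of k]] t[OF cB(1)[of j] cB(2)] t[OF cB(2) cB(1)[of k]] t[OF cB(2) cB(2)]
        c_eq(1)[of j k] c_eq(2)[of j] c_eq(2)[of k] by auto
    show "t (c j) \<bullet> ((\<Sum>j\<in>UNIV. f j *\<^sub>R c j) + r *\<^sub>R o1) = f j"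
      "t o1 \<bullet> ((\<Sum>j\<in>UNIV. f j *\<^sub>R c j) + r *\<^sub>R o1) = r"
      by (simp_all add: inner_add_right inner_sum_right tc if_distrib cong: if_cong)
  qed
  obtain idx :: "'d \<Rightarrow> nat" where idx: "inj idx"
    using finite_imp_inj_to_nat_seg[OF finite_class.finite_UNIV] by metis
  \<comment> \<open>The basis vectors allowed in column \<open>i\<close>. Both \<open>c i\<close>
    and \<open>w\<close> are among them, so each block has at least two coordinates.\<close>
  define S where "S i = {c j | j. idx i \<le> idx j} \<union> W" for i
  have SB: "S i \<subseteq> B" "finite (S i)" "c i \<in> S i" "w \<in> S i" "w \<noteq> c i" "o1 \<notin> S i" for i
  proof -
    show "S i \<subseteq> B" using cB by (auto simp: S_def W_def)
    then show "finite (S i)" using finB finite_subset by blast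
    show "c i \<in> S i" "w \<in> S i" "w \<noteq> c i" "o1 \<notin> S i" using w c_eq by (auto simp: S_def W_def)
  qed
  have cS: "c j \<in> S i \<longleftrightarrow> idx i \<le> idx j" for i j
    using c_eq by (auto simp: S_def W_def)
  define U :: "'d \<Rightarrow> real ^ 'v \<Rightarrow> ('d, 'v) framework" where "U i f = (\<chi> u j. if j = i then f $ u else 0)" for i f
  have colU: "column j (U i f) = (if j = i then f else 0)" for i j f
    by (simp add: column_def U_def vec_eq_iff)
  \<comment> \<open>A change of basis that turns \<open>\<rho>\<close> into (1, ..., 1): the vectors
    \<open>vv i b\<close> with \<open>b\<close> in \<open>S i\<close> add up to \<open>c i\<close>.
    The coefficients with respect to the old basis are \<open>\<alpha>\<close>.\<close>
  define vv where "vv i b = (if b = c i then c i - \<Sum>(S i - {c i}) else b)" for i b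
  define J where "J = (SIGMA i : UNIV. S i)"
  have finJ: "finite J" using SB(2) by (auto simp: J_def)
  define VJ where "VJ = (\<lambda>(i, b). U i (vv i b))"
  define \<Psi> where "\<Psi> y = (\<Sum>j\<in>J. y j *\<^sub>R VJ j)" for y :: "'d \<times> (real ^ 'v) \<Rightarrow> real"
  define \<alpha> where "\<alpha> y i b = (if b = c i then y (i, c i) else y (i, b) - y (i, c i))"
    for y :: "'d \<times> (real ^ 'v) \<Rightarrow> real" and i b
  have col\<Psi>: "column i (\<Psi> y) = (\<Sum>b\<in>S i. \<alpha> y i b *\<^sub>R b)" for y i
  proof -
    have "column i (\<Psi> y) = (\<Sum>i'\<in>UNIV. \<Sum>b\<in>S i'. y (i', b) *\<^sub>R column i (U i' (vv i' b)))"
      unfolding \<Psi>_def J_def column_sum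
      by (subst sum.Sigma) (auto simp: SB(2) VJ_def column_scaleR intro!: sum.cong)
    also have "\<dots> = (\<Sum>i'\<in>UNIV. if i' = i then \<Sum>b\<in>S i. y (i, b) *\<^sub>R vv i b else 0)"
      by (intro sum.cong) (auto simp: colU)
    also have "\<dots> = (\<Sum>b\<in>S i. y (i, b) *\<^sub>R vv i b)" by simp
    also have "\<dots> = y (i, c i) *\<^sub>R (c i - \<Sum>(S i - {c i})) + (\<Sum>b\<in>S i - {c i}. y (i, b) *\<^sub>R b)"
      by (subst sum.remove[OF SB(2)[of i] SB(3)[of i]]) (auto simp: vv_def intro!: sum.cong)
    also have "\<dots> = y (i, c i) *\<^sub>R c i + (\<Sum>b\<in>S i - {c i}. (y (i, b) - y (i, c i)) *\<^sub>R b)"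
      by (simp add: scaleR_diff_left scaleR_diff_right sum_subtractf scaleR_sum_right)
    also have "\<dots> = (\<Sum>b\<in>S i. \<alpha> y i b *\<^sub>R b)"
      by (subst sum.remove[OF SB(2)[of i] SB(3)[of i]]) (auto simp: \<alpha>_def intro!: sum.cong)
    finally show ?thesis .
  qed
  have t\<Psi>: "t b \<bullet> column i (\<Psi> y) = (if b \<in> S i then \<alpha> y i b else 0)" if "b \<in> B" for b i y
    unfolding col\<Psi> by (rule t_comb[OF that SB(1)])
  have colK: "column i (\<Psi> y) \<in> K" for i y
    unfolding col\<Psi> using SB(1) B(2) K(1) by (intro subspace_sum subspace_scale) auto
  have solve: "\<exists>y. \<Psi> y = \<tau>" if "\<And>i. \<exists>\<beta>. column i \<tau> = (\<Sum>b\<in>S i. \<beta> b *\<^sub>R b)" for \<tau>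
  proof -
    obtain \<beta> where \<beta>: "\<And>i. column i \<tau> = (\<Sum>b\<in>S i. \<beta> i b *\<^sub>R b)" using \<open>\<And>i. \<exists>\<beta>. _ i \<beta>\<close> by metis
    define y where "y = (\<lambda>(i, b). \<beta> i (c i) + (if b = c i then 0 else \<beta> i b))"
    have "\<alpha> y i b = \<beta> i b" for i b by (simp add: \<alpha>_def y_def)
    then show ?thesis by (intro exI[of _ y] column_eqI) (simp add: col\<Psi> \<beta>)
  qed
  have one: "\<Psi> (\<lambda>_. 1) = \<rho>"
  proof (rule column_eqI)
    fix i
    have "column i (\<Psi> (\<lambda>_. 1)) = (\<Sum>b\<in>S i. if b = c i then c i else 0)"
      unfolding col\<Psi> by (intro sum.cong) (auto simp: \<alpha>_def)
    then show "column i (\<Psi> (\<lambda>_. 1)) = column i \<rho>" using SB(2,3) by (simp add: c_def)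
  qed
  have affine: "A $ i $ j = t (c j) \<bullet> column i \<tau> \<and> b $ i = t o1 \<bullet> column i \<tau>"
    if "\<And>u. \<tau> $ u = A *v \<rho> $ u + b" for \<tau> :: "('d, 'v) framework" and A b i j
    using t_aff(1)[where j = j and f = "\<lambda>j. A $ i $ j" and r = "b $ i"]
      t_aff(2)[where f = "\<lambda>j. A $ i $ j" and r = "b $ i"] column_affine[OF that, of i] by (simp add: c_def o1_def)
  have tri: "A $ i $ j = 0" if "\<And>u. \<Psi> y $ u = A *v \<rho> $ u + b" "idx j < idx i" for y A b i j
    using affine[OF that(1), of i j] t\<Psi>[OF cB(1)[of j], of i y] cS[of j i] that(2) by simp
  have b0: "b = 0" if "\<And>u. \<Psi> y $ u = A *v \<rho> $ u + b" for y A b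
    using affine[OF that] t\<Psi>[OF cB(2)] SB(6) by (simp add: vec_eq_iff)
  have \<alpha>_inj: "y j = 0" if "\<Psi> y = 0" "j \<in> J" for y j
  proof -
    obtain i b where j: "j = (i, b)" by (cases j)
    have b: "b \<in> S i" using that(2) by (simp add: J_def j)
    have "column i (\<Psi> y) = 0" using that(1) by (simp add: column_def vec_eq_iff)
    then have "\<alpha> y i b' = 0" if "b' \<in> S i" for b'
      using t\<Psi>[of b' i y] SB(1)[of i] that by auto
    from this[OF b] this[OF SB(3)] show ?thesis by (simp add: \<alpha>_def j split: if_splits)
  qed
  have indep: "\<forall>j\<in>J. y j = 0" if "edge_form E \<rho> (\<Psi> y) = 0" for y
  proof -
    have "\<Psi> y \<in> trivial_flexes \<rho>" using that ker by blast
    then obtain A b where A: "transpose A = - A" "\<And>u. \<Psi> y $ u = A *v \<rho> $ u + b" unfolding trivial_flexes_def by blast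
    have skew: "A $ j $ i = - A $ i $ j" for i j
      using arg_cong[OF A(1), of "\<lambda>M. M $ i $ j"] by (simp add: transpose_def)
    have "A $ i $ j = 0" for i j
    proof -
      have "idx j < idx i \<or> idx i < idx j \<or> i = j" using idx by (metis inj_eq linorder_neqE_nat)
      then show ?thesis using tri[OF A(2)] skew[of i j] skew[of i i] by fastforce
    qed
    then have "A = 0" by (simp add: vec_eq_iff)
    then have "\<Psi> y $ u = 0" for u using A(2)[of u] b0[OF A(2)] by simp
    then have "\<Psi> y = 0" by (simp add: vec_eq_iff)
    then show ?thesis using \<alpha>_inj by blast
  qed
  have rangeK: "\<exists>y. edge_form E \<rho> \<tau> = edge_form E \<rho> (\<Psi> y)" if \<tau>: "\<And>i. column i \<tau> \<in> K" for \<tau> :: "('d, 'v) framework"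
  proof -
    define M where "M i j = t (c j) \<bullet> column i \<tau>" for i j
    \<comment> \<open>The skew matrix whose lower part is the part of \<open>\<tau>\<close>
      forbidden in the slice; subtracting its flex moves \<open>\<tau>\<close> into the slice
      without changing \<open>edge_form E \<rho> \<tau>\<close>.\<close>
    define A :: "real ^ 'd ^ 'd" where
      "A = (\<chi> i j. if idx j < idx i then M i j else if idx i < idx j then - M j i else 0)"
    define b :: "real ^ 'd" where "b = (\<chi> i. t o1 \<bullet> column i \<tau>)"
    define \<tau>' :: "('d, 'v) framework" where "\<tau>' = (\<chi> u. A *v \<rho> $ u + b)"
    have \<tau>': "\<tau>' $ u = A *v \<rho> $ u + b" for u by (simp add: \<tau>'_def)
    have "transpose A = - A" by (auto simp: A_def transpose_def vec_eq_iff)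
    then have "\<tau>' \<in> trivial_flexes \<rho>" using \<tau>' unfolding trivial_flexes_def by blast
    then have z: "edge_form E \<rho> \<tau>' = 0" using ker by blast
    have col\<tau>': "column i \<tau>' = (\<Sum>j\<in>UNIV. A $ i $ j *\<^sub>R c j) + b $ i *\<^sub>R o1" for i
      using column_affine[OF \<tau>'] by (simp add: c_def o1_def)
    have cd: "column i (\<tau> - \<tau>') = column i \<tau> - column i \<tau>'" for i by (simp add: column_def vec_eq_iff)
    have inK: "column i (\<tau> - \<tau>') \<in> K" for i
      unfolding cd col\<tau>' using \<tau> K cB B(2)
      by (intro subspace_diff subspace_add subspace_sum subspace_scale) auto
    have "t b' \<bullet> column i (\<tau> - \<tau>') = 0" if b': "b' \<in> B - S i" for b' i
    proof -
      consider "b' = o1" | j where "b' = c j" "idx j < idx i"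
        using b' cS[of _ i] by (fastforce simp: S_def W_def not_le)
      then show ?thesis
      proof cases
        case 1
        then show ?thesis using affine[OF \<tau>', of i] by (simp add: cd inner_diff_right b_def)
      next
        case 2
        then show ?thesis using affine[OF \<tau>', of i j] by (simp add: cd inner_diff_right A_def M_def)
      qed
    qed
    then have colsum: "column i (\<tau> - \<tau>') = (\<Sum>b'\<in>S i. (t b' \<bullet> column i (\<tau> - \<tau>')) *\<^sub>R b')" for i
      by (subst expandB[OF inK]) (intro sum.mono_neutral_right finB SB(1), auto)
    have "\<exists>y. \<Psi> y = \<tau> - \<tau>'" by (rule solve, rule exI, rule colsum)
    then obtain y where "\<Psi> y = \<tau> - \<tau>'" by blast
    then show ?thesis using z by (intro exI[of _ y]) (simp add: edge_form_simps)
  qed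
  have rng: "\<exists>y'. edge_form E (\<Psi> y) (\<Psi> y) = edge_form E \<rho> (\<Psi> y')" for y
  proof -
    have "\<forall>i. \<exists>\<tau> :: ('d, 'v) framework. (\<forall>j. column j \<tau> \<in> K) \<and> edge_form E (column i (\<Psi> y)) (column i (\<Psi> y)) = edge_form E \<rho> \<tau>"
      using flat[OF colK colK] by blast
    then obtain T where T: "\<And>i j. column j (T i) \<in> K" "\<And>i. edge_form E (column i (\<Psi> y)) (column i (\<Psi> y)) = edge_form E \<rho> (T i)"
      by metis
    have "edge_form E (\<Psi> y) (\<Psi> y) = edge_form E \<rho> (\<Sum>i\<in>UNIV. T i)"
      unfolding edge_form_columns[of E "\<Psi> y"] T(2) edge_form_sum_right ..
    moreover have "column j (\<Sum>i\<in>UNIV. T i) \<in> K" for j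
      unfolding column_sum using T(1) K(1) by (intro subspace_sum) auto
    ultimately show ?thesis using rangeK by metis
  qed
  have uniq: "\<exists>g. \<forall>i. g i \<in> {1, -1} \<and> (\<forall>b\<in>S i. y (i, b) = g i)" if "edge_form E (\<Psi> y) (\<Psi> y) = edge_form E \<rho> \<rho>" for y
  proof -
    have "congruent_frameworks \<rho> (\<Psi> y)"
      using gr that unfolding globally_rigid_def len_sq_eq_edge_form[OF E] by blast
    then obtain f s where f: "orthogonal_transformation f" "\<And>u. \<Psi> y $ u = f (\<rho> $ u) + s"
      unfolding congruent_frameworks_def rigid_motion_def by blast
    define A where "A = matrix f"
    have A: "orthogonal_matrix A" "\<And>x. f x = A *v x"
      using f(1) unfolding A_def orthogonal_transformation_matrix
      by (auto simp: matrix_works linear_matrix_vector_mul_eq)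
    have aff: "\<Psi> y $ u = A *v \<rho> $ u + s" for u using f(2) A(2) by simp
    have diag: "A $ i $ i \<in> {1, -1}" "j \<noteq> i \<Longrightarrow> A $ i $ j = 0" for i j
      using orthogonal_triangular[OF A(1) idx tri[OF aff]] by auto
    have s0: "s = 0" by (rule b0[OF aff])
    have col: "column i (\<Psi> y) = A $ i $ i *\<^sub>R c i" for i
    proof -
      have "column i (\<Psi> y) = (\<Sum>j\<in>UNIV. A $ i $ j *\<^sub>R c j)"
        using column_affine[OF aff, of i] s0 by (simp add: c_def)
      also have "\<dots> = A $ i $ i *\<^sub>R c i"
        by (subst sum.remove[of _ i]) (auto simp: diag(2) intro!: sum.neutral)
      finally show ?thesis .
    qed
    have \<alpha>A: "\<alpha> y i b = (if b = c i then A $ i $ i else 0)" if "b \<in> S i" for i b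
    proof -
      have "b \<in> B" using SB(1) that by blast
      then show ?thesis using t\<Psi>[of b i y] that t[of b "c i"] cB by (cases "b = c i") (simp_all add: col)
    qed
    have "y (i, b) = A $ i $ i" if "b \<in> S i" for i b
      using \<alpha>A[OF that] \<alpha>A[OF SB(3), of i] by (simp add: \<alpha>_def split: if_splits)
    then show ?thesis using diag(1) by (intro exI[of _ "\<lambda>i. A $ i $ i"]) blast
  qed
  have inv: "edge_form E (\<Psi> y') (\<Psi> y') = edge_form E (\<Psi> y) (\<Psi> y)"
    if g: "\<And>i. g i \<in> {1, -1 :: real}" and y': "\<And>i b. b \<in> S i \<Longrightarrow> y' (i, b) = g i * y (i, b)" for g y y'
  proof -
    have "\<alpha> y' i b = g i * \<alpha> y i b" if "b \<in> S i" for i b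
      using y'[OF that] y'[OF SB(3)] by (simp add: \<alpha>_def right_diff_distrib)
    then have "column i (\<Psi> y') = g i *\<^sub>R column i (\<Psi> y)" for i
      by (simp add: col\<Psi> scaleR_sum_right)
    moreover have "g i * g i = 1" for i using g[of i] by auto
    ultimately show ?thesis
      unfolding edge_form_columns[of E "\<Psi> y'"] edge_form_columns[of E "\<Psi> y"] by (simp add: edge_form_simps)
  qed
  obtain Cd where Cd: "0 \<le> Cd"
    "\<And>(\<sigma> :: ('d, 'v) framework) u w. norm (\<sigma> $ u - \<sigma> $ w) \<le> Cd * sqrt (norm (edge_form E \<sigma> \<sigma>))"
    using connected_diameter_bound[OF E globally_rigid_connected[OF E gr], where 'd = 'd] by blast
  define Ct where "Ct b = (\<Sum>u\<in>UNIV. \<bar>t b $ u\<bar>) * Cd" for b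
  have Ct0: "0 \<le> Ct b" for b using Cd(1) by (simp add: Ct_def sum_nonneg)
  have \<alpha>bd: "\<bar>\<alpha> y i b\<bar> \<le> Ct b * sqrt (norm (edge_form E (\<Psi> y) (\<Psi> y)))" if b: "b \<in> S i" for y i b
  proof -
    have bB: "b \<in> B" "b \<noteq> o1" using b SB(1,6) by auto
    define u0 :: 'v where "u0 = undefined"
    \<comment> \<open>Being orthogonal to the constant function, \<open>t b\<close> sees only
      positions relative to \<open>u0\<close>, which the diameter bound controls.\<close>
    have "t b \<bullet> o1 = 0" using t[OF bB(1) cB(2)] bB(2) by simp
    then have "(\<Sum>u\<in>UNIV. t b $ u) = 0" by (simp add: o1_def inner_vec_def)
    then have "(\<Sum>u\<in>UNIV. t b $ u * (\<Psi> y $ u $ i - \<Psi> y $ u0 $ i)) = t b \<bullet> column i (\<Psi> y)"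
      by (simp add: inner_vec_def column_def right_diff_distrib sum_subtractf flip: sum_distrib_right)
    also have "\<dots> = \<alpha> y i b" using t\<Psi>[OF bB(1)] b by simp
    finally have "\<bar>\<alpha> y i b\<bar> = \<bar>\<Sum>u\<in>UNIV. t b $ u * (\<Psi> y $ u $ i - \<Psi> y $ u0 $ i)\<bar>" by simp
    also have "\<dots> \<le> (\<Sum>u\<in>UNIV. \<bar>t b $ u\<bar> * (Cd * sqrt (norm (edge_form E (\<Psi> y) (\<Psi> y)))))"
    proof (intro order_trans[OF sum_abs] sum_mono)
      fix u
      have "\<bar>\<Psi> y $ u $ i - \<Psi> y $ u0 $ i\<bar> \<le> norm (\<Psi> y $ u - \<Psi> y $ u0)"
        using component_le_norm_cart[of "\<Psi> y $ u - \<Psi> y $ u0" i] by simp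
      also have "\<dots> \<le> Cd * sqrt (norm (edge_form E (\<Psi> y) (\<Psi> y)))" by (rule Cd(2))
      finally show "\<bar>t b $ u * (\<Psi> y $ u $ i - \<Psi> y $ u0 $ i)\<bar> \<le> \<bar>t b $ u\<bar> * (Cd * sqrt (norm (edge_form E (\<Psi> y) (\<Psi> y))))"
        by (simp add: abs_mult mult_left_mono)
    qed
    also have "\<dots> = Ct b * sqrt (norm (edge_form E (\<Psi> y) (\<Psi> y)))"
      by (simp add: Ct_def sum_distrib_right mult.assoc)
    finally show ?thesis .
  qed
  define C where "C = (\<Sum>(i, b)\<in>J. Ct (c i) + Ct b)"
  have C0: "0 \<le> C" unfolding C_def by (intro sum_nonneg) (auto simp: Ct0 add_nonneg_nonneg)
  have bnd: "\<bar>y j\<bar> \<le> C * sqrt (norm (edge_form E (\<Psi> y) (\<Psi> y)))" if "j \<in> J" for y j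
  proof -
    obtain i b where j: "j = (i, b)" by (cases j)
    have b: "b \<in> S i" using that by (simp add: J_def j)
    have "\<bar>y j\<bar> \<le> \<bar>\<alpha> y i (c i)\<bar> + \<bar>\<alpha> y i b\<bar>" unfolding \<alpha>_def j by (cases "b = c i") auto
    also have "\<dots> \<le> (Ct (c i) + Ct b) * sqrt (norm (edge_form E (\<Psi> y) (\<Psi> y)))"
      using \<alpha>bd[OF b, of y] \<alpha>bd[OF SB(3), of y i] by (simp add: distrib_right)
    also have "Ct (c i) + Ct b \<le> C"
      using member_le_sum[OF that, of "\<lambda>(i, b). Ct (c i) + Ct b"] finJ Ct0 by (simp add: C_def j case_prod_beta)
    then have "(Ct (c i) + Ct b) * sqrt (norm (edge_form E (\<Psi> y) (\<Psi> y))) \<le> C * sqrt (norm (edge_form E (\<Psi> y) (\<Psi> y)))"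
      by (intro mult_right_mono) auto
    finally show ?thesis .
  qed
  define p where "p y = (\<Sum>e\<in>UNIV. y $ e)" for y :: "real ^ 'v set"
  have nn: "0 \<le> edge_form E \<rho> \<rho> $ e" for e
  proof (cases "e \<in> E")
    case True
    then obtain u w where "e = {u, w}" "u \<noteq> w" using E unfolding is_graph_def by (metis card_2_iff)
    then show ?thesis using True by (simp add: edge_form_edge)
  qed (simp add: edge_form_non_edge)
  \<comment> \<open>If all edges had length 0, connectedness would collapse \<open>\<rho>\<close> to
    a point, which is not spanning. As \<open>\<rho>\<close> is the sum of the \<open>VJ j\<close>,
    positivity passes to some \<open>j0\<close>, which is to become index 0.\<close>
  have "0 < p (edge_form E \<rho> \<rho>)"
  proof (rule ccontr)
    assume "\<not> ?thesis"
    then have "p (edge_form E \<rho> \<rho>) = 0" using sum_nonneg[of UNIV "\<lambda>e. edge_form E \<rho> \<rho> $ e"] nn by (simp add: p_def)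
    then have "edge_form E \<rho> \<rho> $ e = 0" for e unfolding p_def using nn by (subst (asm) sum_nonneg_eq_0_iff) auto
    then have "edge_form E \<rho> \<rho> = 0" by (simp add: vec_eq_iff)
    then have "\<rho> $ u = \<rho> $ undefined" for u using Cd(2)[where \<sigma> = \<rho> and u = u and w = undefined] by simp
    then have "\<forall>u. axis undefined 1 \<bullet> \<rho> $ u = axis undefined 1 \<bullet> \<rho> $ undefined" by metis
    then have "(axis undefined 1 :: real ^ 'd) = 0" using sp unfolding spanning_def by blast
    then show False by (simp add: axis_eq_0_iff)
  qed
  moreover have "p (edge_form E \<rho> \<rho>) = (\<Sum>j\<in>J. p (edge_form E \<rho> (VJ j)))"
  proof -
    have "edge_form E \<rho> \<rho> = (\<Sum>j\<in>J. edge_form E \<rho> (VJ j))"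
      by (subst (2) one[symmetric]) (simp add: \<Psi>_def edge_form_sum_right)
    then show ?thesis unfolding p_def by (simp add: sum.swap[of _ J])
  qed
  ultimately obtain j0 where j0: "j0 \<in> J" "0 < p (edge_form E \<rho> (VJ j0))"
    using sum_nonpos[of J "\<lambda>j. p (edge_form E \<rho> (VJ j))"] by (metis not_less)
  define N where "N = card J"
  obtain e0 where e0: "bij_betw e0 {..<N} J"
    using ex_bij_betw_nat_finite[OF finJ] by (auto simp: N_def lessThan_atLeast0)
  obtain l where l: "l < N" "e0 l = j0" using e0 j0(1) unfolding bij_betw_def by (metis imageE lessThan_iff)
  \<comment> \<open>The transposition moves \<open>j0\<close> to index 0.\<close>
  define e where "e = e0 \<circ> Transposition.transpose 0 l"
  have e: "bij_betw e {..<N} J" unfolding e_def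
    by (rule bij_betw_trans[OF _ e0], rule bij_betw_transpose_iff) (use l(1) in auto)
  have e_0: "e 0 = j0" by (simp add: e_def l(2))
  define e' where "e' = inv_into {..<N} e"
  have e': "e' j < N" "e (e' j) = j" if "j \<in> J" for j
    using e that unfolding e'_def bij_betw_def by (metis inv_into_into lessThan_iff, metis f_inv_into_f)
  have e'e: "e' (e k) = k" if "k < N" for k
    using e that unfolding e'_def bij_betw_def by (simp add: inv_into_f_f)
  have eJ: "e k \<in> J" if "k < N" for k using e that unfolding bij_betw_def by blast
  have \<Phi>: "(\<Sum>k<N. x k *\<^sub>R VJ (e k)) = \<Psi> (\<lambda>j. x (e' j))" for x
    unfolding \<Psi>_def by (subst sum.reindex_bij_betw[OF e, symmetric]) (simp add: e'e)
  have block: "\<exists>k'<N. k' \<noteq> k \<and> idx (fst (e k')) = idx (fst (e k))" if k: "k < N" for k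
  proof -
    obtain i b where ek: "e k = (i, b)" by (cases "e k")
    define b' where "b' = (if b = c i then w else c i)"
    have b': "b' \<in> S i" "b' \<noteq> b" using SB(3-5)[of i] by (auto simp: b'_def)
    then have "(i, b') \<in> J" by (simp add: J_def)
    then show ?thesis using e'[of "(i, b')"] ek b'(2) by (intro exI[of _ "e' (i, b')"]) auto
  qed
  have "2 \<le> N"
  proof -
    have "0 < N" using l(1) by simp
    then obtain k' where "k' < N" "k' \<noteq> 0" using block by blast
    then show ?thesis by simp
  qed
  let ?F = "\<lambda>x. \<Sum>k<N. x k *\<^sub>R VJ (e k)"
  show False
  proof (rule slice_contradiction[OF E \<open>2 \<le> N\<close> block, where \<rho> = \<rho> and V = "\<lambda>k. VJ (e k)" and C = C])
    show "(\<Sum>k<N. 1 *\<^sub>R VJ (e k)) = \<rho>" using one \<Phi>[of "\<lambda>_. 1"] by simp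
    show "\<forall>k<N. x k = 0" if "edge_form E \<rho> (?F x) = 0" for x
    proof (intro allI impI)
      fix k assume "k < N"
      then show "x k = 0" using indep[OF that[unfolded \<Phi>]] eJ[of k] e'e[of k] by fastforce
    qed
    show "\<exists>x'. edge_form E (?F x) (?F x) = edge_form E \<rho> (?F x')" for x
    proof -
      obtain y' where y': "edge_form E (\<Psi> (\<lambda>j. x (e' j))) (\<Psi> (\<lambda>j. x (e' j))) = edge_form E \<rho> (\<Psi> y')" using rng by blast
      have "\<Psi> y' = \<Psi> (\<lambda>j. y' (e (e' j)))" unfolding \<Psi>_def by (intro sum.cong) (auto simp: e')
      then show ?thesis unfolding \<Phi> using y' by (intro exI[of _ "\<lambda>k. y' (e k)"]) simp
    qed
    show "edge_form E (?F (flip (\<lambda>k. idx (fst (e k))) g x)) (?F (flip (\<lambda>k. idx (fst (e k))) g x)) =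
      edge_form E (?F x) (?F x)" if g: "\<And>b. g b \<in> {1, -1}" for g and x :: "nat \<Rightarrow> real"
      unfolding \<Phi>
    proof (rule inv[where g = "\<lambda>i. g (idx i)"])
      fix i b assume "b \<in> S i"
      then have "(i, b) \<in> J" by (simp add: J_def)
      then show "flip (\<lambda>k. idx (fst (e k))) g x (e' (i, b)) = g (idx i) * x (e' (i, b))"
        using e'(2) by (simp add: flip_def)
    qed (rule g)
    show "\<exists>g. (\<forall>b. g b \<in> {1, -1}) \<and> (\<forall>k<N. x k = g (idx (fst (e k))))"
      if eq: "edge_form E (?F x) (?F x) = edge_form E \<rho> \<rho>" for x
    proof -
      obtain g where g: "\<And>i. g i \<in> {1, -1 :: real}" "\<And>i b. b \<in> S i \<Longrightarrow> x (e' (i, b)) = g i"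
        using uniq[OF eq[unfolded \<Phi>]] by blast
      have "x k = g (inv idx (idx (fst (e k))))" if "k < N" for k
      proof -
        obtain i b where ek: "e k = (i, b)" by (cases "e k")
        then have "b \<in> S i" using eJ[OF that] by (simp add: J_def)
        then show ?thesis using g(2) e'e[OF that] ek idx by (metis fst_conv inv_f_f)
      qed
      then show ?thesis using g(1) by (intro exI[of _ "\<lambda>b. g (inv idx b)"]) blast
    qed
    show "\<bar>x k\<bar> \<le> C * sqrt (norm (edge_form E (?F x) (?F x)))" if "k < N" for x k
      unfolding \<Phi> using bnd[OF eJ[OF that], of "\<lambda>j. x (e' j)"] e'e[OF that] by simp
    show "0 < (\<Sum>ed\<in>UNIV. edge_form E \<rho> (VJ (e 0)) $ ed)" using j0(2) by (simp add: e_0 p_def)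
  qed (use C0 in auto)
qed

section \<open>Minimal stress kernels\<close>

text \<open>The constant function and the coordinate functions lie in the kernel of every
  equilibrium stress matrix, and they are independent at a generic framework.\<close>

lemma k_min_bounds:
  fixes E :: "'v::finite set set"
  assumes v: "CARD('d::finite) < CARD('v)"
  shows "CARD('d) + 1 \<le> k_min E TYPE('d)"
    and "generic (\<rho> :: ('d, 'v) framework) \<Longrightarrow> equilibrium_stress_matrix E \<rho> \<Omega> \<Longrightarrow> k_min E TYPE('d) \<le> dim {x. \<Omega> *v x = 0}"
proof -
  let ?S = "{dim {x. \<Omega> *v x = 0} | \<Omega> (\<rho> :: ('d, 'v) framework). generic \<rho> \<and> equilibrium_stress_matrix E \<rho> \<Omega>}"
  obtain \<rho>0 :: "('d, 'v) framework" where "generic \<rho>0" using generic_dense[of 1 0] by auto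
  moreover have "equilibrium_stress_matrix E \<rho>0 0"
    by (simp add: equilibrium_stress_matrix_def transpose_def vec_eq_iff)
  ultimately have ne: "?S \<noteq> {}" by blast
  have "CARD('d) + 1 \<le> n" if n: "n \<in> ?S" for n
  proof -
    obtain \<Omega> and \<rho> :: "('d, 'v) framework" where *: "n = dim {x. \<Omega> *v x = 0}" "generic \<rho>" "equilibrium_stress_matrix E \<rho> \<Omega>"
      using n by blast
    note ind = spanning_columns_independent[OF generic_imp_spanning[OF *(2) v]]
    have "\<Omega> *v (\<chi> u. 1) = 0" using *(3) by (simp add: equilibrium_stress_matrix_def matrix_vector_mult_def vec_eq_iff)
    moreover have "\<Omega> *v column i \<rho> = 0" for i
    proof (rule iffD2[OF vec_eq_iff], rule allI)
      fix u
      have "(\<Sum>w\<in>UNIV. \<Omega> $ u $ w *\<^sub>R \<rho> $ w) $ i = 0" using *(3) by (simp add: equilibrium_stress_matrix_def)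
      then show "(\<Omega> *v column i \<rho>) $ u = 0 $ u" by (simp add: matrix_vector_mult_def column_def)
    qed
    ultimately have "insert (\<chi> u. 1) (range (\<lambda>i. column i \<rho>)) \<subseteq> {f. \<Omega> *v f = 0}" by auto
    then have "card (insert (\<chi> u. 1) (range (\<lambda>i. column i \<rho>))) \<le> dim {f. \<Omega> *v f = 0}"
      using ind(3) by (rule independent_card_le_dim)
    then show ?thesis using ind(1,2) *(1) by (simp add: card_image)
  qed
  then show "CARD('d) + 1 \<le> k_min E TYPE('d)" unfolding k_min_def using cInf_greatest[OF ne] by blast
  show "k_min E TYPE('d) \<le> dim {x. \<Omega> *v x = 0}" if "generic \<rho>" "equilibrium_stress_matrix E \<rho> \<Omega>"
    unfolding k_min_def by (rule cInf_lower) (use that in auto)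
qed

theorem corollary1p16:
  fixes E :: "'v::finite set set"
    and \<rho> :: "('d::finite, 'v) framework"
  assumes "is_graph E"
    and "CARD('v) \<ge> CARD('d) + 2"
    and "\<not> minimal_stress_kernel E TYPE('d)"
    and "infinitesimally_rigid E \<rho>"
  shows "\<not> globally_rigid E \<rho>"
proof
  assume gr: "globally_rigid E \<rho>"
  note E = assms(1)
  have v: "CARD('d) < CARD('v)" using assms(2) by simp
  obtain e1 where e1: "0 < e1"
    "\<And>m :: ('d, 'v) framework. norm (m - \<rho>) < e1 \<Longrightarrow> CARD('v) * CARD('d) - ((CARD('d) + 1) choose 2) \<le> dim (range (edge_form E m))"
    using rigid_near[OF E v assms(4)] by metis
  obtain e2 where e2: "0 < e2" "\<And>m :: ('d, 'v) framework. norm (m - \<rho>) < e2 \<Longrightarrow> globally_rigid E m"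
    using globally_rigid_near[OF E v assms(4) gr] by metis
  \<comment> \<open>On this ball every framework is both infinitesimally and globally rigid, so the
    rank of \<open>edge_form\<close> is constant.\<close>
  define U where "U = {m :: ('d, 'v) framework. norm (m - \<rho>) < min e1 e2}"
  have "\<rho> \<in> U" using e1(1) e2(1) by (simp add: U_def)
  have ker: "{\<tau>. edge_form E m \<tau> = 0} = trivial_flexes m" "spanning m" "globally_rigid E m"
    and dk: "dim {\<tau>. edge_form E m \<tau> = 0} = (CARD('d) + 1) choose 2" if "m \<in> U" for m
    using rigid_kernel[OF E v e1(2)[of m]] rigid_imp_spanning[OF E v e1(2)[of m]] e2(2)[of m] that
    by (auto simp: U_def)
  have rank_const: "dim (range (edge_form E m)) = dim (range (edge_form E m'))" if "m \<in> U" "m' \<in> U" for m m'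
    using rank_plus_flexes[of E m] rank_plus_flexes[of E m'] dk[OF that(1)] dk[OF that(2)] by linarith
  define P where "P n \<longleftrightarrow> (\<exists>m\<in>U. \<exists>\<omega>. stress_map E m \<omega> = 0 \<and> n = dim {f. laplacian E \<omega> *v f = 0})" for n
  have "stress_map E \<rho> 0 = 0" by (rule bounded_bilinear.zero_right[OF bounded_bilinear_stress_map])
  then have "\<exists>n. P n" using \<open>\<rho> \<in> U\<close> unfolding P_def by blast
  \<comment> \<open>The kernel is minimised over all of \<open>U\<close>, not just over the stresses
    of one framework; only so can it not shrink when stress and framework are deformed
    together.\<close>
  then have "P (LEAST n. P n)" by (rule LeastI_ex)
  then obtain \<rho>0 \<omega> where \<rho>0: "\<rho>0 \<in> U" "stress_map E \<rho>0 \<omega> = 0" "(LEAST n. P n) = dim {f. laplacian E \<omega> *v f = 0}"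
    unfolding P_def by blast
  have max: "dim {f. laplacian E \<omega> *v f = 0} \<le> dim {f. laplacian E \<omega>' *v f = 0}" if "m \<in> U" "stress_map E m \<omega>' = 0" for m \<omega>'
    unfolding \<rho>0(3)[symmetric] by (rule Least_le) (use that in \<open>auto simp: P_def\<close>)
  define \<epsilon> where "\<epsilon> = min e1 e2 - norm (\<rho>0 - \<rho>)"
  have \<epsilon>: "0 < \<epsilon>" using \<rho>0(1) by (simp add: U_def \<epsilon>_def)
  have inU: "m \<in> U" if "norm (m - \<rho>0) < \<epsilon>" for m
  proof -
    have "norm (m - \<rho>) \<le> norm (m - \<rho>0) + norm (\<rho>0 - \<rho>)" using norm_triangle_ineq[of "m - \<rho>0" "\<rho>0 - \<rho>"] by simp
    then have "norm (m - \<rho>) < min e1 e2" using that unfolding \<epsilon>_def by linarith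
    then show ?thesis by (simp add: U_def)
  qed
  let ?K = "{f. laplacian E \<omega> *v f = 0}"
  \<comment> \<open>A kernel of dimension at most \<open>d + 1\<close> would be inherited by a
    nearby stress of a nearby generic framework, which would force \<open>k_min\<close> to equal
    \<open>d + 1\<close>.\<close>
  have large: "CARD('d) + 2 \<le> dim ?K"
  proof (rule ccontr)
    assume "\<not> ?thesis"
    then have small: "dim ?K \<le> CARD('d) + 1" by simp
    obtain a C where a: "0 < a" "0 \<le> C"
      "\<And>p x. norm (p - \<rho>0) < a \<Longrightarrow> dim {x. stress_map E \<rho>0 x = 0} \<le> dim {x. stress_map E p x = 0} \<Longrightarrow>
         \<exists>x'. stress_map E p x' = 0 \<and> norm (x - x') \<le> C * norm (stress_map E p x)"
      using bilinear_kernel_stable[OF bounded_bilinear_stress_map[of E], of \<rho>0] by metis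
    obtain b where b: "0 < b"
      "\<And>p. norm (p - \<omega>) < b \<Longrightarrow> dim {x. laplacian E p *v x = 0} \<le> dim {x. laplacian E \<omega> *v x = 0}"
      using bilinear_kernel_stable[OF bounded_bilinear_laplacian[of E], of \<omega>] by metis
    obtain M where M: "0 < M" "\<And>(m :: ('d, 'v) framework) x. norm (stress_map E m x) \<le> norm m * norm x * M"
      using bounded_bilinear.pos_bounded[OF bounded_bilinear_stress_map[of E]] by blast
    define Q where "Q = C * (norm \<omega> * M) + 1"
    have Q: "0 < Q" using a(2) M(1) by (simp add: Q_def add_nonneg_pos)
    have "0 < min (min \<epsilon> a) (b / Q)" using \<epsilon> a(1) b(1) Q by simp
    then obtain m where m: "generic m" "norm (m - \<rho>0) < min (min \<epsilon> a) (b / Q)" using generic_dense by blast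
    have mU: "m \<in> U" using inU m(2) by simp
    have "dim {x. stress_map E \<rho>0 x = 0} \<le> dim {x. stress_map E m x = 0}"
      using dim_stresses[of E \<rho>0] dim_stresses[of E m] rank_const[OF mU \<rho>0(1)] by linarith
    then obtain \<omega>' where \<omega>': "stress_map E m \<omega>' = 0" "norm (\<omega> - \<omega>') \<le> C * norm (stress_map E m \<omega>)"
      using a(3)[of m \<omega>] m(2) by auto
    have "stress_map E m \<omega> = stress_map E (m - \<rho>0) \<omega>"
      using bounded_bilinear.diff_left[OF bounded_bilinear_stress_map, of E m \<rho>0 \<omega>] \<rho>0(2) by simp
    then have "norm (stress_map E m \<omega>) \<le> norm (m - \<rho>0) * norm \<omega> * M" using M(2) by simp
    then have "norm (\<omega> - \<omega>') \<le> C * (norm (m - \<rho>0) * norm \<omega> * M)"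
      using \<omega>'(2) a(2) by (meson mult_left_mono order_trans)
    also have "\<dots> = (C * (norm \<omega> * M)) * norm (m - \<rho>0)" by simp
    also have "\<dots> \<le> Q * norm (m - \<rho>0)" by (simp add: Q_def mult_right_mono)
    also have "\<dots> < b" using m(2) Q by (simp add: pos_less_divide_eq mult.commute)
    finally have "norm (\<omega>' - \<omega>) < b" by (simp add: norm_minus_commute)
    then have "dim {x. laplacian E \<omega>' *v x = 0} \<le> CARD('d) + 1" using b(2) small by fastforce
    moreover have "k_min E TYPE('d) \<le> dim {x. laplacian E \<omega>' *v x = 0}"
      by (rule k_min_bounds(2)[OF v m(1) equilibrium_stress_matrix_laplacian[OF E \<omega>'(1)]])
    ultimately have "k_min E TYPE('d) = CARD('d) + 1" using k_min_bounds(1)[OF v, of E] by simp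
    then show False using assms(3) by (simp add: minimal_stress_kernel_def)
  qed
  show False
  proof (rule no_large_flat_kernel[OF E ker(3)[OF \<rho>0(1)] ker(2)[OF \<rho>0(1)] ker(1)[OF \<rho>0(1)]])
    show "subspace ?K" by (rule linear_subspace_kernel) simp
    show "(\<chi> u. 1) \<in> ?K" using laplacian_const[OF E] by simp
    show "column i \<rho>0 \<in> ?K" for i using \<rho>0(2) by (simp add: stress_map_eq_0)
    show "CARD('d) + 2 \<le> dim ?K" by (rule large)
    show "\<exists>\<tau> :: ('d, 'v) framework. (\<forall>i. column i \<tau> \<in> ?K) \<and> edge_form E k k' = edge_form E \<rho>0 \<tau>"
      if "k \<in> ?K" "k' \<in> ?K" for k k'
    proof -
      have "\<exists>\<tau> :: ('d, 'v) framework. (\<forall>i. laplacian E \<omega> *v column i \<tau> = 0) \<and> edge_form E k k' = edge_form E \<rho>0 \<tau>"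
      proof (rule stress_kernel_flat[OF \<epsilon> _ \<rho>0(2)])
        show "dim (range (edge_form E m)) = dim (range (edge_form E \<rho>0))" if "norm (m - \<rho>0) < \<epsilon>" for m
          by (rule rank_const[OF inU[OF that] \<rho>0(1)])
        show "dim {f. laplacian E \<omega> *v f = 0} \<le> dim {f. laplacian E \<omega>' *v f = 0}"
          if "norm (m - \<rho>0) < \<epsilon>" "stress_map E m \<omega>' = 0" for m \<omega>'
          by (rule max[OF inU[OF that(1)] that(2)])
      qed (use that in auto)
      then show ?thesis by simp
    qed
  qed
qed

end
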